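(* Every almost strongly proper forcing preserves Suslinity; that is, if $\mathbb P$ is an almost strongly proper forcing and $S$ is a Suslin tree, then for every $V$-generic filter $G\subseteq\mathbb P$, $S$ is a Suslin tree in $V[G]$.
   Context: For a set $Z$, $[Z]^{\omega}$ is the set of countably infinite subsets of $Z$. An algebra over $Z$ is a function $F:[Z]^{<\omega}\to Z$; $A\subseteq Z$ is $F$-closed if $F(s)\in A$ for all finite $s\subseteq A$. For conditions $r,q$, $r\,\|\,q$ means that $r$ and $q$ are compatible. Let $\mathbb P$ be a forcing and $M\prec H_\vartheta$ with $[\mathbb P]^\omega\in M$. A condition $p\in\mathbb P$ is $(M,\mathbb P)$-almost strongly generic if for every $q\le p$ the set $$S_q=\{Y\in[\mathbb P]^\omega:\ \exists\, q'\in Y\ \ \forall r\in Y\ (r\le q'\Rightarrow r\,\|\,q)\}$$ is $M$-stationary, i.e. for every algebra $F\in M$ over $\mathbb P$ there is an $F$-closed $A\in M\cap S_q$. The forcing $\mathbb P$ is almost strongly proper (a.s.p.) if for every sufficiently large regular cardinal $\vartheta$ there is a club (in $[H_\vartheta]^\omega$) of countable models $M\prec H_\vartheta$ with $[\mathbb P]^\omega\in M$ such that every $p\in M\cap\mathbb P$ can be extended to an $(M,\mathbb P)$-almost strongly generic condition. *)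

theory Defs
  imports "HOL-Library.Equipollence" "HOL-Library.Countable_Set"
begin

section \<open>The universe of sets\<close>

text \<open>
  A type of this class is the set-theoretic universe \<open>V\<close>. Replacement and separation range over
  all HOL functions and predicates, so every HOL subset of \<open>elts x\<close> is (the extension of) an
  element of the universe. The axiom of choice is inherited from HOL's choice operator via
  replacement.
\<close>

class zfc_universe =
  fixes elts :: "'a \<Rightarrow> 'a set"
  assumes extensionality: "elts x = elts y \<Longrightarrow> x = y"
    and foundation: "wf {(x, y). x \<in> elts y}"
    and pairing: "\<exists>z. elts z = {x, y}"
    and union: "\<exists>z. elts z = (\<Union>y\<in>elts x. elts y)"
    and powerset: "\<exists>z. elts z = {y. elts y \<subseteq> elts x}"
    and separation: "\<exists>z. elts z = {y \<in> elts x. Q y}"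
    and replacement: "\<exists>z. elts z = f ` elts x"
    and infinity: "\<exists>w. (\<exists>e\<in>elts w. elts e = {}) \<and>
                       (\<forall>n\<in>elts w. \<exists>m\<in>elts w. elts m = insert n (elts n))"

text \<open>\<open>vset A\<close> is meaningful only if \<open>A\<close> is the extension of some element of the universe.\<close>

definition vset :: "'v::zfc_universe set \<Rightarrow> 'v" where
  "vset A = (THE z. elts z = A)"

definition vpair :: "'v::zfc_universe \<Rightarrow> 'v \<Rightarrow> 'v" where
  "vpair x y = vset {vset {x}, vset {x, y}}"

definition transitive_set :: "'v::zfc_universe \<Rightarrow> bool" where
  "transitive_set x \<longleftrightarrow> (\<forall>y\<in>elts x. elts y \<subseteq> elts x)"

text \<open>By foundation, an ordinal is a transitive set of transitive sets.\<close>

definition ordinal :: "'v::zfc_universe \<Rightarrow> bool" where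
  "ordinal x \<longleftrightarrow> transitive_set x \<and> (\<forall>y\<in>elts x. transitive_set y)"

definition cardinal :: "'v::zfc_universe \<Rightarrow> bool" where
  "cardinal x \<longleftrightarrow> ordinal x \<and> (\<forall>y\<in>elts x. elts y \<prec> elts x)"

definition regular_cardinal :: "'v::zfc_universe \<Rightarrow> bool" where
  "regular_cardinal \<theta> \<longleftrightarrow> cardinal \<theta> \<and> infinite (elts \<theta>) \<and>
     (\<forall>X \<subseteq> elts \<theta>. X \<prec> elts \<theta> \<longrightarrow> (\<exists>\<alpha>\<in>elts \<theta>. X \<subseteq> elts \<alpha>))"

definition trcl :: "'v::zfc_universe \<Rightarrow> 'v set" where
  "trcl x = {y. (y, x) \<in> {(a, b). a \<in> elts b}\<^sup>+}"

text \<open>\<open>hered \<theta>\<close> is \<open>H\<^sub>\<theta>\<close>.\<close>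

definition hered :: "'v::zfc_universe \<Rightarrow> 'v set" where
  "hered \<theta> = {x. trcl x \<prec> elts \<theta>}"


section \<open>The language of set theory\<close>

text \<open>
  Variables are natural numbers; \<open>FAll i \<phi>\<close> binds variable \<open>i\<close>. The same formulas are used for
  elementarity, for truth in \<open>V\<close> and for the forcing relation.
\<close>

datatype fm = FMem nat nat | FEq nat nat | FNeg fm | FAnd fm fm | FAll nat fm

primrec sat :: "'v::zfc_universe set \<Rightarrow> fm \<Rightarrow> (nat \<Rightarrow> 'v) \<Rightarrow> bool" where
  "sat M (FMem i j) e \<longleftrightarrow> e i \<in> elts (e j)"
| "sat M (FEq i j) e \<longleftrightarrow> e i = e j"
| "sat M (FNeg \<phi>) e \<longleftrightarrow> \<not> sat M \<phi> e"
| "sat M (FAnd \<phi> \<psi>) e \<longleftrightarrow> sat M \<phi> e \<and> sat M \<psi> e"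
| "sat M (FAll i \<phi>) e \<longleftrightarrow> (\<forall>x\<in>M. sat M \<phi> (e(i := x)))"

definition elementary_submodel :: "'v::zfc_universe set \<Rightarrow> 'v set \<Rightarrow> bool" where
  "elementary_submodel M N \<longleftrightarrow>
     M \<subseteq> N \<and> M \<noteq> {} \<and> (\<forall>\<phi> e. range e \<subseteq> M \<longrightarrow> (sat M \<phi> e \<longleftrightarrow> sat N \<phi> e))"

definition FOr :: "fm \<Rightarrow> fm \<Rightarrow> fm" where
  "FOr \<phi> \<psi> = FNeg (FAnd (FNeg \<phi>) (FNeg \<psi>))"

definition FImp :: "fm \<Rightarrow> fm \<Rightarrow> fm" where
  "FImp \<phi> \<psi> = FNeg (FAnd \<phi> (FNeg \<psi>))"

definition FIff :: "fm \<Rightarrow> fm \<Rightarrow> fm" where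
  "FIff \<phi> \<psi> = FAnd (FImp \<phi> \<psi>) (FImp \<psi> \<phi>)"

definition FEx :: "nat \<Rightarrow> fm \<Rightarrow> fm" where
  "FEx i \<phi> = FNeg (FAll i (FNeg \<phi>))"

definition FBall :: "nat \<Rightarrow> nat \<Rightarrow> fm \<Rightarrow> fm" where
  "FBall i x \<phi> = FAll i (FImp (FMem i x) \<phi>)"

definition FBex :: "nat \<Rightarrow> nat \<Rightarrow> fm \<Rightarrow> fm" where
  "FBex i x \<phi> = FEx i (FAnd (FMem i x) \<phi>)"

text \<open>
  In the formulas below the parameters are the free variables. Bound variables are chosen larger
  than all parameters, so that no capture can occur.
\<close>

definition fm_empty :: "nat \<Rightarrow> fm" where
  "fm_empty x = (let y = x + 1 in FAll y (FNeg (FMem y x)))"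

definition fm_subset :: "nat \<Rightarrow> nat \<Rightarrow> fm" where
  "fm_subset x y = (let z = x + y + 1 in FBall z x (FMem z y))"

definition fm_transitive :: "nat \<Rightarrow> fm" where
  "fm_transitive x = (let y = x + 1 in FBall y x (fm_subset y x))"

definition fm_ordinal :: "nat \<Rightarrow> fm" where
  "fm_ordinal x = (let y = x + 1 in FAnd (fm_transitive x) (FBall y x (fm_transitive y)))"

text \<open>\<open>y = x \<union> {x}\<close>\<close>

definition fm_succ :: "nat \<Rightarrow> nat \<Rightarrow> fm" where
  "fm_succ x y = (let z = x + y + 1 in FAll z (FIff (FMem z y) (FOr (FMem z x) (FEq z x))))"

text \<open>\<open>w\<close> is the least limit ordinal.\<close>

definition fm_omega :: "nat \<Rightarrow> fm" where
  "fm_omega w = (let n = w + 1; m = w + 2 in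
     FAnd (fm_ordinal w)
    (FAnd (FBex n w (fm_empty n))
    (FAnd (FBall n w (FBex m w (fm_succ n m)))
          (FBall n w (FOr (fm_empty n) (FBex m w (fm_succ m n)))))))"

text \<open>\<open>z = {x, y}\<close>\<close>

definition fm_upair :: "nat \<Rightarrow> nat \<Rightarrow> nat \<Rightarrow> fm" where
  "fm_upair z x y = (let w = x + y + z + 1 in FAll w (FIff (FMem w z) (FOr (FEq w x) (FEq w y))))"

text \<open>\<open>z = (x, y)\<close> (Kuratowski)\<close>

definition fm_pair :: "nat \<Rightarrow> nat \<Rightarrow> nat \<Rightarrow> fm" where
  "fm_pair z x y = (let a = x + y + z + 1; b = x + y + z + 2 in
     FEx a (FEx b (FAnd (fm_upair a x x) (FAnd (fm_upair b x y) (fm_upair z a b)))))"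

text \<open>\<open>(x, y) \<in> r\<close>\<close>

definition fm_rel :: "nat \<Rightarrow> nat \<Rightarrow> nat \<Rightarrow> fm" where
  "fm_rel r x y = (let z = r + x + y + 1 in FBex z r (fm_pair z x y))"

text \<open>\<open>f\<close> is a function from \<open>x\<close> to \<open>y\<close>.\<close>

definition fm_function :: "nat \<Rightarrow> nat \<Rightarrow> nat \<Rightarrow> fm" where
  "fm_function f x y =
    (let z = f + x + y + 1; a = f + x + y + 2; b = f + x + y + 3; c = f + x + y + 4 in
     FAnd (FBall z f (FBex a x (FBex b y (fm_pair z a b))))
          (FBall a x (FBex b y (FAnd (fm_rel f a b) (FBall c y (FImp (fm_rel f a c) (FEq c b)))))))"

definition fm_injective_on :: "nat \<Rightarrow> nat \<Rightarrow> fm" where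
  "fm_injective_on f x = (let a = f + x + 1; b = f + x + 2; c = f + x + 3 in
     FBall a x (FBall b x (FAll c (FImp (FAnd (fm_rel f a c) (fm_rel f b c)) (FEq a b)))))"

definition fm_countable :: "nat \<Rightarrow> fm" where
  "fm_countable x = (let w = x + 1; f = x + 2 in
     FEx w (FEx f (FAnd (fm_omega w) (FAnd (fm_function f x w) (fm_injective_on f x)))))"

text \<open>\<open>h\<close> is the set of all countable ordinals.\<close>

definition fm_omega1 :: "nat \<Rightarrow> fm" where
  "fm_omega1 h = (let a = h + 1 in
     FAll a (FIff (FMem a h) (FAnd (fm_ordinal a) (fm_countable a))))"

text \<open>
  \<open>r\<close> is a strict partial order on \<open>t\<close> such that the predecessors of every element of \<open>t\<close> are
  well-ordered by \<open>r\<close>: every nonempty set of them has an element that is \<open>r\<close>-below all others.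
\<close>

definition fm_tree :: "nat \<Rightarrow> nat \<Rightarrow> fm" where
  "fm_tree t r =
    (let x = t + r + 1; y = t + r + 2; z = t + r + 3; X = t + r + 4 in
     FAnd (FBall x t (FNeg (fm_rel r x x)))
    (FAnd (FBall x t (FBall y t (FBall z t
            (FImp (FAnd (fm_rel r x y) (fm_rel r y z)) (fm_rel r x z)))))
          (FBall x t (FAll X
            (FImp (FAnd (FEx y (FMem y X)) (FBall y X (FAnd (FMem y t) (fm_rel r y x))))
                  (FBex y X (FBall z X (FOr (FEq z y) (fm_rel r y z)))))))))"

text \<open>
  \<open>s\<close> has height \<open>a\<close> in the tree \<open>(t, r)\<close>: there is an order isomorphism \<open>f\<close> from the set \<open>d\<close> of
  predecessors of \<open>s\<close>, ordered by \<open>r\<close>, onto the ordinal \<open>a\<close>.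
\<close>

definition fm_node_height :: "nat \<Rightarrow> nat \<Rightarrow> nat \<Rightarrow> nat \<Rightarrow> fm" where
  "fm_node_height t r s a =
    (let k = t + r + s + a; d = k + 1; f = k + 2; u = k + 3; v = k + 4; b = k + 5; c = k + 6 in
     FAnd (fm_ordinal a)
     (FEx d (FEx f
       (FAnd (FAll u (FIff (FMem u d) (FAnd (FMem u t) (fm_rel r u s))))
       (FAnd (fm_function f d a)
       (FAnd (FBall b a (FBex u d (fm_rel f u b)))
             (FBall u d (FBall v d (FBall b a (FBall c a
               (FImp (FAnd (fm_rel f u b) (fm_rel f v c))
                     (FIff (fm_rel r u v) (FMem b c))))))))))))) "

text \<open>The heights of the nodes of \<open>(t, r)\<close> are exactly the elements of the ordinal \<open>h\<close>.\<close>

definition fm_tree_height :: "nat \<Rightarrow> nat \<Rightarrow> nat \<Rightarrow> fm" where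
  "fm_tree_height t r h = (let s = t + r + h + 1; a = t + r + h + 2 in
     FAnd (FBall s t (FBex a h (fm_node_height t r s a)))
          (FBall a h (FBex s t (fm_node_height t r s a))))"

definition fm_chain :: "nat \<Rightarrow> nat \<Rightarrow> nat \<Rightarrow> fm" where
  "fm_chain t r A = (let x = t + r + A + 1; y = t + r + A + 2 in
     FAnd (fm_subset A t)
          (FBall x A (FBall y A (FOr (FEq x y) (FOr (fm_rel r x y) (fm_rel r y x))))))"

definition fm_antichain :: "nat \<Rightarrow> nat \<Rightarrow> nat \<Rightarrow> fm" where
  "fm_antichain t r A = (let x = t + r + A + 1; y = t + r + A + 2 in
     FAnd (fm_subset A t) (FBall x A (FBall y A (FNeg (fm_rel r x y)))))"

text \<open>\<open>(t, r)\<close> is a tree of height \<open>\<omega>\<^sub>1\<close> without uncountable chains or antichains.\<close>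

definition fm_suslin_tree :: "nat \<Rightarrow> nat \<Rightarrow> fm" where
  "fm_suslin_tree t r = (let h = t + r + 1; A = t + r + 2 in
     FAnd (fm_tree t r)
    (FAnd (FEx h (FAnd (fm_omega1 h) (fm_tree_height t r h)))
    (FAnd (FAll A (FImp (fm_chain t r A) (fm_countable A)))
          (FAll A (FImp (fm_antichain t r A) (fm_countable A))))))"

definition env2 :: "'v \<Rightarrow> 'v \<Rightarrow> nat \<Rightarrow> 'v" where
  "env2 x y = (\<lambda>i. if i = 0 then x else y)"

definition suslin_tree :: "'v::zfc_universe \<Rightarrow> 'v \<Rightarrow> bool" where
  "suslin_tree T R \<longleftrightarrow> sat UNIV (fm_suslin_tree 0 1) (env2 T R)"


section \<open>Forcing\<close>

text \<open>
  A forcing notion is a nonempty preorder whose carrier \<open>P\<close> is a set; \<open>le p q\<close> means that \<open>p\<close>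
  extends \<open>q\<close>. Only the restriction of \<open>le\<close> to \<open>P\<close> matters. A greatest condition is not required.
\<close>

definition forcing_notion :: "'v::zfc_universe \<Rightarrow> ('v \<Rightarrow> 'v \<Rightarrow> bool) \<Rightarrow> bool" where
  "forcing_notion P le \<longleftrightarrow> elts P \<noteq> {} \<and> (\<forall>p\<in>elts P. le p p) \<and>
     (\<forall>p\<in>elts P. \<forall>q\<in>elts P. \<forall>r\<in>elts P. le p q \<longrightarrow> le q r \<longrightarrow> le p r)"

inductive is_name :: "'v::zfc_universe \<Rightarrow> 'v \<Rightarrow> bool" for P where
  "(\<forall>z\<in>elts \<tau>. \<exists>\<sigma> p. z = vpair \<sigma> p \<and> p \<in> elts P \<and> is_name P \<sigma>) \<Longrightarrow> is_name P \<tau>"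

text \<open>
  The canonical name of a ground model set. As there need not be a greatest condition, every
  condition is attached to every element.
\<close>

function check_name :: "'v::zfc_universe \<Rightarrow> 'v \<Rightarrow> 'v" where
  "check_name P x = vset (\<Union>y\<in>elts x. (\<lambda>p. vpair (check_name P y) p) ` elts P)"
  by auto
termination
  by (relation "inv_image {(a, b). a \<in> elts b} snd") (auto intro: foundation wf_inv_image)

declare check_name.simps [simp del]

text \<open>
  The forcing relation for atomic formulas, by recursion on names. Since the membership relation is
  well-founded, the defining clauses have exactly one solution, so the least one is the intended one.
\<close>

inductive forces_eq :: "'v::zfc_universe \<Rightarrow> ('v \<Rightarrow> 'v \<Rightarrow> bool) \<Rightarrow> 'v \<Rightarrow> 'v \<Rightarrow> 'v \<Rightarrow> bool"
  and forces_mem :: "'v::zfc_universe \<Rightarrow> ('v \<Rightarrow> 'v \<Rightarrow> bool) \<Rightarrow> 'v \<Rightarrow> 'v \<Rightarrow> 'v \<Rightarrow> bool"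
  for P le where
  forces_eqI:
    "(\<forall>\<pi> s. vpair \<pi> s \<in> elts \<tau> \<longrightarrow>
        (\<forall>q\<in>elts P. le q p \<longrightarrow> le q s \<longrightarrow> forces_mem P le q \<pi> \<sigma>)) \<Longrightarrow>
     (\<forall>\<pi> s. vpair \<pi> s \<in> elts \<sigma> \<longrightarrow>
        (\<forall>q\<in>elts P. le q p \<longrightarrow> le q s \<longrightarrow> forces_mem P le q \<pi> \<tau>)) \<Longrightarrow>
     forces_eq P le p \<tau> \<sigma>"
| forces_memI:
    "(\<forall>q\<in>elts P. le q p \<longrightarrow>
        (\<exists>r\<in>elts P. le r q \<and>
           (\<exists>\<sigma> s. vpair \<sigma> s \<in> elts \<tau> \<and> le r s \<and> forces_eq P le r \<pi> \<sigma>))) \<Longrightarrow>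
     forces_mem P le p \<pi> \<tau>"

primrec forces :: "'v::zfc_universe \<Rightarrow> ('v \<Rightarrow> 'v \<Rightarrow> bool) \<Rightarrow> 'v \<Rightarrow> fm \<Rightarrow> (nat \<Rightarrow> 'v) \<Rightarrow> bool" where
  "forces P le p (FMem i j) e \<longleftrightarrow> forces_mem P le p (e i) (e j)"
| "forces P le p (FEq i j) e \<longleftrightarrow> forces_eq P le p (e i) (e j)"
| "forces P le p (FNeg \<phi>) e \<longleftrightarrow> (\<forall>q\<in>elts P. le q p \<longrightarrow> \<not> forces P le q \<phi> e)"
| "forces P le p (FAnd \<phi> \<psi>) e \<longleftrightarrow> forces P le p \<phi> e \<and> forces P le p \<psi> e"
| "forces P le p (FAll i \<phi>) e \<longleftrightarrow> (\<forall>\<tau>. is_name P \<tau> \<longrightarrow> forces P le p \<phi> (e(i := \<tau>)))"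

text \<open>
  ``\<open>\<phi>\<close> holds in \<open>V[G]\<close> for every \<open>V\<close>-generic filter \<open>G \<subseteq> P\<close>'', for \<open>V\<close> the full universe:
  every condition forces \<open>\<phi>\<close>. (A filter on an atomless \<open>P\<close> that is itself a HOL set is never generic
  over a universe in this sense, so \<open>V[G]\<close> is accessible only through names and the forcing relation.)
\<close>

definition holds_in_all_generic_extensions ::
  "'v::zfc_universe \<Rightarrow> ('v \<Rightarrow> 'v \<Rightarrow> bool) \<Rightarrow> fm \<Rightarrow> (nat \<Rightarrow> 'v) \<Rightarrow> bool" where
  "holds_in_all_generic_extensions P le \<phi> e \<longleftrightarrow> (\<forall>p\<in>elts P. forces P le p \<phi> e)"

definition preserves_suslinity :: "'v::zfc_universe \<Rightarrow> ('v \<Rightarrow> 'v \<Rightarrow> bool) \<Rightarrow> bool" where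
  "preserves_suslinity P le \<longleftrightarrow>
     (\<forall>T R. suslin_tree T R \<longrightarrow>
        holds_in_all_generic_extensions P le (fm_suslin_tree 0 1)
          (env2 (check_name P T) (check_name P R)))"


section \<open>Almost strongly proper forcing\<close>

text \<open>\<open>[Z]\<^sup>\<omega>\<close>, for a HOL set \<open>Z\<close>\<close>

definition ctbl_infinite_subsets :: "'a set \<Rightarrow> 'a set set" where
  "ctbl_infinite_subsets Z = {X. X \<subseteq> Z \<and> countable X \<and> infinite X}"

definition club_in_ctbl_subsets :: "'a set \<Rightarrow> 'a set set \<Rightarrow> bool" where
  "club_in_ctbl_subsets Z C \<longleftrightarrow> C \<subseteq> ctbl_infinite_subsets Z \<and>
     (\<forall>X\<in>ctbl_infinite_subsets Z. \<exists>Y\<in>C. X \<subseteq> Y) \<and>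
     (\<forall>X :: nat \<Rightarrow> 'a set. (\<forall>n. X n \<in> C \<and> X n \<subseteq> X (Suc n)) \<longrightarrow> (\<Union>n. X n) \<in> C)"

text \<open>\<open>[P]\<^sup>\<omega>\<close> as an element of the universe\<close>

definition v_ctbl_infinite_subsets :: "'v::zfc_universe \<Rightarrow> 'v" where
  "v_ctbl_infinite_subsets P = vset {Y. elts Y \<in> ctbl_infinite_subsets (elts P)}"

text \<open>An algebra \<open>F : [Z]\<^sup><\<^sup>\<omega> \<rightarrow> Z\<close> is a set of pairs in the universe, so that it can belong to \<open>M\<close>.\<close>

definition algebra_over :: "'v::zfc_universe \<Rightarrow> 'v \<Rightarrow> bool" where
  "algebra_over Z F \<longleftrightarrow>
     (\<forall>z\<in>elts F. \<exists>s y. z = vpair s y \<and> elts s \<subseteq> elts Z \<and> finite (elts s) \<and> y \<in> elts Z) \<and>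
     (\<forall>s. elts s \<subseteq> elts Z \<and> finite (elts s) \<longrightarrow> (\<exists>!y. vpair s y \<in> elts F))"

definition closed_under :: "'v::zfc_universe \<Rightarrow> 'v \<Rightarrow> bool" where
  "closed_under F A \<longleftrightarrow>
     (\<forall>s y. elts s \<subseteq> elts A \<and> finite (elts s) \<and> vpair s y \<in> elts F \<longrightarrow> y \<in> elts A)"

definition compatible :: "'v::zfc_universe \<Rightarrow> ('v \<Rightarrow> 'v \<Rightarrow> bool) \<Rightarrow> 'v \<Rightarrow> 'v \<Rightarrow> bool" where
  "compatible P le p q \<longleftrightarrow> (\<exists>r\<in>elts P. le r p \<and> le r q)"

definition reflecting_sets :: "'v::zfc_universe \<Rightarrow> ('v \<Rightarrow> 'v \<Rightarrow> bool) \<Rightarrow> 'v \<Rightarrow> 'v set" where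
  "reflecting_sets P le q =
     {Y. elts Y \<in> ctbl_infinite_subsets (elts P) \<and>
         (\<exists>q'\<in>elts Y. \<forall>r\<in>elts Y. le r q' \<longrightarrow> compatible P le r q)}"

definition M_stationary :: "'v::zfc_universe set \<Rightarrow> 'v \<Rightarrow> 'v set \<Rightarrow> bool" where
  "M_stationary M Z S \<longleftrightarrow>
     (\<forall>F\<in>M. algebra_over Z F \<longrightarrow> (\<exists>A \<in> M \<inter> S. closed_under F A))"

definition almost_strongly_generic ::
  "'v::zfc_universe set \<Rightarrow> 'v \<Rightarrow> ('v \<Rightarrow> 'v \<Rightarrow> bool) \<Rightarrow> 'v \<Rightarrow> bool" where
  "almost_strongly_generic M P le p \<longleftrightarrow> p \<in> elts P \<and>
     (\<forall>q\<in>elts P. le q p \<longrightarrow> M_stationary M P (reflecting_sets P le q))"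

definition almost_strongly_proper :: "'v::zfc_universe \<Rightarrow> ('v \<Rightarrow> 'v \<Rightarrow> bool) \<Rightarrow> bool" where
  "almost_strongly_proper P le \<longleftrightarrow>
     (\<exists>\<kappa>. ordinal \<kappa> \<and>
       (\<forall>\<theta>. regular_cardinal \<theta> \<and> \<kappa> \<in> elts \<theta> \<longrightarrow>
         (\<exists>C. club_in_ctbl_subsets (hered \<theta>) C \<and>
           (\<forall>M\<in>C. elementary_submodel M (hered \<theta>) \<and> v_ctbl_infinite_subsets P \<in> M \<and>
             (\<forall>p \<in> M \<inter> elts P. \<exists>q\<in>elts P. le q p \<and> almost_strongly_generic M P le q)))))"

end

theory Submission
  imports Defs
begin

text \<open>
  Let \<open>p\<close> force that \<open>\<xi>\<close> is an antichain of the Suslin tree \<open>T\<close>. For a condition \<open>q \<le> p\<close>, call a node \<open>s\<close>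
  \<^emph>\<open>decided\<close> by \<open>r \<le> q\<close> if \<open>r\<close> forces some \<open>s' \<le> s\<close> into \<open>\<xi>\<close> or forces all \<open>s' \<ge> s\<close> out of \<open>\<xi>\<close>. The nodes
  decided by some \<open>r \<le> q\<close> form a dense upward closed set, whose minimal elements are countably many;
  so countably many \<open>r \<le> q\<close> suffice to force each \<open>t\<close> out of \<open>\<xi>\<close>, with countably many exceptions \<open>t\<close>.
  Put all these countably many \<open>r\<close> into an algebra \<open>F\<close>, and let \<open>q\<^sub>0 \<le> p\<close> be almost strongly generic over a
  countable \<open>M\<close> that contains \<open>F\<close>. If \<open>q\<^sub>1 \<le> q\<^sub>0\<close>, then some \<open>F\<close>-closed \<open>Y \<in> M\<close> has an element \<open>q\<close> all of whose
  extensions in \<open>Y\<close> are compatible with \<open>q\<^sub>1\<close>. Hence \<open>q\<^sub>1\<close> cannot force \<open>t\<close> into \<open>\<xi>\<close> unless \<open>t\<close> is an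
  exception for some member of a countable \<open>Y \<in> M\<close>; there are only countably many such \<open>t\<close>. The same bound,
  applied to a name for an injection of \<open>\<omega>\<^sub>1\<close> into \<open>\<omega>\<close>, shows that \<open>\<omega>\<^sub>1\<close> is preserved, and the chain
  condition is dealt with like the antichain condition.
\<close>

section \<open>Sets and regular cardinals\<close>

text \<open>The exceptional set is fixed before \<open>q\<^sub>1\<close> is given: it is a union
  over the countable \<open>Y \<in> M\<close>, their members and the natural numbers. Given
  \<open>q\<^sub>1\<close>, closure of \<open>Y\<close> under \<open>F\<close> puts the right
  witness \<open>r \<le> q\<close> into \<open>Y\<close>, and compatibility of \<open>r\<close> with
  \<open>q\<^sub>1\<close> carries the refusal of \<open>t\<close> over to a common extension. The
  reflecting condition \<open>q\<close> is known only to be compatible with \<open>p\<close>, so its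
  witnesses are sought below a common extension of \<open>q\<close> and \<open>p\<close>. A forced
  chain needs another notion of decision: it cannot meet the cones of two incomparable nodes, so
  above every node there is a cone that some condition refuses or that is itself a chain, hence
  countable. For a forced injection, a condition that decides the preimage of \<open>n\<close>
  leaves one exception only; the values \<open>n\<close> are why the bound concerns countably many
  sets at once. There is no generic filter to compute with. Each statement about the extension is
  argued densely below a condition, and facts of the ground model reach it through absoluteness of
  formulas whose quantifiers are bounded in effect.\<close>

unbundle cardinal_syntax

definition small :: "'v::zfc_universe set \<Rightarrow> bool" where
  "small A \<longleftrightarrow> (\<exists>x. elts x = A)"

lemma small_elts [simp]: "small (elts x)"
  by (auto simp: small_def)

lemma elts_inject: "elts x = elts y \<longleftrightarrow> x = y"
  using extensionality by auto

lemma elts_vset: "small A \<Longrightarrow> elts (vset A) = A"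
  unfolding small_def vset_def by (metis (mono_tags, lifting) elts_inject the_equality)

lemma vset_elts [simp]: "vset (elts x) = x"
  by (simp add: elts_vset extensionality)

lemma small_subset: "small B \<Longrightarrow> A \<subseteq> B \<Longrightarrow> small A"
proof -
  assume "small B" "A \<subseteq> B"
  then obtain x where "elts x = B" by (auto simp: small_def)
  moreover obtain z where "elts z = {y \<in> elts x. y \<in> A}" using separation[of x "\<lambda>y. y \<in> A"] by blast
  ultimately show ?thesis using \<open>A \<subseteq> B\<close> by (auto simp: small_def intro!: exI[of _ z])
qed

lemma small_image: "small A \<Longrightarrow> small (f ` A)" for f :: "'v::zfc_universe \<Rightarrow> 'v"
  unfolding small_def using replacement[of f] by fastforce

lemma small_lepoll:
  fixes A B :: "'v::zfc_universe set"
  assumes "small B" "A \<lesssim> B" shows "small A"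
proof -
  obtain g where "A \<subseteq> g ` B" using assms(2) by (auto simp: lepoll_iff)
  then show ?thesis using small_subset[OF small_image[OF assms(1), of g]] by blast
qed

lemma small_pair [simp]: "small {x, y}"
  using pairing by (auto simp: small_def)

lemma small_singleton [simp]: "small {x}"
  using small_pair[of x x] by simp

lemma small_UN:
  fixes B :: "'v::zfc_universe \<Rightarrow> 'v set"
  assumes "small A" "\<And>x. x \<in> A \<Longrightarrow> small (B x)" shows "small (\<Union>x\<in>A. B x)"
proof -
  obtain z where z: "elts z = (\<lambda>x. vset (B x)) ` A" using small_image[OF assms(1)] unfolding small_def by blast
  obtain u where "elts u = (\<Union>y\<in>elts z. elts y)" using union[of z] by blast
  also have "\<dots> = (\<Union>x\<in>A. B x)" using assms(2) by (simp add: z elts_vset)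
  finally show ?thesis by (auto simp: small_def)
qed

lemma small_Un: "small A \<Longrightarrow> small B \<Longrightarrow> small (A \<union> B)"
proof -
  assume "small A" "small B"
  then obtain x y where "elts x = A" "elts y = B" by (auto simp: small_def)
  then show ?thesis using small_UN[of "{x, y}" elts] by simp
qed

lemma small_insert: "small A \<Longrightarrow> small (insert x A)"
  using small_Un[of "{x}" A] by simp

lemma small_empty [simp]: "small {}"
  using small_subset[of "elts undefined" "{}"] by simp

lemma small_finite: "finite A \<Longrightarrow> small A"
  by (induction rule: finite_induct) (auto intro: small_insert)

lemma small_Collect_subset: "small B \<Longrightarrow> small {y. elts y \<subseteq> B}"
  unfolding small_def using powerset by fastforce

text \<open>If an inductive set were finite, membership on it would be finite and acyclic, hence
  conversely well-founded. A membership-maximal element would then exist, and its successor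
  contradicts maximality.\<close>

lemma ex_small_infinite: "\<exists>w :: 'v::zfc_universe. infinite (elts w)"
proof -
  obtain w :: 'v where w: "\<exists>e\<in>elts w. elts e = {}"
      "\<forall>n\<in>elts w. \<exists>m\<in>elts w. elts m = insert n (elts n)"
    using infinity by blast
  have "False" if fin: "finite (elts w)"
  proof -
    define E where "E = {(x, y). x \<in> elts y \<and> x \<in> elts w \<and> y \<in> elts w}"
    have "wf E" by (rule wf_subset[OF foundation]) (auto simp: E_def)
    moreover have "finite E" by (rule finite_subset[of _ "elts w \<times> elts w"]) (auto simp: E_def fin)
    ultimately have "wf (E\<inverse>)" using finite_acyclic_wf_converse wf_acyclic by blast
    then obtain n where n: "n \<in> elts w" "\<And>m. (m, n) \<in> E\<inverse> \<Longrightarrow> m \<notin> elts w"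
      using w(1) by (metis wf_eq_minimal)
    obtain m where m: "m \<in> elts w" "n \<in> elts m" using w(2) n(1) by (metis insertI1)
    then have "(m, n) \<in> E\<inverse>" using n(1) by (simp add: E_def)
    then show False using n(2) m(1) by blast
  qed
  then show ?thesis by blast
qed

lemma mem_induct [case_names mem]:
  assumes "\<And>x. (\<And>y. y \<in> elts x \<Longrightarrow> P y) \<Longrightarrow> P x" shows "P (x :: 'v::zfc_universe)"
  using foundation by (rule wf_induct_rule) (use assms in auto)

lemma mem_irrefl: "x \<notin> elts (x :: 'v::zfc_universe)"
  using wf_irrefl[OF foundation, of x] by simp

lemma vpair_inject [simp]: "vpair a b = vpair c d \<longleftrightarrow> a = c \<and> b = d"
proof -
  have "vset {x} = vset {y} \<longleftrightarrow> x = y" for x y :: 'a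
    by (metis elts_vset small_singleton singleton_inject)
  moreover have "vset {x, y} = vset {z, w} \<longleftrightarrow> {x, y} = {z, w}" for x y z w :: 'a
    by (metis elts_vset small_pair)
  moreover have "vset {x, y} = vset {z} \<longleftrightarrow> {x, y} = {z}" "vset {z} = vset {x, y} \<longleftrightarrow> {x, y} = {z}" for x y z :: 'a
    by (metis elts_vset small_pair small_singleton)+
  ultimately show ?thesis unfolding vpair_def by (auto simp: doubleton_eq_iff)
qed

lemma elts_vpair: "elts (vpair x y) = {vset {x}, vset {x, y}}"
  by (simp add: vpair_def elts_vset)

lemma fst_in_trcl_vpair: "(x, z) \<in> {(a, b). a \<in> elts b}\<^sup>+" if "vpair x y \<in> elts z"
proof -
  have "(x, vset {x}) \<in> {(a, b). a \<in> elts b}" by (simp add: elts_vset)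
  moreover have "(vset {x}, vpair x y) \<in> {(a, b). a \<in> elts b}" by (simp add: elts_vpair)
  moreover have "(vpair x y, z) \<in> {(a, b). a \<in> elts b}" using that by simp
  ultimately show ?thesis by (meson r_into_trancl' trancl_into_trancl)
qed

text \<open>The first component of a pair in \<open>x\<close> lies three membership steps below
  \<open>x\<close>, so induction on names runs along the transitive closure of membership.\<close>

lemma name_induct [case_names name]:
  assumes "\<And>x. (\<And>y s. vpair y s \<in> elts x \<Longrightarrow> Q y) \<Longrightarrow> Q x" shows "Q (x :: 'v::zfc_universe)"
  using wf_trancl[OF foundation]
  by (rule wf_induct_rule) (use assms fst_in_trcl_vpair in blast)

lemma trcl_unfold: "trcl x = elts x \<union> (\<Union>y\<in>elts x. trcl y)"
proof -
  have "(y, x) \<in> {(a, b). a \<in> elts b}\<^sup>+ \<longleftrightarrow> y \<in> elts x \<or> (\<exists>z\<in>elts x. (y, z) \<in> {(a, b). a \<in> elts b}\<^sup>+)" for y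
    by (metis (mono_tags, lifting) case_prodD case_prodI mem_Collect_eq r_into_trancl' tranclE trancl_into_trancl)
  then show ?thesis by (auto simp: trcl_def)
qed

lemma small_trcl: "small (trcl x)"
proof (induction x rule: mem_induct)
  case (mem x)
  then show ?case by (subst trcl_unfold) (intro small_Un small_UN small_elts)
qed

section \<open>Ordinals and regular cardinals\<close>

lemma ordinal_mem: "ordinal a \<Longrightarrow> b \<in> elts a \<Longrightarrow> ordinal b"
  unfolding ordinal_def transitive_set_def by blast

lemma ordinal_trans: "ordinal a \<Longrightarrow> b \<in> elts a \<Longrightarrow> c \<in> elts b \<Longrightarrow> c \<in> elts a"
  by (auto simp: ordinal_def transitive_set_def)

text \<open>If neither ordinal is a member of the other, the two induction hypotheses put each
  member of one into the other. The same double induction returns, in forced form, in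
  \<open>frc_ordinal_trichotomy\<close>.\<close>

lemma ordinal_linear: "ordinal a \<Longrightarrow> ordinal b \<Longrightarrow> a \<in> elts b \<or> a = b \<or> b \<in> elts (a :: 'v::zfc_universe)"
proof (induction a arbitrary: b rule: mem_induct)
  case (mem a)
  note IHa = mem.IH
  have oa: "ordinal a" by fact
  from \<open>ordinal b\<close> show ?case
  proof (induction b rule: mem_induct)
    case (mem b)
    have "elts a = elts b" if "a \<notin> elts b" "b \<notin> elts a"
    proof (intro subset_antisym subsetI)
      fix x assume "x \<in> elts a"
      then show "x \<in> elts b" using IHa[of x b] mem.prems oa that ordinal_mem ordinal_trans by metis
    next
      fix x assume "x \<in> elts b"
      then show "x \<in> elts a" using mem.IH[of x] mem.prems oa that ordinal_mem ordinal_trans by metis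
    qed
    then show ?case using extensionality by blast
  qed
qed

lemma trcl_ordinal: "ordinal a \<Longrightarrow> trcl a \<subseteq> elts a"
proof (induction a rule: mem_induct)
  case (mem a)
  have "trcl y \<subseteq> elts a" if "y \<in> elts a" for y
    using mem.IH[OF that] mem.prems that ordinal_mem ordinal_trans by blast
  then show ?case by (subst trcl_unfold) blast
qed

text \<open>The map \<open>c\<close> is the Mostowski collapse of \<open>r\<close>; it transports
  the HOL theory of cardinals into the universe. The embedding into \<open>elts x\<close> makes all
  images of the field small, so that the collapse exists as a set.\<close>

lemma regular_cardinal_of_wellorder:
  fixes r :: "'b rel" and x :: "'v::zfc_universe"
  assumes r: "Card_order r" and inf: "infinite (Field r)" and reg: "regularCard r"
    and le: "Field r \<lesssim> elts x"
  shows "\<exists>\<theta> :: 'v. regular_cardinal \<theta> \<and> elts \<theta> \<approx> Field r"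
proof -
  have wo: "Well_order r" using r by (simp add: card_order_on_well_order_on)
  then have w: "wo_rel r" by (simp add: wo_rel_def)
  note TOTALS = wo_rel.TOTALS[OF w] and TRANS = wo_rel.TRANS[OF w] and ANTISYM = wo_rel.ANTISYM[OF w]
  have wfr: "wf (r - Id)" using wo by (simp add: well_order_on_def)
  define c :: "'b \<Rightarrow> 'v" where "c = wfrec (r - Id) (\<lambda>f a. vset (f ` underS r a))"
  have us: "underS r a = {b. (b, a) \<in> r - Id}" for a by (auto simp: underS_def)
  have sm: "small (f ` K)" if "K \<subseteq> Field r" for K and f :: "'b \<Rightarrow> 'v"
    using small_lepoll[OF small_elts[of x]] that le
    by (meson image_lepoll lepoll_trans subset_imp_lepoll)
  have "c a = vset (c ` underS r a)" for a
    unfolding c_def by (subst wfrec[OF wfr]) (auto intro!: arg_cong[where f = vset] image_cong simp: cut_apply us)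
  then have ec: "elts (c a) = c ` underS r a" for a
    using sm[OF Order_Relation.underS_Field[of r a]] by (metis elts_vset)
  have lt: "c a \<in> elts (c b)" if "(a, b) \<in> r" "a \<noteq> b" for a b
    using that by (auto simp: ec underS_def)
  have inj: "inj_on c (Field r)"
  proof (rule inj_onI, rule ccontr)
    fix a b assume "a \<in> Field r" "b \<in> Field r" "c a = c b" "a \<noteq> b"
    then show False using TOTALS lt mem_irrefl by metis
  qed
  define \<theta> where "\<theta> = vset (c ` Field r)"
  have et: "elts \<theta> = c ` Field r" by (simp add: \<theta>_def elts_vset sm)
  have tr: "transitive_set (c a)" for a
    using TRANS ANTISYM by (auto simp: transitive_set_def ec underS_def trans_def antisym_def)
  have ord: "ordinal \<theta>"
    using tr Order_Relation.underS_Field[of r] by (fastforce simp: ordinal_def transitive_set_def et ec)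
  have eqp: "elts \<theta> \<approx> Field r" using inj by (auto simp: et intro: inj_on_image_eqpoll_self)
  have card: "elts y \<prec> elts \<theta>" if "y \<in> elts \<theta>" for y
  proof -
    from that obtain a where a: "a \<in> Field r" "y = c a" by (auto simp: et)
    have "|underS r a| <o |Field r|"
      using card_of_underS[OF r a(1)] card_of_Field_ordIso[OF r] ordIso_symmetric ordLess_ordIso_trans by blast
    then have "\<not> underS r a \<approx> Field r"
      by (simp add: eqpoll_iff_card_of_ordIso not_ordLess_ordIso)
    moreover have "elts y \<approx> underS r a"
      using inj_on_image_eqpoll_self[of c "underS r a"] inj Order_Relation.underS_Field[of r a]
      by (simp add: a ec inj_on_subset)
    moreover have "elts y \<subseteq> elts \<theta>" using ord that by (auto simp: ordinal_def transitive_set_def)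
    ultimately show ?thesis using eqp unfolding lesspoll_def
      by (metis (full_types) eqpoll_sym eqpoll_trans subset_imp_lepoll)
  qed
  have "\<exists>\<alpha>\<in>elts \<theta>. X \<subseteq> elts \<alpha>" if X: "X \<subseteq> elts \<theta>" "X \<prec> elts \<theta>" for X
  proof -
    define K where "K = {a \<in> Field r. c a \<in> X}"
    have XK: "X = c ` K" using X(1) by (auto simp: K_def et)
    have "K \<approx> X" using inj by (metis (no_types, lifting) K_def XK eqpoll_sym inj_on_image_eqpoll_self inj_on_subset mem_Collect_eq subsetI)
    have "\<not> |K| =o r"
    proof
      assume "|K| =o r"
      then have "|K| =o |Field r|"
        using card_of_Field_ordIso[OF r] ordIso_symmetric ordIso_transitive by blast
      then have "K \<approx> Field r" by (simp add: eqpoll_iff_card_of_ordIso)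
      then have "X \<approx> elts \<theta>" using eqpoll_trans[OF eqpoll_sym[OF \<open>K \<approx> X\<close>] eqpoll_trans[OF _ eqpoll_sym[OF eqp]]] by blast
      then show False using X(2) by (simp add: lesspoll_def)
    qed
    then have "\<not> cofinal K r" using reg by (auto simp: regularCard_def K_def)
    then obtain a where a: "a \<in> Field r" "\<And>b. b \<in> K \<Longrightarrow> a = b \<or> (a, b) \<notin> r" by (auto simp: cofinal_def)
    \<comment> \<open>Failure of cofinality bounds \<open>K\<close> by \<open>a\<close> only weakly.
      An infinite cardinal order has no last element, so \<open>a'\<close> makes the bound strict,
      as membership in \<open>c a'\<close> requires.\<close>
    obtain a' where a': "a' \<in> Field r" "a \<noteq> a'" "(a, a') \<in> r"
      using infinite_Card_order_limit[OF r inf a(1)] by blast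
    have "(b, a') \<in> r \<and> b \<noteq> a'" if "b \<in> K" for b
      using a a' that TOTALS TRANS ANTISYM K_def unfolding trans_def antisym_def
      by (metis (mono_tags, lifting) mem_Collect_eq)
    then have "X \<subseteq> elts (c a')" by (auto simp: XK lt)
    then show ?thesis using a' by (auto simp: et)
  qed
  then have "regular_cardinal \<theta>"
    using ord card inf eqpoll_finite_iff[OF eqp] by (auto simp: regular_cardinal_def cardinal_def)
  then show ?thesis using eqp by blast
qed

text \<open>Infinite successor cardinals are regular, so the successor of the size of
  \<open>X\<close> is collapsed. An infinite set is adjoined to \<open>X\<close> first, to have an
  infinite cardinal to start from.\<close>

lemma ex_regular_cardinal_above:
  fixes X :: "'v::zfc_universe set"
  assumes "small X"
  shows "\<exists>\<theta> :: 'v. regular_cardinal \<theta> \<and> X \<prec> elts \<theta>"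
proof -
  obtain w :: 'v where w: "infinite (elts w)" using ex_small_infinite by blast
  obtain x where x: "elts x = X \<union> elts w" using small_Un[OF assms small_elts] by (auto simp: small_def)
  define r where "r = cardSuc |elts x|"
  obtain z where z: "elts z = {y. elts y \<subseteq> elts x}" using powerset[of x] by blast
  \<comment> \<open>The successor is at most the power set in size, and the power set is available
    in the universe; this is the bound that the collapse asks for.\<close>
  have "r \<le>o |Pow (elts x)|"
    unfolding r_def by (intro cardSuc_least card_of_Card_order card_of_Pow)
  then have "|Field r| \<le>o |Pow (elts x)|"
    using card_of_Field_ordIso[OF cardSuc_Card_order[OF card_of_Card_order]] ordIso_ordLeq_trans r_def by blast
  then have "Field r \<lesssim> Pow (elts x)" by (simp add: lepoll_def card_of_ordLeq)
  also have "Pow (elts x) \<lesssim> elts z"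
    unfolding lepoll_def
  proof (intro exI conjI)
    have e: "elts (vset A) = A" if "A \<subseteq> elts x" for A
      using that small_elts[of x] elts_vset small_subset by blast
    then show "inj_on vset (Pow (elts x))" by (metis PowD inj_onI)
    show "vset ` Pow (elts x) \<subseteq> elts z" using e by (auto simp: z)
  qed
  finally have le: "Field r \<lesssim> elts z" .
  have inf: "infinite (elts x)" using w by (simp add: x)
  have "infinite (Field r)" using inf by (metis r_def cardSuc_finite[OF card_of_Card_order] Field_card_of)
  moreover have "regularCard r" unfolding r_def
    using infinite_cardSuc_regularCard[OF _ card_of_Card_order] inf Field_card_of by metis
  moreover have co: "Card_order r" by (simp add: r_def cardSuc_Card_order card_of_Card_order)
  ultimately obtain \<theta> :: 'v where \<theta>: "regular_cardinal \<theta>" "elts \<theta> \<approx> Field r"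
    using regular_cardinal_of_wellorder le by blast
  have "|elts x| <o |Field r|"
    using cardSuc_greater[OF card_of_Card_order, of "elts x"] card_of_Field_ordIso[OF co] r_def
      ordIso_symmetric ordLess_ordIso_trans by blast
  then have "elts x \<prec> Field r"
    unfolding lesspoll_def eqpoll_iff_card_of_ordIso lepoll_def card_of_ordLeq
    by (simp add: not_ordLess_ordIso ordLess_imp_ordLeq)
  then have "X \<prec> elts \<theta>" using \<theta>(2)
    by (metis Un_upper1 eqpoll_sym lesspoll_eq_trans lesspoll_trans1 subset_imp_lepoll x)
  then show ?thesis using \<theta>(1) by blast
qed

section \<open>Countable bounds from almost strongly generic conditions\<close>

text \<open>The arguments of an algebra are unordered, so \<open>g m y\<close> is coded by sets of cardinality \<open>2m + 1\<close>
  with least element \<open>y\<close> and by sets of cardinality \<open>2m + 2\<close> with greatest element \<open>y\<close>. In an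
  infinite set, at least one of the two is available for every \<open>y\<close>.\<close>

lemma ex_algebra_closed_under_maps:
  fixes P :: "'v::zfc_universe" and g :: "nat \<Rightarrow> 'v \<Rightarrow> 'v"
  assumes p0: "p0 \<in> elts P" and g: "\<And>m x. x \<in> elts P \<Longrightarrow> g m x \<in> elts P"
  shows "\<exists>F. algebra_over P F \<and>
    (\<forall>Y. elts Y \<subseteq> elts P \<longrightarrow> infinite (elts Y) \<longrightarrow> closed_under F Y \<longrightarrow> (\<forall>y\<in>elts Y. \<forall>m. g m y \<in> elts Y))"
proof -
  obtain r :: "'v rel" where "well_order_on UNIV r" using well_order_on by blast
  then have tot: "\<And>x y. x \<noteq> y \<Longrightarrow> (x, y) \<in> r \<or> (y, x) \<in> r" and asym: "\<And>x y. (x, y) \<in> r \<Longrightarrow> (y, x) \<in> r \<Longrightarrow> x = y"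
    and rf: "\<And>x. (x, x) \<in> r"
    by (auto simp: well_order_on_def linear_order_on_def partial_order_on_def preorder_on_def
        total_on_def antisym_def refl_on_def)
  define mn where "mn S = (THE m. m \<in> S \<and> (\<forall>x\<in>S. (m, x) \<in> r))" for S
  define mx where "mx S = (THE m. m \<in> S \<and> (\<forall>x\<in>S. (x, m) \<in> r))" for S
  \<comment> \<open>Cardinalities \<open>2m + 1\<close> and \<open>2m + 2\<close> must both decode
    to the index \<open>m\<close>; hence the subtraction in the even case.\<close>
  define h where "h S = (if odd (card S) then g (card S div 2) (mn S) else g (card S div 2 - 1) (mx S))" for S
  \<comment> \<open>The empty set has no extremum, so \<open>h\<close> need not map it into
    \<open>P\<close>; \<open>p0\<close> stands in.\<close>
  define f where "f S = (if h S \<in> elts P then h S else p0)" for S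
  define D where "D = {s. elts s \<subseteq> elts P \<and> finite (elts s)}"
  have "small D" unfolding D_def
    by (rule small_subset[OF small_Collect_subset[OF small_elts[of P]]]) auto
  define F where "F = vset ((\<lambda>s. vpair s (f (elts s))) ` D)"
  have eF: "elts F = (\<lambda>s. vpair s (f (elts s))) ` D" unfolding F_def
    by (rule elts_vset[OF small_image[OF \<open>small D\<close>]])
  have mem: "vpair s y \<in> elts F \<longleftrightarrow> elts s \<subseteq> elts P \<and> finite (elts s) \<and> y = f (elts s)" for s y
    by (auto simp: eF D_def)
  have fP: "f S \<in> elts P" for S by (simp add: f_def p0)
  have alg: "algebra_over P F"
    unfolding algebra_over_def by (auto simp: mem) (auto simp: eF D_def fP)
  have "g m y \<in> elts Y"
    if Y: "elts Y \<subseteq> elts P" "infinite (elts Y)" "closed_under F Y" and y: "y \<in> elts Y" for Y y m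
  proof -
    have cl: "h S \<in> elts Y" if "S \<subseteq> elts Y" "finite S" "h S \<in> elts P" for S
    proof -
      have e: "elts (vset S) = S" using that small_finite elts_vset by blast
      have "vpair (vset S) (f S) \<in> elts F" using that Y(1) by (auto simp: mem e)
      then have "f S \<in> elts Y" using Y(3) that unfolding closed_under_def using e by metis
      then show ?thesis using that by (simp add: f_def)
    qed
    define U where "U = {x \<in> elts Y. x \<noteq> y \<and> (y, x) \<in> r}"
    define L where "L = {x \<in> elts Y. x \<noteq> y \<and> (x, y) \<in> r}"
    have "elts Y \<subseteq> insert y (U \<union> L)" using tot by (auto simp: U_def L_def)
    then have "infinite U \<or> infinite L" using Y(2) finite_subset by (metis finite_UnI finite_insert)
    then show ?thesis
    proof
      assume "infinite U"
      then obtain D where D: "finite D" "card D = 2 * m" "D \<subseteq> U" using infinite_arbitrarily_large by blast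
      have c: "card (insert y D) = 2 * m + 1" using D by (auto simp: U_def card_insert_if)
      have "mn (insert y D) = y" unfolding mn_def
        by (rule the_equality) (use D asym rf in \<open>auto simp: U_def subset_iff\<close>)
      then have "h (insert y D) = g m y" by (simp add: h_def c)
      moreover have "g m y \<in> elts P" using g y Y(1) by blast
      ultimately show ?thesis using cl[of "insert y D"] D y by (auto simp: U_def)
    next
      assume "infinite L"
      then obtain D where D: "finite D" "card D = 2 * m + 1" "D \<subseteq> L" using infinite_arbitrarily_large by blast
      have c: "card (insert y D) = 2 * m + 2" using D by (auto simp: L_def card_insert_if)
      have "mx (insert y D) = y" unfolding mx_def
        by (rule the_equality) (use D asym rf in \<open>auto simp: L_def subset_iff\<close>)
      then have "h (insert y D) = g m y" by (simp add: h_def c)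
      moreover have "g m y \<in> elts P" using g y Y(1) by blast
      ultimately show ?thesis using cl[of "insert y D"] D y by (auto simp: L_def)
    qed
  qed
  then show ?thesis using alg by blast
qed

text \<open>Properness offers a club for each large \<open>\<theta>\<close>. Since
  \<open>\<theta>\<close> is chosen after \<open>F\<close>, the set \<open>F\<close> belongs to
  \<open>hered \<theta>\<close>, and unboundedness of the club puts it into some
  \<open>M\<close>.\<close>

lemma ex_almost_strongly_generic:
  fixes P :: "'v::zfc_universe"
  assumes "almost_strongly_proper P le" and p: "p \<in> elts P"
  shows "\<exists>M q. countable M \<and> F \<in> M \<and> q \<in> elts P \<and> le q p \<and> almost_strongly_generic M P le q"
proof -
  obtain \<kappa> where \<kappa>: "ordinal \<kappa>" and asp: "\<And>\<theta>. regular_cardinal \<theta> \<Longrightarrow> \<kappa> \<in> elts \<theta> \<Longrightarrow>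
         (\<exists>C. club_in_ctbl_subsets (hered \<theta>) C \<and>
           (\<forall>M\<in>C. elementary_submodel M (hered \<theta>) \<and> v_ctbl_infinite_subsets P \<in> M \<and>
             (\<forall>p \<in> M \<inter> elts P. \<exists>q\<in>elts P. le q p \<and> almost_strongly_generic M P le q)))"
    using assms(1) unfolding almost_strongly_proper_def by blast
  \<comment> \<open>Exceeding the transitive closures of \<open>F\<close> and \<open>p\<close>
    places both in \<open>hered \<theta>\<close>; exceeding \<open>\<kappa>\<close> in size makes
    \<open>\<kappa>\<close> a member of \<open>\<theta>\<close>.\<close>
  obtain \<theta> :: 'v where \<theta>: "regular_cardinal \<theta>" "trcl F \<union> trcl p \<union> elts \<kappa> \<prec> elts \<theta>"
    using ex_regular_cardinal_above[of "trcl F \<union> trcl p \<union> elts \<kappa>"] small_Un small_trcl small_elts by blast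
  have ord: "ordinal \<theta>" and inf: "infinite (elts \<theta>)"
    and card: "\<And>y. y \<in> elts \<theta> \<Longrightarrow> elts y \<prec> elts \<theta>"
    using \<theta>(1) by (auto simp: regular_cardinal_def cardinal_def)
  have lt: "A \<prec> elts \<theta>" if "A \<subseteq> trcl F \<union> trcl p \<union> elts \<kappa>" for A
    using lesspoll_trans1[OF subset_imp_lepoll[OF that] \<theta>(2)] .
  have "\<kappa> \<in> elts \<theta>"
  proof (rule ccontr)
    assume "\<kappa> \<notin> elts \<theta>"
    then have "elts \<theta> \<subseteq> elts \<kappa>" using ordinal_linear[OF \<kappa> ord] \<kappa> by (auto simp: ordinal_def transitive_set_def)
    then have "elts \<theta> \<prec> elts \<theta>" using lt by blast
    then show False by (simp add: lesspoll_def)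
  qed
  then obtain C where C: "club_in_ctbl_subsets (hered \<theta>) C"
    and CM: "\<And>M p. M \<in> C \<Longrightarrow> p \<in> M \<inter> elts P \<Longrightarrow> \<exists>q\<in>elts P. le q p \<and> almost_strongly_generic M P le q"
    using asp[OF \<theta>(1)] by blast
  \<comment> \<open>\<open>K\<close> makes the seed set infinite; its members lie in
    \<open>hered \<theta>\<close> because ordinals below a cardinal are smaller than it.\<close>
  obtain K where K: "K \<subseteq> elts \<theta>" "countable K" "infinite K"
    using infinite_countable_subset'[OF inf] by blast
  have "trcl a \<prec> elts \<theta>" if "a \<in> elts \<theta>" for a
    using lesspoll_trans1[OF subset_imp_lepoll[OF trcl_ordinal] card] that ordinal_mem[OF ord] by blast
  then have "insert F (insert p K) \<in> ctbl_infinite_subsets (hered \<theta>)"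
    using K lt[of "trcl F"] lt[of "trcl p"] by (auto simp: ctbl_infinite_subsets_def hered_def)
  then obtain M where M: "M \<in> C" "insert F (insert p K) \<subseteq> M"
    using C unfolding club_in_ctbl_subsets_def by blast
  moreover have "countable M" using C M(1) by (auto simp: club_in_ctbl_subsets_def ctbl_infinite_subsets_def)
  ultimately show ?thesis using CM[OF M(1), of p] p by blast
qed

text \<open>\<open>\<Phi> n t\<close> is to be thought of as the set of conditions that force \<open>t\<close> to be in the \<open>n\<close>-th of
  countably many subsets of \<open>X\<close>. For each condition \<open>q\<close>, only countably many \<open>t\<close> escape the witnesses
  below \<open>q\<close>; the bound collects them for all \<open>q\<close> in one of the countably many countable \<open>Y \<in> M\<close>.\<close>

lemma almost_strongly_proper_countable_bound:
  fixes P :: "'v::zfc_universe"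
  assumes fn: "forcing_notion P le" and asp: "almost_strongly_proper P le" and p0: "p0 \<in> elts P"
    and down: "\<And>n t p q. p \<in> \<Phi> n t \<Longrightarrow> p \<in> elts P \<Longrightarrow> q \<in> elts P \<Longrightarrow> le q p \<Longrightarrow> q \<in> \<Phi> n t"
    and witness: "\<And>n q. q \<in> elts P \<Longrightarrow> le q p0 \<Longrightarrow>
      \<exists>B Z. countable B \<and> B \<subseteq> {r \<in> elts P. le r q} \<and> countable Z \<and>
        (\<forall>t\<in>X - Z. \<exists>r\<in>B. \<forall>r'\<in>elts P. le r' r \<longrightarrow> r' \<notin> \<Phi> n t)"
  shows "\<exists>q\<in>elts P. le q p0 \<and> (\<exists>Z. countable Z \<and> (\<forall>n. \<forall>t\<in>X - Z. \<forall>q'\<in>elts P. le q' q \<longrightarrow> q' \<notin> \<Phi> (n :: nat) (t :: 'b)))"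
proof -
  have refl: "\<And>p. p \<in> elts P \<Longrightarrow> le p p"
    and trans: "\<And>p q r. p \<in> elts P \<Longrightarrow> q \<in> elts P \<Longrightarrow> r \<in> elts P \<Longrightarrow> le p q \<Longrightarrow> le q r \<Longrightarrow> le p r"
    using fn unfolding forcing_notion_def by blast+
  define good where "good n q b \<longleftrightarrow> countable (fst b) \<and> fst b \<subseteq> {r \<in> elts P. le r q} \<and> countable (snd b) \<and>
      (\<forall>t\<in>X - snd b. \<exists>r\<in>fst b. \<forall>r'\<in>elts P. le r' r \<longrightarrow> r' \<notin> \<Phi> n t)" for n q and b :: "'v set \<times> 'b set"
  define B where "B n q = fst (SOME b. good n q b)" for n q
  define Z where "Z n q = snd (SOME b. good n q b)" for n q
  have good: "good n q (SOME b. good n q b)" if qq: "q \<in> elts P" "le q p0" for n q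
  proof (rule someI_ex)
    obtain b z where "good n q (b, z)" using witness[OF qq, of n] unfolding good_def by auto
    then show "\<exists>b. good n q b" by blast
  qed
  have B: "countable (B n q) \<and> B n q \<subseteq> {r \<in> elts P. le r q}"
    and Z: "countable (Z n q)"
    and BZ: "\<And>t. t \<in> X - Z n q \<Longrightarrow> \<exists>r\<in>B n q. \<forall>r'\<in>elts P. le r' r \<longrightarrow> r' \<notin> \<Phi> n t"
    if "q \<in> elts P" "le q p0" for n q
    using good[OF that, of n] unfolding B_def Z_def good_def by blast+
  \<comment> \<open>Witnesses exist only for conditions below \<open>p0\<close>, whereas members of
    \<open>Y\<close> may lie elsewhere; \<open>d q\<close> moves a compatible \<open>q\<close> below
    \<open>p0\<close>.\<close>
  define d where "d q = (SOME d. d \<in> elts P \<and> le d q \<and> le d p0)" for q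
  have d: "d q \<in> elts P \<and> le (d q) q \<and> le (d q) p0" if "compatible P le q p0" for q
    using that unfolding d_def compatible_def by (metis (mono_tags, lifting) someI_ex)
  \<comment> \<open>Adjoining \<open>d q\<close> makes \<open>A q\<close> nonempty, so that
    \<open>from_nat_into\<close> enumerates it.\<close>
  define A where "A q = insert (d q) (\<Union>n. B n (d q))" for q
  have A: "countable (A q) \<and> A q \<noteq> {} \<and> A q \<subseteq> {r \<in> elts P. le r q}" if "q \<in> elts P" "compatible P le q p0" for q
  proof -
    note dq = d[OF that(2)]
    have "countable (B n (d q))" "B n (d q) \<subseteq> {r \<in> elts P. le r (d q)}" for n
      using B[of "d q" n] dq by blast+
    moreover have "le r q" if "r \<in> elts P" "le r (d q)" for r
      using trans[of r "d q" q] that dq \<open>q \<in> elts P\<close> by blast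
    ultimately show ?thesis unfolding A_def using dq by blast
  qed
  define g where "g m q = (if compatible P le q p0 then from_nat_into (A q) m else q)" for m q
  have g: "g m q \<in> elts P" if "q \<in> elts P" for m q
    using A[OF that] that from_nat_into[of "A q" m] by (auto simp: g_def)
  obtain F where F: "algebra_over P F" and clF: "\<And>Y y m. elts Y \<subseteq> elts P \<Longrightarrow> infinite (elts Y) \<Longrightarrow>
      closed_under F Y \<Longrightarrow> y \<in> elts Y \<Longrightarrow> g m y \<in> elts Y"
    using ex_algebra_closed_under_maps[where g = g, OF p0 g] by blast
  obtain M q where M: "countable M" "F \<in> M" and q: "q \<in> elts P" "le q p0" and gen: "almost_strongly_generic M P le q"
    using ex_almost_strongly_generic[OF asp p0, of F] by blast
  \<comment> \<open>A countable union because \<open>M\<close>, the sets \<open>Y\<close> and the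
    sets \<open>Z n (d y)\<close> are countable; it is formed independently of the later
    \<open>q1\<close>, \<open>n\<close> and \<open>t\<close>.\<close>
  define W where "W = (\<Union>Y\<in>{Y \<in> M. countable (elts Y)}. \<Union>y\<in>{y \<in> elts Y. compatible P le y p0}. \<Union>n. Z n (d y))"
  have "countable W" unfolding W_def
    using M(1) d Z by (intro countable_UN) auto
  moreover have "q1 \<notin> \<Phi> n t" if t: "t \<in> X - W" and q1: "q1 \<in> elts P" "le q1 q" for n t q1
  proof
    assume \<Phi>: "q1 \<in> \<Phi> n t"
    have "M_stationary M P (reflecting_sets P le q1)" using gen q1 by (auto simp: almost_strongly_generic_def)
    then obtain Y where Y: "Y \<in> M" "Y \<in> reflecting_sets P le q1" "closed_under F Y"
      unfolding M_stationary_def using F M(2) by blast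
    then have YP: "elts Y \<subseteq> elts P" "countable (elts Y)" "infinite (elts Y)"
      by (auto simp: reflecting_sets_def ctbl_infinite_subsets_def)
    obtain y where y: "y \<in> elts Y" and yc: "\<And>r. r \<in> elts Y \<Longrightarrow> le r y \<Longrightarrow> compatible P le r q1"
      using Y(2) by (auto simp: reflecting_sets_def)
    have yP: "y \<in> elts P" using y YP by blast
    \<comment> \<open>Reflection applied to \<open>y\<close> itself makes \<open>y\<close>
      compatible with \<open>q1\<close>, and \<open>q1\<close> lies below \<open>p0\<close>; so
      \<open>d y\<close> is a genuine common extension.\<close>
    have yp0: "compatible P le y p0"
    proof -
      obtain r where "r \<in> elts P" "le r y" "le r q1" using yc[OF y refl[OF yP]] by (auto simp: compatible_def)
      then show ?thesis unfolding compatible_def using trans[of r q1 q] trans[of r q p0] q q1 p0 by blast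
    qed
    have "t \<in> X - Z n (d y)" using t Y(1) YP y yp0 by (auto simp: W_def)
    then obtain r where r: "r \<in> B n (d y)" and rr: "\<And>r'. r' \<in> elts P \<Longrightarrow> le r' r \<Longrightarrow> r' \<notin> \<Phi> n t"
      using BZ d[OF yp0] by blast
    have "r \<in> A y" using r by (auto simp: A_def)
    then obtain m where "from_nat_into (A y) m = r"
      using from_nat_into_surj[of "A y" r] A[OF yP yp0] by auto
    then have "g m y = r" by (simp add: g_def yp0)
    then have "r \<in> elts Y" using clF[OF YP(1,3) Y(3) y] by blast
    moreover have rP: "r \<in> elts P" "le r y" using A[OF yP yp0] \<open>r \<in> A y\<close> by blast+
    \<comment> \<open>The common extension \<open>s\<close> lies in \<open>\<Phi> n t\<close>
      because it is below \<open>q1\<close>, and outside it because it is below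
      \<open>r\<close>.\<close>
    ultimately obtain s where "s \<in> elts P" "le s r" "le s q1" using yc by (auto simp: compatible_def)
    then show False using rr down[OF \<Phi> q1(1)] by blast
  qed
  ultimately show ?thesis using q by blast
qed

section \<open>Trees without uncountable chains and antichains\<close>

text \<open>The combinatorial content of a Suslin tree apart from its height, stated for HOL sets so
  that no coding of pairs or formulas enters the argument.\<close>

locale ctbl_tree =
  fixes T :: "'a set" and rel :: "'a \<Rightarrow> 'a \<Rightarrow> bool"
  assumes irrefl: "x \<in> T \<Longrightarrow> \<not> rel x x"
    and trans: "x \<in> T \<Longrightarrow> y \<in> T \<Longrightarrow> z \<in> T \<Longrightarrow> rel x y \<Longrightarrow> rel y z \<Longrightarrow> rel x z"
    and least: "x \<in> T \<Longrightarrow> X \<noteq> {} \<Longrightarrow> (\<And>y. y \<in> X \<Longrightarrow> y \<in> T \<and> rel y x) \<Longrightarrow> \<exists>y\<in>X. \<forall>z\<in>X. z = y \<or> rel y z"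
    and chain_countable: "A \<subseteq> T \<Longrightarrow> (\<And>x y. x \<in> A \<Longrightarrow> y \<in> A \<Longrightarrow> x = y \<or> rel x y \<or> rel y x) \<Longrightarrow> countable A"
    and antichain_countable: "A \<subseteq> T \<Longrightarrow> (\<And>x y. x \<in> A \<Longrightarrow> y \<in> A \<Longrightarrow> \<not> rel x y) \<Longrightarrow> countable A"
begin

definition up :: "'a \<Rightarrow> 'a set" where
  "up s = {t \<in> T. t = s \<or> rel s t}"

lemma predecessors_comparable:
  assumes "x \<in> T" "y \<in> T" "z \<in> T" "rel y x" "rel z x" shows "y = z \<or> rel y z \<or> rel z y"
  using least[of x "{y, z}"] assms by auto

lemma up_trans: "s \<in> T \<Longrightarrow> t \<in> up s \<Longrightarrow> up t \<subseteq> up s"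
  unfolding up_def using trans by blast

lemma countable_predecessors: "a \<in> T \<Longrightarrow> countable {t \<in> T. rel t a}"
  by (rule chain_countable) (use predecessors_comparable[of a] in auto)

text \<open>The minimal elements \<open>B\<close> of \<open>E\<close> form an antichain. A node
  \<open>t\<close> has some \<open>s \<in> E\<close> above it, and \<open>s\<close> has some
  \<open>a \<in> B\<close> below it; as \<open>t\<close> and \<open>a\<close> both lie weakly below
  \<open>s\<close>, they are comparable. So a node not strictly above \<open>B\<close> is in
  \<open>B\<close> or is a predecessor of a member of \<open>B\<close>, and predecessors of one node
  form a chain.\<close>

lemma dense_upward_closed_countable_part:
  assumes E: "E \<subseteq> T" and up: "\<And>s t. s \<in> E \<Longrightarrow> t \<in> T \<Longrightarrow> rel s t \<Longrightarrow> t \<in> E"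
    and dense: "\<And>t. t \<in> T \<Longrightarrow> \<exists>s\<in>E. s \<in> up t"
  obtains B where "B \<subseteq> E" "countable B" "countable {t \<in> T. \<not> (\<exists>s\<in>B. rel s t)}"
proof -
  define B where "B = {s \<in> E. \<forall>t\<in>E. \<not> rel t s}"
  have BE: "B \<subseteq> E" by (auto simp: B_def)
  have cB: "countable B" by (rule antichain_countable) (use E in \<open>auto simp: B_def\<close>)
  have minimal: "\<exists>a\<in>B. s \<in> up a" if s: "s \<in> E" for s
  proof (cases "s \<in> B")
    case True
    then show ?thesis using s E by (auto simp: up_def)
  next
    case False
    have sT: "s \<in> T" using s E by blast
    define X where "X = {t \<in> E. rel t s}"
    have "\<exists>a\<in>X. \<forall>z\<in>X. z = a \<or> rel a z"
      by (rule least[OF sT]) (use False s E in \<open>auto simp: X_def B_def\<close>)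
    then obtain a where a: "a \<in> X" "\<And>z. z \<in> X \<Longrightarrow> z = a \<or> rel a z" by blast
    have "a \<in> B"
    proof -
      have "\<not> rel t a" if t: "t \<in> E" for t
      proof
        assume ta: "rel t a"
        have T: "t \<in> T" "a \<in> T" using t a(1) E by (auto simp: X_def)
        then have "t \<in> X" using trans[OF T sT ta] t a(1) by (auto simp: X_def)
        then show False using a(2)[of t] ta irrefl trans[OF T(1,2,1)] T by blast
      qed
      then show ?thesis using a(1) by (auto simp: B_def X_def)
    qed
    then show ?thesis using a(1) sT by (auto simp: up_def X_def)
  qed
  have "{t \<in> T. \<not> (\<exists>s\<in>B. rel s t)} \<subseteq> B \<union> (\<Union>a\<in>B. {t \<in> T. rel t a})"
  proof (rule subsetI, rule ccontr)
    fix t assume "t \<in> {t \<in> T. \<not> (\<exists>s\<in>B. rel s t)}" "t \<notin> B \<union> (\<Union>a\<in>B. {t \<in> T. rel t a})"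
    then have t: "t \<in> T" "t \<notin> (\<Union>a\<in>B. {t \<in> T. rel t a})" "t \<notin> B" "\<not> (\<exists>s\<in>B. rel s t)" by blast+
    obtain s where s: "s \<in> E" "s \<in> up t" using dense t by blast
    obtain a where a: "a \<in> B" "s \<in> up a" using minimal[OF s(1)] by blast
    have T: "a \<in> T" "s \<in> T" using a(1) BE E s by auto
    have "a = t \<or> rel a t \<or> rel t a"
      using s(2) a(2) predecessors_comparable[OF T(2) T(1) t(1)] by (auto simp: up_def)
    then show False using t a by blast
  qed
  moreover have "countable (B \<union> (\<Union>a\<in>B. {t \<in> T. rel t a}))"
    using cB countable_predecessors BE E by (auto intro!: countable_UN)
  ultimately show ?thesis using that[OF BE cB] countable_subset by blast
qed

section \<open>Countable witnesses for forced antichains and chains\<close>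

context
  fixes P :: "'p set" and le :: "'p \<Rightarrow> 'p \<Rightarrow> bool" and \<Phi> :: "'a \<Rightarrow> 'p set" and p0 :: 'p
  assumes le_refl: "p \<in> P \<Longrightarrow> le p p"
    and le_trans: "p \<in> P \<Longrightarrow> q \<in> P \<Longrightarrow> r \<in> P \<Longrightarrow> le p q \<Longrightarrow> le q r \<Longrightarrow> le p r"
    and down: "p \<in> \<Phi> t \<Longrightarrow> p \<in> P \<Longrightarrow> q \<in> P \<Longrightarrow> le q p \<Longrightarrow> q \<in> \<Phi> t"
    and p0: "p0 \<in> P"
begin

lemma antichain_witness:
  assumes anti: "\<And>p s t. p \<in> P \<Longrightarrow> le p p0 \<Longrightarrow> p \<in> \<Phi> s \<Longrightarrow> p \<in> \<Phi> t \<Longrightarrow> s \<in> T \<Longrightarrow> t \<in> T \<Longrightarrow> \<not> rel s t"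
    and q: "q \<in> P" "le q p0"
  shows "\<exists>B Z. countable B \<and> B \<subseteq> {r \<in> P. le r q} \<and> countable Z \<and>
        (\<forall>t\<in>T - Z. \<exists>r\<in>B. \<forall>r'\<in>P. le r' r \<longrightarrow> r' \<notin> \<Phi> t)"
proof -
  define ok where "ok s r \<longleftrightarrow> r \<in> P \<and> le r q \<and>
    ((\<exists>s'\<in>T. s \<in> up s' \<and> r \<in> \<Phi> s') \<or> (\<forall>s'\<in>up s. \<forall>r'\<in>P. le r' r \<longrightarrow> r' \<notin> \<Phi> s'))" for s r
  define E where "E = {s \<in> T. \<exists>r. ok s r}"
  have "ok t r" if "ok s r" "s \<in> T" "t \<in> T" "rel s t" for s t r
  proof -
    have "t \<in> up s" using that by (auto simp: up_def)
    then show ?thesis using that up_trans[of s t] up_trans[of _ s] unfolding ok_def by blast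
  qed
  then have upE: "t \<in> E" if "s \<in> E" "t \<in> T" "rel s t" for s t using that by (auto simp: E_def)
  \<comment> \<open>If a node above \<open>t\<close> can be forced in below \<open>q\<close>, that
    node is decided positively; otherwise \<open>q\<close> itself decides \<open>t\<close>
    negatively.\<close>
  have dense: "\<exists>s\<in>E. s \<in> up t" if t: "t \<in> T" for t
  proof (cases "\<exists>s\<in>up t. \<exists>r\<in>P. le r q \<and> r \<in> \<Phi> s")
    case True
    then obtain s r where "s \<in> up t" "r \<in> P" "le r q" "r \<in> \<Phi> s" by blast
    moreover from this have "ok s r" unfolding ok_def by (auto simp: up_def)
    ultimately show ?thesis by (auto simp: E_def up_def)
  next
    case False
    then have "ok t q" using q le_refl by (auto simp: ok_def)
    then show ?thesis using t by (auto simp: E_def up_def)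
  qed
  have "E \<subseteq> T" by (auto simp: E_def)
  from dense_upward_closed_countable_part[OF this upE dense]
  obtain B where B: "B \<subseteq> E" "countable B" "countable {t \<in> T. \<not> (\<exists>s\<in>B. rel s t)}" .
  define c where "c s = (SOME r. ok s r)" for s
  have c: "ok s (c s)" if "s \<in> B" for s
    unfolding c_def by (rule someI_ex) (use that B(1) in \<open>auto simp: E_def\<close>)
  \<comment> \<open>Strictness of \<open>rel s t\<close> matters in the positive case: the node
    \<open>s'\<close> forced in may be \<open>s\<close> itself, and only a strictly larger node
    conflicts with it.\<close>
  have main: "\<forall>r'\<in>P. le r' (c s) \<longrightarrow> r' \<notin> \<Phi> t" if s: "s \<in> B" and t: "t \<in> T" "rel s t" for s t
  proof (intro ballI impI notI)
    fix r' assume r': "r' \<in> P" "le r' (c s)" "r' \<in> \<Phi> t"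
    have sT: "s \<in> T" using s B by (auto simp: E_def)
    note cs = c[OF s, unfolded ok_def]
    have "t \<in> up s" using t by (auto simp: up_def)
    then obtain s' where s': "s' \<in> T" "s \<in> up s'" "c s \<in> \<Phi> s'" using cs r' by blast
    then have "r' \<in> \<Phi> s'" using down cs r' by blast
    moreover have "rel s' t" using s' t sT trans[of s' s t] by (auto simp: up_def)
    moreover have "le r' q" using le_trans[of r' "c s" q] r' cs q by blast
    moreover then have "le r' p0" using le_trans[of r' q p0] r' q p0 by blast
    ultimately show False using anti r' s'(1) t by blast
  qed
  have "countable (c ` B)" "c ` B \<subseteq> {r \<in> P. le r q}"
    using B(2) c by (auto simp: ok_def)
  moreover have "\<forall>t\<in>T - {t \<in> T. \<not> (\<exists>s\<in>B. rel s t)}. \<exists>r\<in>c ` B. \<forall>r'\<in>P. le r' r \<longrightarrow> r' \<notin> \<Phi> t"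
    using main by blast
  ultimately show ?thesis using B(3) by blast
qed

text \<open>Let \<open>x\<close> and \<open>y\<close> be incomparable nodes above \<open>t\<close>.
  If \<open>q\<close> does not refuse the whole cone of \<open>x\<close>, an extension
  \<open>r\<close> forces in some \<open>x'\<close> of that cone; then \<open>r\<close> refuses the
  cone of \<open>y\<close>, since a node comparable with \<open>x'\<close> there would make
  \<open>x\<close> and \<open>y\<close> predecessors of one node. If no such pair exists, the cone
  of \<open>t\<close> is a chain.\<close>

lemma chain_witness:
  assumes chain: "\<And>p s t. p \<in> P \<Longrightarrow> le p p0 \<Longrightarrow> p \<in> \<Phi> s \<Longrightarrow> p \<in> \<Phi> t \<Longrightarrow> s \<in> T \<Longrightarrow> t \<in> T \<Longrightarrow> s = t \<or> rel s t \<or> rel t s"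
    and q: "q \<in> P" "le q p0"
  shows "\<exists>B Z. countable B \<and> B \<subseteq> {r \<in> P. le r q} \<and> countable Z \<and>
        (\<forall>t\<in>T - Z. \<exists>r\<in>B. \<forall>r'\<in>P. le r' r \<longrightarrow> r' \<notin> \<Phi> t)"
proof -
  define ok where "ok s r \<longleftrightarrow> r \<in> P \<and> le r q \<and> (\<forall>s'\<in>up s. \<forall>r'\<in>P. le r' r \<longrightarrow> r' \<notin> \<Phi> s')" for s r
  define lin where "lin s \<longleftrightarrow> (\<forall>x\<in>up s. \<forall>y\<in>up s. x = y \<or> rel x y \<or> rel y x)" for s
  define E where "E = {s \<in> T. (\<exists>r. ok s r) \<or> lin s}"
  have upE: "t \<in> E" if "s \<in> E" "t \<in> T" "rel s t" for s t
  proof -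
    have "s \<in> T" using that by (auto simp: E_def)
    moreover have "t \<in> up s" using that by (auto simp: up_def)
    ultimately show ?thesis using that up_trans[of s t] unfolding E_def ok_def lin_def by blast
  qed
  have dense: "\<exists>s\<in>E. s \<in> up t" if t: "t \<in> T" for t
  proof (cases "lin t")
    case True
    then show ?thesis using t by (auto simp: E_def up_def)
  next
    case False
    then obtain x y where xy: "x \<in> up t" "y \<in> up t" "x \<noteq> y" "\<not> rel x y" "\<not> rel y x" by (auto simp: lin_def)
    show ?thesis
    proof (cases "ok x q")
      case True
      then show ?thesis using xy by (auto simp: E_def up_def)
    next
      case False
      then obtain x' r where x': "x' \<in> up x" "r \<in> P" "le r q" "r \<in> \<Phi> x'"
        unfolding ok_def using q le_refl by blast
      have "r' \<notin> \<Phi> y'" if y': "y' \<in> up y" "r' \<in> P" "le r' r" for y' r'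
      proof
        assume "r' \<in> \<Phi> y'"
        moreover have "r' \<in> \<Phi> x'" using down x' y' by blast
        moreover have "le r' p0" using le_trans[of r' r q] le_trans[of r' q p0] x' y' q p0 by blast
        moreover have T: "x \<in> T" "y \<in> T" "x' \<in> T" "y' \<in> T" using xy x' y' by (auto simp: up_def)
        ultimately consider "x' \<in> up y'" | "y' \<in> up x'"
          using chain[of r' x' y'] y' by (auto simp: up_def)
        then show False
        proof cases
          case 1
          then have "x' \<in> up y" using up_trans[OF T(2) y'(1)] by blast
          then show False using x'(1) xy predecessors_comparable[OF T(3) T(1) T(2)] by (auto simp: up_def)
        next
          case 2
          then have "y' \<in> up x" using up_trans[OF T(1) x'(1)] by blast
          then show False using y'(1) xy predecessors_comparable[OF T(4) T(1) T(2)] by (auto simp: up_def)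
        qed
      qed
      then have "ok y r" using x' by (auto simp: ok_def)
      then show ?thesis using xy by (auto simp: E_def up_def)
    qed
  qed
  have "E \<subseteq> T" by (auto simp: E_def)
  from dense_upward_closed_countable_part[OF this upE dense]
  obtain B where B: "B \<subseteq> E" "countable B" "countable {t \<in> T. \<not> (\<exists>s\<in>B. rel s t)}" .
  define c where "c s = (SOME r. ok s r)" for s
  define B' where "B' = {s \<in> B. \<exists>r. ok s r}"
  have c: "ok s (c s)" if "s \<in> B'" for s
    unfolding c_def by (rule someI_ex) (use that in \<open>auto simp: B'_def\<close>)
  \<comment> \<open>A node of \<open>B\<close> without a refusing condition belongs to
    \<open>E\<close> because its cone is a chain; such cones are countable and join the
    exceptions.\<close>
  define Z where "Z = {t \<in> T. \<not> (\<exists>s\<in>B. rel s t)} \<union> (\<Union>s\<in>{s \<in> B. lin s}. up s)"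
  have "countable (up s)" if "lin s" for s
    by (rule chain_countable) (use that in \<open>auto simp: up_def lin_def\<close>)
  then have "countable Z" unfolding Z_def using B by (auto intro!: countable_UN)
  moreover have "countable (c ` B')" using B(2) by (auto simp: B'_def)
  moreover have "c ` B' \<subseteq> {r \<in> P. le r q}" using c by (auto simp: ok_def)
  moreover have "\<forall>t\<in>T - Z. \<exists>r\<in>c ` B'. \<forall>r'\<in>P. le r' r \<longrightarrow> r' \<notin> \<Phi> t"
  proof
    fix t assume t: "t \<in> T - Z"
    then obtain s where s: "s \<in> B" "rel s t" by (auto simp: Z_def)
    then have "t \<in> up s" using t by (auto simp: up_def)
    then have "s \<in> B'" using t s B(1) by (auto simp: Z_def B'_def E_def)
    then show "\<exists>r\<in>c ` B'. \<forall>r'\<in>P. le r' r \<longrightarrow> r' \<notin> \<Phi> t"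
      using c[of s] \<open>t \<in> up s\<close> unfolding ok_def by blast
  qed
  ultimately show ?thesis by blast
qed

end

end

section \<open>Satisfaction in the universe\<close>

text \<open>The conditional accounts for \<open>i = j\<close>, where the quantifier also captures
  the variable that is meant to bound it.\<close>

lemma sat_connectives [simp]:
  "sat M (FOr \<phi> \<psi>) e \<longleftrightarrow> sat M \<phi> e \<or> sat M \<psi> e"
  "sat M (FImp \<phi> \<psi>) e \<longleftrightarrow> (sat M \<phi> e \<longrightarrow> sat M \<psi> e)"
  "sat M (FIff \<phi> \<psi>) e \<longleftrightarrow> (sat M \<phi> e \<longleftrightarrow> sat M \<psi> e)"
  "sat M (FEx i \<phi>) e \<longleftrightarrow> (\<exists>x\<in>M. sat M \<phi> (e(i := x)))"
  "sat UNIV (FBall i j \<phi>) e \<longleftrightarrow> (\<forall>x. x \<in> elts (if i = j then x else e j) \<longrightarrow> sat UNIV \<phi> (e(i := x)))"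
  "sat UNIV (FBex i j \<phi>) e \<longleftrightarrow> (\<exists>x. x \<in> elts (if i = j then x else e j) \<and> sat UNIV \<phi> (e(i := x)))"
  by (auto simp: FOr_def FImp_def FIff_def FEx_def FBall_def FBex_def)

lemma sat_fm_subset [simp]: "sat UNIV (fm_subset x y) e \<longleftrightarrow> elts (e x) \<subseteq> elts (e y)"
  by (auto simp: fm_subset_def Let_def)

lemma sat_fm_empty [simp]: "sat UNIV (fm_empty x) e \<longleftrightarrow> elts (e x) = {}"
  by (auto simp: fm_empty_def Let_def)

lemma sat_fm_transitive [simp]: "sat UNIV (fm_transitive x) e \<longleftrightarrow> transitive_set (e x)"
  by (auto simp: fm_transitive_def Let_def transitive_set_def)

lemma sat_fm_ordinal [simp]: "sat UNIV (fm_ordinal x) e \<longleftrightarrow> ordinal (e x)"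
  by (auto simp: fm_ordinal_def Let_def ordinal_def)

lemma sat_fm_succ [simp]: "sat UNIV (fm_succ x y) e \<longleftrightarrow> elts (e y) = insert (e x) (elts (e x))"
  by (auto simp: fm_succ_def Let_def)

lemma sat_fm_upair [simp]: "sat UNIV (fm_upair z x y) e \<longleftrightarrow> elts (e z) = {e x, e y}"
  by (auto simp: fm_upair_def Let_def)

lemma vset_eq_iff: "small A \<Longrightarrow> x = vset A \<longleftrightarrow> elts x = A"
  by (metis elts_vset vset_elts)

lemma sat_fm_pair [simp]: "sat UNIV (fm_pair z x y) e \<longleftrightarrow> e z = vpair (e x) (e y)"
proof -
  have "(\<exists>a b. elts a = {e x} \<and> elts b = {e x, e y} \<and> elts (e z) = {a, b}) \<longleftrightarrow> e z = vpair (e x) (e y)"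
    unfolding vpair_def by (simp add: vset_eq_iff [symmetric])
  then show ?thesis by (simp add: fm_pair_def Let_def)
qed

lemma sat_fm_rel [simp]: "sat UNIV (fm_rel r x y) e \<longleftrightarrow> vpair (e x) (e y) \<in> elts (e r)"
  by (auto simp: fm_rel_def Let_def)

definition function_graph :: "'v::zfc_universe \<Rightarrow> 'v \<Rightarrow> 'v \<Rightarrow> bool" where
  "function_graph f x y \<longleftrightarrow> (\<forall>z\<in>elts f. \<exists>a\<in>elts x. \<exists>b\<in>elts y. z = vpair a b) \<and>
     (\<forall>a\<in>elts x. \<exists>b\<in>elts y. vpair a b \<in> elts f \<and> (\<forall>c\<in>elts y. vpair a c \<in> elts f \<longrightarrow> c = b))"

lemma sat_fm_function [simp]: "sat UNIV (fm_function f x y) e \<longleftrightarrow> function_graph (e f) (e x) (e y)"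
  by (simp add: fm_function_def Let_def function_graph_def) blast

lemma sat_fm_injective_on [simp]: "sat UNIV (fm_injective_on f x) e \<longleftrightarrow>
   (\<forall>a\<in>elts (e x). \<forall>b\<in>elts (e x). \<forall>c. vpair a c \<in> elts (e f) \<and> vpair b c \<in> elts (e f) \<longrightarrow> a = b)"
  by (simp add: fm_injective_on_def Let_def) blast

definition is_omega :: "'v::zfc_universe \<Rightarrow> bool" where
  "is_omega w \<longleftrightarrow> ordinal w \<and> (\<exists>n\<in>elts w. elts n = {}) \<and>
     (\<forall>n\<in>elts w. \<exists>m\<in>elts w. elts m = insert n (elts n)) \<and>
     (\<forall>n\<in>elts w. elts n = {} \<or> (\<exists>m\<in>elts w. elts n = insert m (elts m)))"

lemma sat_fm_omega [simp]: "sat UNIV (fm_omega w) e \<longleftrightarrow> is_omega (e w)"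
  by (simp add: fm_omega_def Let_def is_omega_def Bex_def Ball_def)

section \<open>The set of natural numbers and countability\<close>

primrec num :: "nat \<Rightarrow> 'v::zfc_universe" where
  "num 0 = vset {}"
| "num (Suc n) = vset (insert (num n) (elts (num n)))"

lemma elts_num_Suc: "elts (num (Suc n)) = insert (num n) (elts (num n))"
  by (simp add: elts_vset small_insert)

lemma elts_num: "elts (num n) = num ` {..<n}"
proof (induction n)
  case (Suc n)
  then show ?case by (simp only: elts_num_Suc lessThan_Suc image_insert)
qed (simp add: elts_vset)

declare num.simps [simp del]

lemma num_inject: "num m = (num n :: 'v::zfc_universe) \<longleftrightarrow> m = n"
proof -
  have "num m \<noteq> (num n :: 'v)" if "m < n" for m n
    using that mem_irrefl[of "num n :: 'v"] elts_num by (metis image_eqI lessThan_iff)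
  then show ?thesis by (metis linorder_neqE_nat)
qed

lemma small_range_nat: "small (range f)" for f :: "nat \<Rightarrow> 'v::zfc_universe"
proof -
  obtain w :: 'v where "infinite (elts w)" using ex_small_infinite by blast
  then have "(UNIV :: nat set) \<lesssim> elts w" by (simp add: infinite_le_lepoll)
  then show ?thesis using small_lepoll[OF small_elts] lepoll_trans[OF image_lepoll] by blast
qed

lemma ex_is_omega: "\<exists>w :: 'v::zfc_universe. is_omega w"
proof -
  define w :: 'v where "w = vset (range num)"
  have ew: "elts w = range num" by (simp add: w_def elts_vset small_range_nat)
  have tr: "transitive_set (num n :: 'v)" for n
    by (auto simp: transitive_set_def elts_num)
  have o1: "elts (num n :: 'v) = {} \<or> (\<exists>m\<in>elts w. elts (num n :: 'v) = insert m (elts m))" for n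
    by (cases n) (auto simp: elts_num_Suc ew elts_num[of 0])
  have o2: "ordinal w" using tr by (auto simp: ordinal_def transitive_set_def ew elts_num)
  have o3: "num 0 \<in> elts w" "elts (num 0 :: 'v) = {}" by (auto simp: ew elts_num[of 0])
  have o4: "\<exists>m\<in>elts w. elts m = insert n (elts n)" if "n \<in> elts w" for n
    using that elts_num_Suc by (auto simp: ew)
  have "is_omega w" unfolding is_omega_def
  proof (intro conjI ballI)
    show "\<exists>n\<in>elts w. elts n = {}" using o3 by blast
    show "elts n = {} \<or> (\<exists>m\<in>elts w. elts n = insert m (elts m))" if "n \<in> elts w" for n
    proof -
      obtain k where "n = num k" using \<open>n \<in> elts w\<close> unfolding ew by (rule rangeE)
      then show ?thesis using o1[of k] by metis
    qed
  qed (use o2 o4 in auto)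
  then show ?thesis by blast
qed

text \<open>Membership induction shows that every member is a numeral, ordinary induction that every
  numeral is a member. This is what lets \<open>fm_countable\<close> mean HOL countability in the
  universe.\<close>

lemma is_omega_elts: "is_omega w \<Longrightarrow> elts w = range num"
proof (intro subset_antisym subsetI)
  fix n assume w: "is_omega w"
  { assume "n \<in> elts w"
    then show "n \<in> range num"
    proof (induction n rule: mem_induct)
      case (mem n)
      show ?case
      proof (cases "elts n = {}")
        case True
        then have "n = num 0" by (simp add: elts_num elts_inject [symmetric])
        then show ?thesis by simp
      next
        case False
        then obtain m where m: "m \<in> elts w" "elts n = insert m (elts m)"
          using w mem.prems unfolding is_omega_def by blast
        then obtain k where "m = num k" using mem.IH[of m] by auto
        then have "elts n = elts (num (Suc k))" using m(2) by (simp only: elts_num_Suc)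
        then have "n = num (Suc k)" by (simp only: elts_inject)
        then show ?thesis by simp
      qed
    qed }
  have "num k \<in> elts w" for k
  proof (induction k)
    case 0
    then show ?case using w elts_num[of 0] unfolding is_omega_def by (metis elts_inject image_empty lessThan_0)
  next
    case (Suc k)
    then show ?case using w elts_num_Suc unfolding is_omega_def by (metis elts_inject)
  qed
  then show "n \<in> range num \<Longrightarrow> n \<in> elts w" by blast
qed

lemma sat_fm_countable [simp]: "sat UNIV (fm_countable x) e \<longleftrightarrow> countable (elts (e x))"
proof -
  have "(\<exists>w f. is_omega w \<and> function_graph f X w \<and>
      (\<forall>a\<in>elts X. \<forall>b\<in>elts X. \<forall>c. vpair a c \<in> elts f \<and> vpair b c \<in> elts f \<longrightarrow> a = b)) \<longleftrightarrow> countable (elts X)"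
    (is "?L \<longleftrightarrow> ?R") for X :: 'a
  proof
    assume ?L
    then obtain w f where w: "is_omega w" and f: "function_graph f X w"
      and inj: "\<And>a b c. a \<in> elts X \<Longrightarrow> b \<in> elts X \<Longrightarrow> vpair a c \<in> elts f \<Longrightarrow> vpair b c \<in> elts f \<Longrightarrow> a = b"
      by metis
    define g where "g a = (SOME b. b \<in> elts w \<and> vpair a b \<in> elts f)" for a
    have g: "g a \<in> elts w \<and> vpair a (g a) \<in> elts f" if "a \<in> elts X" for a
      unfolding g_def by (rule someI_ex) (use f that in \<open>auto simp: function_graph_def\<close>)
    have "inj_on g (elts X)" using g inj by (metis inj_onI)
    moreover have "countable (g ` elts X)"
      by (rule countable_subset[of _ "range num"]) (use g is_omega_elts[OF w] in auto)
    ultimately show ?R using countable_image_inj_on by blast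
  next
    assume R: ?R
    obtain w :: 'a where w: "is_omega w" using ex_is_omega by blast
    define k where "k a = (num (to_nat_on (elts X) a) :: 'a)" for a
    have inj: "inj_on k (elts X)" using inj_on_to_nat_on[OF R] by (auto simp: k_def inj_on_def num_inject)
    define f where "f = vset ((\<lambda>a. vpair a (k a)) ` elts X)"
    have ef: "elts f = (\<lambda>a. vpair a (k a)) ` elts X" unfolding f_def by (simp add: elts_vset small_image)
    have "function_graph f X w" by (auto simp: function_graph_def ef is_omega_elts[OF w] k_def)
    moreover have "\<forall>a\<in>elts X. \<forall>b\<in>elts X. \<forall>c. vpair a c \<in> elts f \<and> vpair b c \<in> elts f \<longrightarrow> a = b"
    proof (intro ballI allI impI)
      fix a b c assume ab: "a \<in> elts X" "b \<in> elts X" "vpair a c \<in> elts f \<and> vpair b c \<in> elts f"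
      then have "k a = c" "k b = c" by (auto simp: ef)
      then show "a = b" using inj ab by (auto dest: inj_onD)
    qed
    ultimately show ?L using w by blast
  qed
  from this[of "e x"] show ?thesis by (simp add: fm_countable_def Let_def)
qed

lemma sat_fm_omega1 [simp]:
  "sat UNIV (fm_omega1 h) e \<longleftrightarrow> elts (e h) = {a. ordinal a \<and> countable (elts a)}"
  by (auto simp: fm_omega1_def Let_def)

text \<open>The set of countable ordinals is an ordinal; were it countable, it would be a member of
  itself.\<close>

lemma uncountable_omega1:
  assumes "elts h = {a. ordinal a \<and> countable (elts a)}" shows "uncountable (elts h)" "ordinal h"
proof -
  show "ordinal h"
    unfolding ordinal_def transitive_set_def
    using assms ordinal_mem countable_subset ordinal_def transitive_set_def
    by (metis (mono_tags, lifting) mem_Collect_eq subsetI)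
  then show "uncountable (elts h)" using assms mem_irrefl by blast
qed

lemma sat_fm_chain [simp]: "sat UNIV (fm_chain t r A) e \<longleftrightarrow> elts (e A) \<subseteq> elts (e t) \<and>
    (\<forall>x\<in>elts (e A). \<forall>y\<in>elts (e A). x = y \<or> vpair x y \<in> elts (e r) \<or> vpair y x \<in> elts (e r))"
  by (auto simp: fm_chain_def Let_def)

lemma sat_fm_antichain [simp]: "sat UNIV (fm_antichain t r A) e \<longleftrightarrow> elts (e A) \<subseteq> elts (e t) \<and>
    (\<forall>x\<in>elts (e A). \<forall>y\<in>elts (e A). vpair x y \<notin> elts (e r))"
  by (auto simp: fm_antichain_def Let_def)

lemma suslin_tree_iff:
  "suslin_tree T R \<longleftrightarrow>
    sat UNIV (fm_tree 0 1) (env2 T R) \<and>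
    (\<exists>h. elts h = {a. ordinal a \<and> countable (elts a)} \<and> sat UNIV (fm_tree_height 0 1 2) ((env2 T R)(2 := h))) \<and>
    (\<forall>A. elts A \<subseteq> elts T \<longrightarrow> (\<forall>x\<in>elts A. \<forall>y\<in>elts A. x = y \<or> vpair x y \<in> elts R \<or> vpair y x \<in> elts R) \<longrightarrow>
       countable (elts A)) \<and>
    (\<forall>A. elts A \<subseteq> elts T \<longrightarrow> (\<forall>x\<in>elts A. \<forall>y\<in>elts A. vpair x y \<notin> elts R) \<longrightarrow> countable (elts A))"
  by (simp add: suslin_tree_def fm_suslin_tree_def Let_def env2_def numeral_2_eq_2 numeral_3_eq_3 imp_conjL)

lemma sat_fm_tree:
  "sat UNIV (fm_tree t r) e \<longleftrightarrow>
    (\<forall>x\<in>elts (e t). vpair x x \<notin> elts (e r)) \<and>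
    (\<forall>x\<in>elts (e t). \<forall>y\<in>elts (e t). \<forall>z\<in>elts (e t).
       vpair x y \<in> elts (e r) \<and> vpair y z \<in> elts (e r) \<longrightarrow> vpair x z \<in> elts (e r)) \<and>
    (\<forall>x\<in>elts (e t). \<forall>X. (\<exists>y. y \<in> elts X) \<and> (\<forall>y\<in>elts X. y \<in> elts (e t) \<and> vpair y x \<in> elts (e r)) \<longrightarrow>
       (\<exists>y\<in>elts X. \<forall>z\<in>elts X. z = y \<or> vpair y z \<in> elts (e r)))"
  by (simp add: fm_tree_def Let_def Ball_def Bex_def)

text \<open>By separation every HOL subset of \<open>elts T\<close> is the extension of an element
  of the universe, so the quantifiers over sets in the formula reach all HOL subsets.\<close>

lemma ctbl_tree_of_suslin_tree:
  fixes T :: "'v::zfc_universe"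
  assumes S: "suslin_tree T R"
  shows "ctbl_tree (elts T) (\<lambda>x y. vpair x y \<in> elts R)"
proof
  have e: "env2 T R 0 = T" "env2 T R 1 = R" by (simp_all add: env2_def)
  have "sat UNIV (fm_tree 0 1) (env2 T R)" using S by (simp add: suslin_tree_iff)
  note t = this[unfolded sat_fm_tree e]
  note tree = conjunct1[OF t] conjunct1[OF conjunct2[OF t]] conjunct2[OF conjunct2[OF t]]
  show "vpair x x \<notin> elts R" if "x \<in> elts T" for x
    using tree(1) that by blast
  show "vpair x z \<in> elts R" if "x \<in> elts T" "y \<in> elts T" "z \<in> elts T" "vpair x y \<in> elts R" "vpair y z \<in> elts R" for x y z
    using tree(2) that by blast
  have *: "elts (vset A) = A" if "A \<subseteq> elts T" for A
    using elts_vset small_subset[OF small_elts that] by blast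
  show "\<exists>y\<in>X. \<forall>z\<in>X. z = y \<or> vpair y z \<in> elts R"
    if "x \<in> elts T" "X \<noteq> {}" "\<And>y. y \<in> X \<Longrightarrow> y \<in> elts T \<and> vpair y x \<in> elts R" for x X
  proof -
    have e: "elts (vset X) = X" using * that(3) by blast
    show ?thesis using tree(3)[THEN bspec, OF that(1), THEN spec, of "vset X"] that(2,3) unfolding e by blast
  qed
  have "\<forall>A. elts A \<subseteq> elts T \<longrightarrow> (\<forall>x\<in>elts A. \<forall>y\<in>elts A. x = y \<or> vpair x y \<in> elts R \<or> vpair y x \<in> elts R) \<longrightarrow>
       countable (elts A)"
    and "\<forall>A. elts A \<subseteq> elts T \<longrightarrow> (\<forall>x\<in>elts A. \<forall>y\<in>elts A. vpair x y \<notin> elts R) \<longrightarrow> countable (elts A)"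
    using S unfolding suslin_tree_iff by blast+
  note cc = this[rule_format]
  show "countable A" if "A \<subseteq> elts T" "\<And>x y. x \<in> A \<Longrightarrow> y \<in> A \<Longrightarrow> x = y \<or> vpair x y \<in> elts R \<or> vpair y x \<in> elts R" for A
    using cc(1)[of "vset A"] that(2) by (simp add: *[OF that(1)] that(1))
  show "countable A" if "A \<subseteq> elts T" "\<And>x y. x \<in> A \<Longrightarrow> y \<in> A \<Longrightarrow> vpair x y \<notin> elts R" for A
    using cc(2)[of "vset A"] that(2) by (simp add: *[OF that(1)] that(1))
qed

section \<open>The forcing relation\<close>

text \<open>Environments assign names to all variables; \<open>fv\<close> restricts the demand of
  forced equality to the variables that a formula mentions.\<close>

primrec fv :: "fm \<Rightarrow> nat set" where
  "fv (FMem i j) = {i, j}"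
| "fv (FEq i j) = {i, j}"
| "fv (FNeg \<phi>) = fv \<phi>"
| "fv (FAnd \<phi> \<psi>) = fv \<phi> \<union> fv \<psi>"
| "fv (FAll i \<phi>) = fv \<phi> - {i}"

lemma fv_connectives [simp]:
  "fv (FOr \<phi> \<psi>) = fv \<phi> \<union> fv \<psi>" "fv (FImp \<phi> \<psi>) = fv \<phi> \<union> fv \<psi>" "fv (FIff \<phi> \<psi>) = fv \<phi> \<union> fv \<psi>"
  "fv (FEx i \<phi>) = fv \<phi> - {i}" "fv (FBall i j \<phi>) = insert j (fv \<phi>) - {i}" "fv (FBex i j \<phi>) = insert j (fv \<phi>) - {i}"
  by (auto simp: FOr_def FImp_def FIff_def FEx_def FBall_def FBex_def)

locale forcing_preorder =
  fixes P :: "'v::zfc_universe" and le :: "'v \<Rightarrow> 'v \<Rightarrow> bool"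
  assumes forcing_notion: "forcing_notion P le"
begin

abbreviation nm where "nm \<equiv> is_name P"
abbreviation ck where "ck \<equiv> check_name P"
abbreviation mem where "mem \<equiv> forces_mem P le"
abbreviation eq where "eq \<equiv> forces_eq P le"
abbreviation frc where "frc \<equiv> forces P le"

section \<open>Monotonicity and density of the forcing relation\<close>

lemma le_refl: "p \<in> elts P \<Longrightarrow> le p p"
  using forcing_notion by (auto simp: forcing_notion_def)

lemma le_trans: "p \<in> elts P \<Longrightarrow> q \<in> elts P \<Longrightarrow> r \<in> elts P \<Longrightarrow> le p q \<Longrightarrow> le q r \<Longrightarrow> le p r"
  using forcing_notion unfolding forcing_notion_def by blast

lemma nm_memD: "nm \<tau> \<Longrightarrow> vpair \<sigma> s \<in> elts \<tau> \<Longrightarrow> nm \<sigma> \<and> s \<in> elts P"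
  by (erule is_name.cases) force

lemma mem_iff: "mem p \<pi> \<tau> \<longleftrightarrow> (\<forall>q\<in>elts P. le q p \<longrightarrow>
    (\<exists>r\<in>elts P. le r q \<and> (\<exists>\<sigma> s. vpair \<sigma> s \<in> elts \<tau> \<and> le r s \<and> eq r \<pi> \<sigma>)))"
  by (subst forces_mem.simps) simp

lemma eq_iff: "eq p \<tau> \<sigma> \<longleftrightarrow>
    (\<forall>\<pi> s. vpair \<pi> s \<in> elts \<tau> \<longrightarrow> (\<forall>q\<in>elts P. le q p \<longrightarrow> le q s \<longrightarrow> mem q \<pi> \<sigma>)) \<and>
    (\<forall>\<pi> s. vpair \<pi> s \<in> elts \<sigma> \<longrightarrow> (\<forall>q\<in>elts P. le q p \<longrightarrow> le q s \<longrightarrow> mem q \<pi> \<tau>))"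
  by (subst forces_eq.simps) simp

lemma mem_check_elts: "z \<in> elts (ck x) \<longleftrightarrow> (\<exists>y\<in>elts x. \<exists>s\<in>elts P. z = vpair (ck y) s)"
proof -
  have "elts (ck x) = (\<Union>y\<in>elts x. (\<lambda>p. vpair (ck y) p) ` elts P)"
    by (subst check_name.simps) (intro elts_vset small_UN small_image small_elts)
  then show ?thesis by auto
qed

lemma vpair_mem_check: "vpair \<sigma> s \<in> elts (ck x) \<longleftrightarrow> s \<in> elts P \<and> (\<exists>y\<in>elts x. \<sigma> = ck y)"
  by (auto simp: mem_check_elts)

lemma nm_check [simp]: "nm (ck x)"
proof (induction x rule: mem_induct)
  case (mem x)
  then show ?case by (intro is_name.intros) (auto simp: mem_check_elts)
qed

lemma mem_down: "mem p \<pi> \<tau> \<Longrightarrow> p \<in> elts P \<Longrightarrow> q \<in> elts P \<Longrightarrow> le q p \<Longrightarrow> mem q \<pi> \<tau>"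
  unfolding mem_iff using le_trans by blast

lemma eq_down: "eq p \<sigma> \<tau> \<Longrightarrow> p \<in> elts P \<Longrightarrow> q \<in> elts P \<Longrightarrow> le q p \<Longrightarrow> eq q \<sigma> \<tau>"
  unfolding eq_iff[of p] eq_iff[of q] using le_trans by blast

lemma frc_down:
  assumes "frc p \<phi> e" "p \<in> elts P" "q \<in> elts P" "le q p"
  shows "frc q \<phi> e"
  using assms(1)
proof (induction \<phi> arbitrary: e)
  case (FMem i j)
  then show ?case using mem_down assms by simp
next
  case (FEq i j)
  then show ?case using eq_down assms by simp
next
  case (FNeg \<phi>)
  then show ?case using le_trans[OF _ assms(3,2) _ assms(4)] by simp
next
  case (FAnd \<phi> \<psi>)
  then show ?case by simp
next
  case (FAll i \<phi>)
  then show ?case unfolding forces.simps by blast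
qed

lemma mem_dense:
  assumes "p \<in> elts P" "\<And>q. q \<in> elts P \<Longrightarrow> le q p \<Longrightarrow> \<exists>r\<in>elts P. le r q \<and> mem r \<pi> \<tau>"
  shows "mem p \<pi> \<tau>"
  unfolding mem_iff
proof (intro ballI impI)
  fix q assume q: "q \<in> elts P" "le q p"
  then obtain r where r: "r \<in> elts P" "le r q" "mem r \<pi> \<tau>" using assms by blast
  then obtain r' \<sigma> s where "r' \<in> elts P" "le r' r" "vpair \<sigma> s \<in> elts \<tau>" "le r' s" "eq r' \<pi> \<sigma>"
    using le_refl unfolding mem_iff by blast
  then show "\<exists>r\<in>elts P. le r q \<and> (\<exists>\<sigma> s. vpair \<sigma> s \<in> elts \<tau> \<and> le r s \<and> eq r \<pi> \<sigma>)"
    using le_trans[of r' r q] r q by blast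
qed

text \<open>Being names guarantees that the conditions inside the pairs belong to \<open>P\<close>,
  where \<open>le\<close> is transitive.\<close>

lemma eq_dense:
  assumes nm: "nm \<sigma>" "nm \<tau>" and p: "p \<in> elts P"
    and d: "\<And>q. q \<in> elts P \<Longrightarrow> le q p \<Longrightarrow> \<exists>r\<in>elts P. le r q \<and> eq r \<sigma> \<tau>"
  shows "eq p \<sigma> \<tau>"
proof (rule forces_eqI; intro allI impI ballI)
  fix \<pi> s q assume m: "vpair \<pi> s \<in> elts \<sigma>" and q: "q \<in> elts P" "le q p" "le q s"
  show "mem q \<pi> \<tau>"
  proof (rule mem_dense[OF q(1)])
    fix q' assume q': "q' \<in> elts P" "le q' q"
    then obtain r where r: "r \<in> elts P" "le r q'" "eq r \<sigma> \<tau>" using d[of q'] le_trans[of q' q p] q p by blast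
    moreover have "le r s" using le_trans[of r q' q] le_trans[of r q s] r q q' nm_memD[OF nm(1) m] by blast
    ultimately have "mem r \<pi> \<tau>" using m le_refl unfolding eq_iff[of r] by blast
    then show "\<exists>r\<in>elts P. le r q' \<and> mem r \<pi> \<tau>" using r by blast
  qed
next
  fix \<pi> s q assume m: "vpair \<pi> s \<in> elts \<tau>" and q: "q \<in> elts P" "le q p" "le q s"
  show "mem q \<pi> \<sigma>"
  proof (rule mem_dense[OF q(1)])
    fix q' assume q': "q' \<in> elts P" "le q' q"
    then obtain r where r: "r \<in> elts P" "le r q'" "eq r \<sigma> \<tau>" using d[of q'] le_trans[of q' q p] q p by blast
    moreover have "le r s" using le_trans[of r q' q] le_trans[of r q s] r q q' nm_memD[OF nm(2) m] by blast
    ultimately have "mem r \<pi> \<sigma>" using m le_refl unfolding eq_iff[of r] by blast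
    then show "\<exists>r\<in>elts P. le r q' \<and> mem r \<pi> \<sigma>" using r by blast
  qed
qed

text \<open>This takes the place of reasoning inside a generic filter: wherever a name has to be
  decided, one may pass to an extension. For a negation, a condition forcing \<open>\<phi>\<close>
  would have an extension forcing both \<open>\<phi>\<close> and its negation.\<close>

lemma frc_dense:
  assumes "p \<in> elts P" "\<And>i. nm (e i)"
    "\<And>q. q \<in> elts P \<Longrightarrow> le q p \<Longrightarrow> \<exists>r\<in>elts P. le r q \<and> frc r \<phi> e"
  shows "frc p \<phi> e"
  using assms
proof (induction \<phi> arbitrary: e p)
  case (FMem i j)
  then show ?case by (auto intro: mem_dense)
next
  case (FEq i j)
  then show ?case by (auto intro: eq_dense)
next
  case (FNeg \<phi>)
  show ?case unfolding forces.simps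
  proof (intro ballI impI notI)
    fix q assume q: "q \<in> elts P" "le q p" "frc q \<phi> e"
    then obtain r where "r \<in> elts P" "le r q" "frc r (FNeg \<phi>) e" using FNeg.prems by blast
    then show False using q frc_down[of q \<phi> e r] le_refl by auto
  qed
next
  case (FAnd \<phi> \<psi>)
  have "frc p \<phi> e"
    using FAnd.IH(1)[of p e, OF FAnd.prems(1,2)] FAnd.prems(3) unfolding forces.simps by blast
  moreover have "frc p \<psi> e"
    using FAnd.IH(2)[of p e, OF FAnd.prems(1,2)] FAnd.prems(3) unfolding forces.simps by blast
  ultimately show ?case by simp
next
  case (FAll i \<phi>)
  have "frc p \<phi> (e(i := \<tau>))" if "nm \<tau>" for \<tau>
  proof (rule FAll.IH[OF FAll.prems(1)])
    show "nm ((e(i := \<tau>)) k)" for k using FAll.prems(2) that by simp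
    show "\<exists>r\<in>elts P. le r q \<and> frc r \<phi> (e(i := \<tau>))" if "q \<in> elts P" "le q p" for q
      using FAll.prems(3)[OF that] \<open>nm \<tau>\<close> unfolding forces.simps by blast
  qed
  then show ?case by simp
qed

section \<open>Forced equality as a congruence\<close>

lemma eq_sym: "eq p \<sigma> \<tau> \<Longrightarrow> eq p \<tau> \<sigma>"
  unfolding eq_iff[of p \<sigma>] eq_iff[of p \<tau>] by blast

lemma mem_vpairI:
  assumes "nm \<tau>" "vpair \<sigma> s \<in> elts \<tau>" "le p s" "p \<in> elts P" and eq: "\<And>q. q \<in> elts P \<Longrightarrow> le q p \<Longrightarrow> eq q \<pi> \<sigma>"
  shows "mem p \<pi> \<tau>"
  unfolding mem_iff using assms le_trans[of _ p s] nm_memD[OF assms(1,2)] le_refl by blast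

lemma eq_refl: "nm \<tau> \<Longrightarrow> eq p \<tau> \<tau>"
proof (induction \<tau> arbitrary: p rule: name_induct)
  case (name \<tau>)
  have "mem q \<pi> \<tau>" if "vpair \<pi> s \<in> elts \<tau>" "q \<in> elts P" "le q s" for \<pi> s q
    using mem_vpairI[OF name.prems that(1,3,2)] name.IH that nm_memD[OF name.prems that(1)] by blast
  then show ?case unfolding eq_iff by blast
qed

lemma eq_trans: "nm \<tau> \<Longrightarrow> nm \<sigma> \<Longrightarrow> nm \<rho> \<Longrightarrow> p \<in> elts P \<Longrightarrow> eq p \<tau> \<sigma> \<Longrightarrow> eq p \<sigma> \<rho> \<Longrightarrow> eq p \<tau> \<rho>"
proof (induction \<tau> arbitrary: \<sigma> \<rho> p rule: name_induct)
  case (name \<tau>)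
  have *: "\<exists>r\<in>elts P. le r q \<and> (\<exists>\<sigma>' s. vpair \<sigma>' s \<in> elts \<beta> \<and> le r s \<and> eq r \<pi> \<sigma>')"
    if "eq p \<alpha> \<beta>" "vpair \<pi> s \<in> elts \<alpha>" "q \<in> elts P" "le q p" "le q s" for \<alpha> \<beta> \<pi> s q p
    using that le_refl unfolding eq_iff[of p] mem_iff by blast
  show ?case
  proof (rule forces_eqI; intro allI impI ballI)
    fix \<pi> s q assume m: "vpair \<pi> s \<in> elts \<tau>" and q: "q \<in> elts P" "le q p" "le q s"
    have n\<pi>: "nm \<pi>" "s \<in> elts P" using nm_memD name.prems(1) m by blast+
    show "mem q \<pi> \<rho>" unfolding mem_iff
    proof (intro ballI impI)
      fix q1 assume q1: "q1 \<in> elts P" "le q1 q"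
      have q1': "le q1 p" "le q1 s" using le_trans[of q1 q] q q1 name.prems(4) n\<pi> by blast+
      obtain r \<pi>1 s1 where r: "r \<in> elts P" "le r q1" "vpair \<pi>1 s1 \<in> elts \<sigma>" "le r s1" "eq r \<pi> \<pi>1"
        using *[OF name.prems(5) m q1(1) q1'] by blast
      have rp: "le r p" using le_trans[of r q1 p] r q1 q1' name.prems(4) by blast
      obtain r' \<pi>2 s2 where r': "r' \<in> elts P" "le r' r" "vpair \<pi>2 s2 \<in> elts \<rho>" "le r' s2" "eq r' \<pi>1 \<pi>2"
        using *[OF name.prems(6) r(3) r(1) rp r(4)] by blast
      have "nm \<pi>1" "nm \<pi>2" using nm_memD name.prems(2,3) r r' by blast+
      then have "eq r' \<pi> \<pi>2" using name.IH[OF m n\<pi>(1)] eq_down[OF r(5,1) r'(1,2)] r' by blast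
      then show "\<exists>r\<in>elts P. le r q1 \<and> (\<exists>\<sigma> s. vpair \<sigma> s \<in> elts \<rho> \<and> le r s \<and> eq r \<pi> \<sigma>)"
        using r' r q1 le_trans[of r' r q1] by blast
    qed
  next
    fix \<pi> s q assume m: "vpair \<pi> s \<in> elts \<rho>" and q: "q \<in> elts P" "le q p" "le q s"
    have n\<pi>: "nm \<pi>" "s \<in> elts P" using nm_memD name.prems(3) m by blast+
    show "mem q \<pi> \<tau>" unfolding mem_iff
    proof (intro ballI impI)
      fix q1 assume q1: "q1 \<in> elts P" "le q1 q"
      have q1': "le q1 p" "le q1 s" using le_trans[of q1 q] q q1 name.prems(4) n\<pi> by blast+
      obtain r \<pi>1 s1 where r: "r \<in> elts P" "le r q1" "vpair \<pi>1 s1 \<in> elts \<sigma>" "le r s1" "eq r \<pi> \<pi>1"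
        using *[OF eq_sym[OF name.prems(6)] m q1(1) q1'] by blast
      have rp: "le r p" using le_trans[of r q1 p] r q1 q1' name.prems(4) by blast
      obtain r' \<pi>2 s2 where r': "r' \<in> elts P" "le r' r" "vpair \<pi>2 s2 \<in> elts \<tau>" "le r' s2" "eq r' \<pi>1 \<pi>2"
        using *[OF eq_sym[OF name.prems(5)] r(3) r(1) rp r(4)] by blast
      have "nm \<pi>1" "nm \<pi>2" using nm_memD name.prems(1,2) r r' by blast+
      \<comment> \<open>The induction is on \<open>\<tau>\<close>, so the hypothesis is applied to
        \<open>\<pi>2\<close> from \<open>\<tau>\<close>, reading the chain of equalities
        backwards.\<close>
      then have "eq r' \<pi>2 \<pi>"
        using name.IH[OF r'(3) _ _ n\<pi>(1) r'(1) eq_sym[OF r'(5)] eq_sym[OF eq_down[OF r(5,1) r'(1,2)]]] by blast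
      then show "\<exists>r\<in>elts P. le r q1 \<and> (\<exists>\<sigma> s. vpair \<sigma> s \<in> elts \<tau> \<and> le r s \<and> eq r \<pi> \<sigma>)"
        using r' r q1 le_trans[of r' r q1] eq_sym by blast
    qed
  qed
qed

lemma mem_cong:
  assumes nm: "nm \<pi>" "nm \<pi>'" "nm \<tau>" "nm \<tau>'" and p: "p \<in> elts P"
    and eq: "eq p \<pi> \<pi>'" "eq p \<tau> \<tau>'" and m: "mem p \<pi> \<tau>"
  shows "mem p \<pi>' \<tau>'"
  unfolding mem_iff
proof (intro ballI impI)
  fix q assume q: "q \<in> elts P" "le q p"
  then obtain r \<sigma> s where r: "r \<in> elts P" "le r q" "vpair \<sigma> s \<in> elts \<tau>" "le r s" "eq r \<pi> \<sigma>"
    using m unfolding mem_iff by blast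
  have rp: "le r p" using le_trans[of r q p] r q p by blast
  have "mem r \<sigma> \<tau>'" using eq(2) r rp unfolding eq_iff[of p] by blast
  then obtain r' \<sigma>' s' where r': "r' \<in> elts P" "le r' r" "vpair \<sigma>' s' \<in> elts \<tau>'" "le r' s'" "eq r' \<sigma> \<sigma>'"
    unfolding mem_iff using le_refl r(1) by blast
  have n: "nm \<sigma>" "nm \<sigma>'" using nm_memD nm r r' by blast+
  have "le r' p" using le_trans[of r' r p] r r' rp p by blast
  then have "eq r' \<pi>' \<pi>" using eq_sym eq_down[OF eq(1) p r'(1)] by blast
  moreover have "eq r' \<pi> \<sigma>" using eq_down[OF r(5,1) r'(1,2)] .
  ultimately have "eq r' \<pi>' \<sigma>'"
    using eq_trans[OF nm(2,1) n(1) r'(1)] eq_trans[OF nm(2) n r'(1) _ r'(5)] by blast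
  then show "\<exists>r\<in>elts P. le r q \<and> (\<exists>\<sigma> s. vpair \<sigma> s \<in> elts \<tau>' \<and> le r s \<and> eq r \<pi>' \<sigma>)"
    using r' le_trans[of r' r q] r q by blast
qed

text \<open>Negation exchanges the two environments, so both stay arbitrary in the induction and
  symmetry of forced equality is used.\<close>

lemma frc_cong:
  assumes "\<And>i. nm (e i)" "\<And>i. nm (e' i)" "p \<in> elts P" "\<And>i. i \<in> fv \<phi> \<Longrightarrow> eq p (e i) (e' i)" "frc p \<phi> e"
  shows "frc p \<phi> e'"
  using assms
proof (induction \<phi> arbitrary: e e' p)
  case (FMem i j)
  then show ?case using mem_cong[of "e i" "e' i" "e j" "e' j" p] by auto
next
  case (FEq i j)
  then show ?case using eq_trans[of "e' i" "e i" "e j" p] eq_trans[of "e' i" "e j" "e' j" p] eq_sym by simp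
next
  case (FNeg \<phi>)
  show ?case unfolding forces.simps
  proof (intro ballI impI notI)
    fix q assume q: "q \<in> elts P" "le q p" "frc q \<phi> e'"
    have "frc q \<phi> e"
    proof (rule FNeg.IH[of e' e, OF FNeg.prems(2,1) q(1) _ q(3)])
      show "eq q (e' i) (e i)" if "i \<in> fv \<phi>" for i
        using eq_sym[OF eq_down[OF FNeg.prems(4)[of i] FNeg.prems(3) q(1,2)]] that by simp
    qed
    then show False using FNeg.prems(5) q(1,2) by simp
  qed
next
  case (FAnd \<phi> \<psi>)
  have "frc p \<phi> e'" by (rule FAnd.IH(1)[of e e', OF FAnd.prems(1-3)]) (use FAnd.prems(4,5) in simp_all)
  moreover have "frc p \<psi> e'" by (rule FAnd.IH(2)[of e e', OF FAnd.prems(1-3)]) (use FAnd.prems(4,5) in simp_all)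
  ultimately show ?case by simp
next
  case (FAll i \<phi>)
  have "frc p \<phi> (e'(i := \<tau>))" if "nm \<tau>" for \<tau>
  proof (rule FAll.IH)
    show "frc p \<phi> (e(i := \<tau>))" using FAll.prems(5) that unfolding forces.simps by blast
    show "nm ((e(i := \<tau>)) j)" "nm ((e'(i := \<tau>)) j)" for j using FAll.prems(1,2) that by simp_all
    show "eq p ((e(i := \<tau>)) j) ((e'(i := \<tau>)) j)" if "j \<in> fv \<phi>" for j
      using FAll.prems(4)[of j] that eq_refl[OF \<open>nm \<tau>\<close>] by simp
  qed (rule FAll.prems(3))
  then show ?case by simp
qed

section \<open>Derived connectives and check names\<close>

lemma frc_FOr: "frc p (FOr \<phi> \<psi>) e \<longleftrightarrow> (\<forall>q\<in>elts P. le q p \<longrightarrow> (\<exists>r\<in>elts P. le r q \<and> (frc r \<phi> e \<or> frc r \<psi> e)))"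
  by (simp add: FOr_def) blast

text \<open>As a negated conjunction, implication yields the conclusion only densely;
  \<open>frc_dense\<close> removes the density.\<close>

lemma frc_FImp:
  assumes "p \<in> elts P" "\<And>i. nm (e i)"
  shows "frc p (FImp \<phi> \<psi>) e \<longleftrightarrow> (\<forall>q\<in>elts P. le q p \<longrightarrow> frc q \<phi> e \<longrightarrow> frc q \<psi> e)"
proof
  assume L: "frc p (FImp \<phi> \<psi>) e"
  show "\<forall>q\<in>elts P. le q p \<longrightarrow> frc q \<phi> e \<longrightarrow> frc q \<psi> e"
  proof (intro ballI impI)
    fix q assume q: "q \<in> elts P" "le q p" "frc q \<phi> e"
    show "frc q \<psi> e"
    proof (rule frc_dense[OF q(1) assms(2)])
      fix q' assume q': "q' \<in> elts P" "le q' q"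
      then have "le q' p" "frc q' \<phi> e" using le_trans[of q' q p] frc_down[of q \<phi> e q'] q assms by blast+
      then show "\<exists>r\<in>elts P. le r q' \<and> frc r \<psi> e" using L q' by (auto simp: FImp_def)
    qed
  qed
next
  assume "\<forall>q\<in>elts P. le q p \<longrightarrow> frc q \<phi> e \<longrightarrow> frc q \<psi> e"
  then show "frc p (FImp \<phi> \<psi>) e" using le_refl by (auto simp: FImp_def)
qed

lemma frc_FIff:
  assumes "p \<in> elts P" "\<And>i. nm (e i)"
  shows "frc p (FIff \<phi> \<psi>) e \<longleftrightarrow> (\<forall>q\<in>elts P. le q p \<longrightarrow> (frc q \<phi> e \<longleftrightarrow> frc q \<psi> e))"
  unfolding FIff_def forces.simps frc_FImp[OF assms] by blast

lemma frc_FEx: "frc p (FEx i \<phi>) e \<longleftrightarrow>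
    (\<forall>q\<in>elts P. le q p \<longrightarrow> (\<exists>r\<in>elts P. le r q \<and> (\<exists>\<tau>. nm \<tau> \<and> frc r \<phi> (e(i := \<tau>)))))"
  by (simp add: FEx_def) blast

lemma frc_FExI: "p \<in> elts P \<Longrightarrow> nm \<tau> \<Longrightarrow> frc p \<phi> (e(i := \<tau>)) \<Longrightarrow> frc p (FEx i \<phi>) e"
  unfolding frc_FEx using frc_down le_refl by blast

lemma frc_FExE:
  assumes "frc p (FEx i \<phi>) e" "p \<in> elts P"
  obtains q \<tau> where "q \<in> elts P" "le q p" "nm \<tau>" "frc q \<phi> (e(i := \<tau>))"
  using assms le_refl unfolding frc_FEx by blast

lemma frc_FBall:
  assumes "p \<in> elts P" "\<And>i. nm (e i)" "i \<noteq> j"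
  shows "frc p (FBall i j \<phi>) e \<longleftrightarrow>
    (\<forall>\<tau>. nm \<tau> \<longrightarrow> (\<forall>q\<in>elts P. le q p \<longrightarrow> mem q \<tau> (e j) \<longrightarrow> frc q \<phi> (e(i := \<tau>))))"
  using assms unfolding FBall_def by (auto simp: frc_FImp)

lemma frc_FBexI:
  "p \<in> elts P \<Longrightarrow> nm \<tau> \<Longrightarrow> i \<noteq> j \<Longrightarrow> mem p \<tau> (e j) \<Longrightarrow> frc p \<phi> (e(i := \<tau>)) \<Longrightarrow> frc p (FBex i j \<phi>) e"
  unfolding FBex_def by (rule frc_FExI) auto

lemma frc_FBexE:
  assumes "frc p (FBex i j \<phi>) e" "p \<in> elts P" "i \<noteq> j"
  obtains q \<tau> where "q \<in> elts P" "le q p" "nm \<tau>" "mem q \<tau> (e j)" "frc q \<phi> (e(i := \<tau>))"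
  using assms unfolding FBex_def by (auto elim!: frc_FExE)

lemma eq_check_iff: "p \<in> elts P \<Longrightarrow> eq p (ck x) (ck y) \<longleftrightarrow> x = y"
proof (induction x arbitrary: y p rule: mem_induct)
  case (mem x)
  have "elts x = elts y" if eq: "eq p (ck x) (ck y)"
  proof (intro subset_antisym subsetI)
    fix z assume z: "z \<in> elts x"
    then have "mem p (ck z) (ck y)"
      using eq mem.prems le_refl unfolding eq_iff[of p] vpair_mem_check by blast
    then obtain r w where "r \<in> elts P" "w \<in> elts y" "eq r (ck z) (ck w)"
      unfolding mem_iff vpair_mem_check using le_refl mem.prems by blast
    then show "z \<in> elts y" using mem.IH[OF z, of r w] by simp
  next
    fix z assume z: "z \<in> elts y"
    then have "mem p (ck z) (ck x)"
      using eq mem.prems le_refl unfolding eq_iff[of p] vpair_mem_check by blast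
    then obtain r w where "r \<in> elts P" "w \<in> elts x" "eq r (ck z) (ck w)"
      unfolding mem_iff vpair_mem_check using le_refl mem.prems by blast
    then show "z \<in> elts x" using mem.IH[of w r z] eq_sym[of r "ck z" "ck w"] by simp
  qed
  then have "x = y" if "eq p (ck x) (ck y)" using that extensionality by metis
  moreover have "eq p (ck x) (ck x)" by (simp add: eq_refl)
  ultimately show ?case by metis
qed

text \<open>Every condition is attached to every element of a check name, so \<open>r\<close> may
  serve as its own label and the clause on labels disappears.\<close>

lemma mem_check_iff: "mem p \<tau> (ck x) \<longleftrightarrow>
    (\<forall>q\<in>elts P. le q p \<longrightarrow> (\<exists>r\<in>elts P. le r q \<and> (\<exists>y\<in>elts x. eq r \<tau> (ck y))))"
proof -
  have *: "(\<exists>\<sigma> s. vpair \<sigma> s \<in> elts (ck x) \<and> le r s \<and> eq r \<tau> \<sigma>) \<longleftrightarrow> (\<exists>y\<in>elts x. eq r \<tau> (ck y))"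
    if "r \<in> elts P" for r
    using le_refl[OF that] that unfolding vpair_mem_check by blast
  show ?thesis unfolding mem_iff
    by (intro ball_cong imp_cong bex_cong conj_cong refl) (rule *)
qed

lemma mem_checkE:
  assumes "mem p \<tau> (ck x)" "p \<in> elts P"
  obtains r y where "r \<in> elts P" "le r p" "y \<in> elts x" "eq r \<tau> (ck y)"
  using assms le_refl unfolding mem_check_iff by blast

lemma mem_check_check_iff: "p \<in> elts P \<Longrightarrow> mem p (ck y) (ck x) \<longleftrightarrow> y \<in> elts x"
  unfolding mem_check_iff using eq_check_iff le_refl by metis

section \<open>Absoluteness between the ground model and the extension\<close>

definition absolute :: "fm \<Rightarrow> bool" where
  "absolute \<phi> \<longleftrightarrow> (\<forall>e. \<forall>p\<in>elts P. frc p \<phi> (ck \<circ> e) \<longleftrightarrow> sat UNIV \<phi> e)"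

definition upward_absolute :: "fm \<Rightarrow> bool" where
  "upward_absolute \<phi> \<longleftrightarrow> (\<forall>e. \<forall>p\<in>elts P. sat UNIV \<phi> e \<longrightarrow> frc p \<phi> (ck \<circ> e))"

text \<open>An unbounded quantifier over variable \<open>i\<close> whose matrix bounds \<open>i\<close> by a ground model set \<open>j\<close> ranges
  in effect over ground model sets only, so it is as harmless for absoluteness as a bounded one.\<close>

definition bounds :: "nat \<Rightarrow> nat \<Rightarrow> fm \<Rightarrow> bool" where
  "bounds i j \<phi> \<longleftrightarrow> (\<forall>e. \<forall>p\<in>elts P. (\<forall>k. nm (e k)) \<longrightarrow> (\<exists>x. e j = ck x) \<longrightarrow> frc p \<phi> e \<longrightarrow>
     (\<exists>q\<in>elts P. le q p \<and> (\<exists>x. eq q (e i) (ck x))))"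

lemma comp_check_upd: "ck \<circ> e(i := x) = (ck \<circ> e)(i := ck x)"
  by auto

text \<open>The form in which absoluteness is applied: arbitrary names qualify as soon as the
  condition forces them equal to check names.\<close>

lemma absolute_cong:
  assumes a: "absolute \<phi>" and e: "\<And>i. nm (e i)" and p: "p \<in> elts P" and v: "\<And>i. i \<in> fv \<phi> \<Longrightarrow> eq p (e i) (ck (v i))"
  shows "frc p \<phi> e \<longleftrightarrow> sat UNIV \<phi> v"
proof -
  have "frc p \<phi> (ck \<circ> v)" if "frc p \<phi> e"
    by (rule frc_cong[where e = e and e' = "ck \<circ> v", OF e _ p _ that]) (use v in simp_all)
  moreover have "frc p \<phi> e" if "frc p \<phi> (ck \<circ> v)"
    by (rule frc_cong[where e = "ck \<circ> v" and e' = e, OF _ e p _ that]) (use v[THEN eq_sym] in simp_all)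
  ultimately show ?thesis using a p unfolding absolute_def by metis
qed

lemma upward_absolute_cong:
  assumes a: "upward_absolute \<phi>" and e: "\<And>i. nm (e i)" and p: "p \<in> elts P" and v: "\<And>i. i \<in> fv \<phi> \<Longrightarrow> eq p (e i) (ck (v i))"
    and s: "sat UNIV \<phi> v"
  shows "frc p \<phi> e"
proof (rule frc_cong[where e = "ck \<circ> v" and e' = e, OF _ e p])
  show "frc p \<phi> (ck \<circ> v)" using a p s by (simp add: upward_absolute_def)
qed (use v[THEN eq_sym] in simp_all)

lemma absolute_FMem [intro!]: "absolute (FMem i j)"
  by (simp add: absolute_def mem_check_check_iff)

lemma absolute_FEq [intro!]: "absolute (FEq i j)"
  by (simp add: absolute_def eq_check_iff)

lemma absolute_FNeg [intro!]: "absolute \<phi> \<Longrightarrow> absolute (FNeg \<phi>)"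
  unfolding absolute_def using le_refl by auto

lemma absolute_FAnd [intro!]: "absolute \<phi> \<Longrightarrow> absolute \<psi> \<Longrightarrow> absolute (FAnd \<phi> \<psi>)"
  unfolding absolute_def by auto

lemma absolute_FOr [intro!]: "absolute \<phi> \<Longrightarrow> absolute \<psi> \<Longrightarrow> absolute (FOr \<phi> \<psi>)"
  and absolute_FImp [intro!]: "absolute \<phi> \<Longrightarrow> absolute \<psi> \<Longrightarrow> absolute (FImp \<phi> \<psi>)"
  and absolute_FIff [intro!]: "absolute \<phi> \<Longrightarrow> absolute \<psi> \<Longrightarrow> absolute (FIff \<phi> \<psi>)"
  unfolding FOr_def FIff_def FImp_def by auto

text \<open>Below each condition, either an extension makes \<open>\<tau>\<close> equal to a check
  name, and absoluteness of \<open>\<phi>\<close> applies there, or no extension does, and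
  hypothesis \<open>b\<close> takes over.\<close>

lemma absolute_FAll:
  assumes a: "absolute \<phi>"
    and b: "\<And>e p \<tau>. p \<in> elts P \<Longrightarrow> nm \<tau> \<Longrightarrow> (\<And>q x. q \<in> elts P \<Longrightarrow> le q p \<Longrightarrow> \<not> eq q \<tau> (ck x)) \<Longrightarrow>
      frc p \<phi> ((ck \<circ> e)(i := \<tau>))"
  shows "absolute (FAll i \<phi>)"
  unfolding absolute_def
proof (intro allI ballI iffI)
  fix e :: "nat \<Rightarrow> 'v" and p assume p: "p \<in> elts P"
  { assume L: "frc p (FAll i \<phi>) (ck \<circ> e)"
    have "sat UNIV \<phi> (e(i := x))" for x
    proof -
      have "frc p \<phi> (ck \<circ> e(i := x))" using L nm_check unfolding comp_check_upd forces.simps by blast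
      then show ?thesis using a p unfolding absolute_def by blast
    qed
    then show "sat UNIV (FAll i \<phi>) e" by simp }
  assume R: "sat UNIV (FAll i \<phi>) e"
  have "frc p \<phi> ((ck \<circ> e)(i := \<tau>))" if nt: "nm \<tau>" for \<tau>
  proof (rule frc_dense[OF p])
    show "nm (((ck \<circ> e)(i := \<tau>)) k)" for k using nt by simp
    fix q assume q: "q \<in> elts P" "le q p"
    show "\<exists>r\<in>elts P. le r q \<and> frc r \<phi> ((ck \<circ> e)(i := \<tau>))"
    proof (cases "\<exists>r\<in>elts P. le r q \<and> (\<exists>x. eq r \<tau> (ck x))")
      case True
      then obtain r x where r: "r \<in> elts P" "le r q" "eq r \<tau> (ck x)" by blast
      have "frc r \<phi> ((ck \<circ> e)(i := \<tau>)) \<longleftrightarrow> sat UNIV \<phi> (e(i := x))"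
        by (rule absolute_cong[OF a _ r(1)]) (use r nt eq_refl in auto)
      then show ?thesis using R r by auto
    next
      case False
      then show ?thesis using b[OF q(1) nt, of e] q le_refl by blast
    qed
  qed
  then show "frc p (FAll i \<phi>) (ck \<circ> e)" by simp
qed

lemma boundsD: "bounds i j \<phi> \<Longrightarrow> p \<in> elts P \<Longrightarrow> (\<And>k. nm (e k)) \<Longrightarrow> e j = ck x \<Longrightarrow> frc p \<phi> e \<Longrightarrow>
    \<exists>q\<in>elts P. le q p \<and> (\<exists>x. eq q (e i) (ck x))"
  unfolding bounds_def by blast

lemma bounds_check_envD:
  assumes "bounds i j \<phi>" "i \<noteq> j" "q \<in> elts P" "le q p" "p \<in> elts P" "nm \<tau>" "frc q \<phi> ((ck \<circ> e)(i := \<tau>))"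
    and "\<And>q x. q \<in> elts P \<Longrightarrow> le q p \<Longrightarrow> \<not> eq q \<tau> (ck x)"
  shows False
  using boundsD[OF assms(1,3) _ _ assms(7), of "e j"] assms le_trans[of _ q p] by force

lemma absolute_FAll_FNeg:
  assumes "absolute \<phi>" "bounds i j \<phi>" "i \<noteq> j" shows "absolute (FAll i (FNeg \<phi>))"
proof (rule absolute_FAll)
  show "absolute (FNeg \<phi>)" using assms by blast
  fix e p \<tau> assume p: "p \<in> elts P" "nm \<tau>" "\<And>q x. q \<in> elts P \<Longrightarrow> le q p \<Longrightarrow> \<not> eq q \<tau> (ck x)"
  show "frc p (FNeg \<phi>) ((ck \<circ> e)(i := \<tau>))"
    using bounds_check_envD[OF assms(2,3) _ _ p(1,2) _ p(3), of _ e] unfolding forces.simps by blast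
qed

lemma absolute_FEx: "absolute \<phi> \<Longrightarrow> bounds i j \<phi> \<Longrightarrow> i \<noteq> j \<Longrightarrow> absolute (FEx i \<phi>)"
  unfolding FEx_def by (intro absolute_FNeg absolute_FAll_FNeg)

lemma absolute_FAll_FImp:
  assumes "absolute \<phi>" "absolute \<psi>" "bounds i j \<phi>" "i \<noteq> j" shows "absolute (FAll i (FImp \<phi> \<psi>))"
proof (rule absolute_FAll)
  show "absolute (FImp \<phi> \<psi>)" using assms by blast
  fix e p \<tau> assume p: "p \<in> elts P" "nm \<tau>" "\<And>q x. q \<in> elts P \<Longrightarrow> le q p \<Longrightarrow> \<not> eq q \<tau> (ck x)"
  have nm: "nm (((ck \<circ> e)(i := \<tau>)) k)" for k using p by simp
  show "frc p (FImp \<phi> \<psi>) ((ck \<circ> e)(i := \<tau>))"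
    using bounds_check_envD[OF assms(3,4) _ _ p(1,2) _ p(3), of _ e] unfolding frc_FImp[OF p(1) nm] by blast
qed

text \<open>A name that no extension turns into a ground model set is forced to satisfy neither
  side, hence to satisfy the equivalence.\<close>

lemma absolute_FAll_FIff:
  assumes "absolute \<phi>" "absolute \<psi>" "bounds i j \<phi>" "i \<noteq> j" "bounds i k \<psi>" "i \<noteq> k" shows "absolute (FAll i (FIff \<phi> \<psi>))"
proof (rule absolute_FAll)
  show "absolute (FIff \<phi> \<psi>)" using assms by blast
  fix e p \<tau> assume p: "p \<in> elts P" "nm \<tau>" "\<And>q x. q \<in> elts P \<Longrightarrow> le q p \<Longrightarrow> \<not> eq q \<tau> (ck x)"
  have nm: "nm (((ck \<circ> e)(i := \<tau>)) k)" for k using p by simp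
  show "frc p (FIff \<phi> \<psi>) ((ck \<circ> e)(i := \<tau>))"
    using bounds_check_envD[OF assms(3,4) _ _ p(1,2) _ p(3), of _ e] bounds_check_envD[OF assms(5,6) _ _ p(1,2) _ p(3), of _ e]
    unfolding frc_FIff[OF p(1) nm] by blast
qed

lemma bounds_FMem: "bounds i j (FMem i j)"
  unfolding bounds_def
proof (intro allI ballI impI)
  fix e p assume p: "p \<in> elts P" "\<exists>x. e j = ck x" "frc p (FMem i j) e"
  then obtain x where "mem p (e i) (ck x)" by auto
  then show "\<exists>q\<in>elts P. le q p \<and> (\<exists>x. eq q (e i) (ck x))" using p(1) by (rule mem_checkE) blast
qed

lemma bounds_FEq: "bounds i j (FEq i j)"
  unfolding bounds_def forces.simps using le_refl by metis

lemma bounds_FAnd1: "bounds i j \<phi> \<Longrightarrow> bounds i j (FAnd \<phi> \<psi>)"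
  and bounds_FAnd2: "bounds i j \<psi> \<Longrightarrow> bounds i j (FAnd \<phi> \<psi>)"
  unfolding bounds_def forces.simps by blast+

lemma bounds_FOr:
  assumes "bounds i j \<phi>" "bounds i j \<psi>" shows "bounds i j (FOr \<phi> \<psi>)"
  unfolding bounds_def
proof (intro allI ballI impI)
  fix e p assume p: "p \<in> elts P" "\<forall>k. nm (e k)" "\<exists>x. e j = ck x" "frc p (FOr \<phi> \<psi>) e"
  then obtain r where r: "r \<in> elts P" "le r p" "frc r \<phi> e \<or> frc r \<psi> e" unfolding frc_FOr using le_refl by blast
  then obtain q where "q \<in> elts P" "le q r" "\<exists>x. eq q (e i) (ck x)" using assms p unfolding bounds_def by metis
  then show "\<exists>q\<in>elts P. le q p \<and> (\<exists>x. eq q (e i) (ck x))" using le_trans[of q r p] r p by blast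
qed

lemma bounds_FEx:
  assumes b: "bounds i j \<phi>" and k: "k \<noteq> i" "k \<noteq> j" shows "bounds i j (FEx k \<phi>)"
  unfolding bounds_def
proof (intro allI ballI impI)
  fix e p assume p: "p \<in> elts P" "\<forall>k. nm (e k)" "\<exists>x. e j = ck x" "frc p (FEx k \<phi>) e"
  then obtain r \<tau> where r: "r \<in> elts P" "le r p" "nm \<tau>" "frc r \<phi> (e(k := \<tau>))" by (auto elim: frc_FExE)
  obtain x where "(e(k := \<tau>)) j = ck x" using p k by auto
  moreover have "nm ((e(k := \<tau>)) l)" for l using p(2) r(3) by simp
  ultimately obtain q where "q \<in> elts P" "le q r" "\<exists>x. eq q ((e(k := \<tau>)) i) (ck x)"
    using boundsD[OF b r(1) _ _ r(4)] by blast
  then show "\<exists>q\<in>elts P. le q p \<and> (\<exists>x. eq q (e i) (ck x))" using le_trans[of q r p] r p k by auto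
qed

text \<open>Once an extension decides \<open>e k\<close> as a check name, that check name can
  replace it in the environment, and the second bound becomes applicable.\<close>

lemma bounds_trans:
  assumes b: "bounds k j \<phi>" "bounds i k \<psi>" and k: "k \<noteq> i" shows "bounds i j (FAnd \<phi> \<psi>)"
  unfolding bounds_def
proof (intro allI ballI impI)
  fix e p assume p: "p \<in> elts P" "\<forall>k. nm (e k)" "\<exists>x. e j = ck x" "frc p (FAnd \<phi> \<psi>) e"
  then obtain x0 where "e j = ck x0" by blast
  then obtain r x where r: "r \<in> elts P" "le r p" "eq r (e k) (ck x)"
    using boundsD[of k j \<phi> p e x0, OF b(1) p(1)] p(2,4) unfolding forces.simps by blast
  have "frc r \<psi> e" using p r frc_down[of p \<psi> e r] by simp
  then have "frc r \<psi> (e(k := ck x))"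
    using frc_cong[of e "e(k := ck x)" r \<psi>] r p eq_refl by auto
  moreover have "nm ((e(k := ck x)) l)" for l using p(2) by simp
  ultimately obtain q where "q \<in> elts P" "le q r" "\<exists>x. eq q (e i) (ck x)"
    using boundsD[OF b(2) r(1), of "e(k := ck x)" x] k by auto
  then show "\<exists>q\<in>elts P. le q p \<and> (\<exists>x. eq q (e i) (ck x))" using le_trans[of q r p] r p k by auto
qed

lemma bounds_trans': "bounds k j \<phi> \<Longrightarrow> bounds i k \<psi> \<Longrightarrow> k \<noteq> i \<Longrightarrow> bounds i j (FAnd \<psi> \<phi>)"
  using bounds_trans[of k j \<phi> i \<psi>] by (simp add: bounds_def conj_commute)

lemma absolute_FBall [intro!]: "absolute \<phi> \<Longrightarrow> i \<noteq> j \<Longrightarrow> absolute (FBall i j \<phi>)"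
  unfolding FBall_def by (rule absolute_FAll_FImp[OF _ _ bounds_FMem]) auto

lemma absolute_FBex [intro!]: "absolute \<phi> \<Longrightarrow> i \<noteq> j \<Longrightarrow> absolute (FBex i j \<phi>)"
  unfolding FBex_def by (rule absolute_FEx[OF _ bounds_FAnd1[OF bounds_FMem]]) auto

lemma absolute_fm_subset [intro!]: "absolute (fm_subset x y)"
  unfolding fm_subset_def Let_def by auto

lemma absolute_fm_transitive [intro!]: "absolute (fm_transitive x)"
  unfolding fm_transitive_def Let_def by auto

lemma absolute_fm_ordinal [intro!]: "absolute (fm_ordinal x)"
  unfolding fm_ordinal_def Let_def by auto

lemma absolute_fm_empty [intro!]: "absolute (fm_empty x)"
  unfolding fm_empty_def Let_def by (rule absolute_FAll_FNeg[OF _ bounds_FMem]) auto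

lemma absolute_fm_succ [intro!]: "absolute (fm_succ x y)"
  unfolding fm_succ_def Let_def
  by (rule absolute_FAll_FIff[OF _ _ bounds_FMem _ bounds_FOr[OF bounds_FMem bounds_FEq]]) auto

lemma absolute_fm_omega [intro!]: "absolute (fm_omega x)"
  unfolding fm_omega_def Let_def by auto

text \<open>The disjunction on the right confines the variable by two different parameters, so
  \<open>absolute_FAll_FIff\<close>, with a single bounding variable on each side, does not cover
  it.\<close>

lemma absolute_fm_upair [intro!]: "absolute (fm_upair z x y)"
  unfolding fm_upair_def Let_def
proof (rule absolute_FAll)
  let ?w = "x + y + z + 1"
  show "absolute (FIff (FMem ?w z) (FOr (FEq ?w x) (FEq ?w y)))" by auto
  fix e p \<tau> assume p: "p \<in> elts P" "nm \<tau>" and n: "\<And>q x. q \<in> elts P \<Longrightarrow> le q p \<Longrightarrow> \<not> eq q \<tau> (ck x)"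
  have "\<not> frc q (FMem ?w z) ((ck \<circ> e)(?w := \<tau>))" if "q \<in> elts P" "le q p" for q
  proof
    assume "frc q (FMem ?w z) ((ck \<circ> e)(?w := \<tau>))"
    then show False by (rule bounds_check_envD[OF bounds_FMem _ that p _ n, rotated]) auto
  qed
  moreover have "\<not> frc q (FOr (FEq ?w x) (FEq ?w y)) ((ck \<circ> e)(?w := \<tau>))" if q: "q \<in> elts P" "le q p" for q
  proof
    assume "frc q (FOr (FEq ?w x) (FEq ?w y)) ((ck \<circ> e)(?w := \<tau>))"
    then obtain r where "r \<in> elts P" "le r q"
      "frc r (FEq ?w x) ((ck \<circ> e)(?w := \<tau>)) \<or> frc r (FEq ?w y) ((ck \<circ> e)(?w := \<tau>))"
      unfolding frc_FOr using q le_refl by blast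
    then have r: "r \<in> elts P" "le r q" "eq r \<tau> (ck (e x)) \<or> eq r \<tau> (ck (e y))" by simp_all
    then show False using n le_trans[of r q p] q p by blast
  qed
  ultimately show "frc p (FIff (FMem ?w z) (FOr (FEq ?w x) (FEq ?w y))) ((ck \<circ> e)(?w := \<tau>))"
    by (subst frc_FIff) (use p in auto)
qed

lemma frc_fm_upair_mem:
  assumes "frc p (fm_upair z x y) e" "p \<in> elts P" "\<And>k. nm (e k)"
  shows "mem p (e x) (e z) \<and> mem p (e y) (e z)"
proof -
  let ?w = "x + y + z + 1"
  have *: "mem p \<tau> (e z)" if "nm \<tau>" "eq p \<tau> (e x) \<or> eq p \<tau> (e y)" for \<tau>
  proof -
    have "frc p (FIff (FMem ?w z) (FOr (FEq ?w x) (FEq ?w y))) (e(?w := \<tau>))"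
      using assms(1) that by (simp add: fm_upair_def Let_def)
    then have "frc p (FMem ?w z) (e(?w := \<tau>)) \<longleftrightarrow> frc p (FOr (FEq ?w x) (FEq ?w y)) (e(?w := \<tau>))"
      by (subst (asm) frc_FIff) (use assms that le_refl in auto)
    moreover have "frc p (FOr (FEq ?w x) (FEq ?w y)) (e(?w := \<tau>))"
      unfolding frc_FOr
    proof (intro ballI impI)
      fix q assume q: "q \<in> elts P" "le q p"
      then have "eq q \<tau> (e x) \<or> eq q \<tau> (e y)" using that(2) eq_down[OF _ assms(2)] by blast
      then have "frc q (FEq ?w x) (e(?w := \<tau>)) \<or> frc q (FEq ?w y) (e(?w := \<tau>))" by simp
      then show "\<exists>r\<in>elts P. le r q \<and> (frc r (FEq ?w x) (e(?w := \<tau>)) \<or> frc r (FEq ?w y) (e(?w := \<tau>)))"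
        using q(1) le_refl by blast
    qed
    ultimately show ?thesis by simp
  qed
  show ?thesis using *[of "e x"] *[of "e y"] assms(3) eq_refl by blast
qed

lemma bounds_fm_upair: "bounds x z (fm_upair z x y)" "bounds y z (fm_upair z x y)"
  unfolding bounds_def using frc_fm_upair_mem mem_checkE by metis+

text \<open>The unordered pair of \<open>x\<close> and \<open>y\<close>, variable
  \<open>x + y + z + 2\<close>, contains both components and is a member of \<open>z\<close>; two
  membership steps therefore bound either component.\<close>

lemma bounds_fm_pair: "bounds x z (fm_pair z x y)" "bounds y z (fm_pair z x y)"
  unfolding fm_pair_def Let_def
  by (intro bounds_FEx bounds_FAnd2 bounds_trans'[where k = "x + y + z + 2"] bounds_fm_upair; simp)+

lemma absolute_fm_pair [intro!]: "absolute (fm_pair z x y)"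
  unfolding fm_pair_def Let_def
  by (rule absolute_FEx[where j = z] bounds_FEx bounds_FAnd2 bounds_fm_upair absolute_FAnd absolute_fm_upair | simp)+

lemma bounds_fm_rel: "bounds x r (fm_rel r x y)" "bounds y r (fm_rel r x y)"
  unfolding fm_rel_def Let_def FBex_def
  by (intro bounds_FEx bounds_trans[OF bounds_FMem] bounds_fm_pair; simp)+

lemma absolute_fm_rel [intro!]: "absolute (fm_rel r x y)"
  unfolding fm_rel_def Let_def by auto

lemma absolute_fm_function [intro!]: "absolute (fm_function f x y)"
  unfolding fm_function_def Let_def by auto

text \<open>The common value \<open>c\<close> is quantified without a bound, but as a component of a
  pair in \<open>f\<close> it is bounded by \<open>f\<close>.\<close>

lemma absolute_fm_injective_on [intro!]: "absolute (fm_injective_on f x)"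
  unfolding fm_injective_on_def Let_def
  by (intro absolute_FBall absolute_FAll_FImp[where j = f] bounds_FAnd1 bounds_fm_rel) auto

section \<open>Upward absoluteness of existential statements\<close>

lemma upward_absolute_absolute: "absolute \<phi> \<Longrightarrow> upward_absolute \<phi>"
  by (simp add: absolute_def upward_absolute_def)

lemma upward_absolute_FAnd: "upward_absolute \<phi> \<Longrightarrow> upward_absolute \<psi> \<Longrightarrow> upward_absolute (FAnd \<phi> \<psi>)"
  by (simp add: upward_absolute_def)

lemma upward_absolute_FEx: "upward_absolute \<phi> \<Longrightarrow> upward_absolute (FEx i \<phi>)"
  unfolding upward_absolute_def using frc_FExI[OF _ nm_check] by (fastforce simp: comp_check_upd)

lemma upward_absolute_FBex: "upward_absolute \<phi> \<Longrightarrow> upward_absolute (FBex i j \<phi>)"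
  unfolding FBex_def by (intro upward_absolute_FEx upward_absolute_FAnd upward_absolute_absolute[OF absolute_FMem])

text \<open>A member of a check name is densely equal to the check name of a ground model element,
  so those are the only instances to test.\<close>

lemma frc_FBall_checkI:
  assumes p: "p \<in> elts P" and e: "\<And>k. nm (e k)" "e j = ck X" and ij: "i \<noteq> j"
    and a: "\<And>x q. x \<in> elts X \<Longrightarrow> q \<in> elts P \<Longrightarrow> le q p \<Longrightarrow> frc q \<phi> (e(i := ck x))"
  shows "frc p (FBall i j \<phi>) e"
  unfolding frc_FBall[OF p e(1) ij]
proof (intro allI impI ballI)
  fix \<tau> q assume \<tau>: "nm \<tau>" and q: "q \<in> elts P" "le q p" "mem q \<tau> (e j)"
  show "frc q \<phi> (e(i := \<tau>))"
  proof (rule frc_dense[OF q(1)])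
    show "nm ((e(i := \<tau>)) k)" for k using e \<tau> by simp
    fix q' assume q': "q' \<in> elts P" "le q' q"
    then obtain r x where r: "r \<in> elts P" "le r q'" "x \<in> elts X" "eq r \<tau> (ck x)"
      using q(3) unfolding e(2) mem_check_iff by blast
    have "le r p" using le_trans[of r q' q] le_trans[of r q p] r q q' p by blast
    then have "frc r \<phi> (e(i := ck x))" using a r by blast
    then have "frc r \<phi> (e(i := \<tau>))"
      using frc_cong[of "e(i := ck x)" "e(i := \<tau>)" r \<phi>] e(1) \<tau> r eq_sym[OF r(4)] eq_refl by auto
    then show "\<exists>r\<in>elts P. le r q' \<and> frc r \<phi> (e(i := \<tau>))" using r by blast
  qed
qed

lemma upward_absolute_FBall: "upward_absolute \<phi> \<Longrightarrow> i \<noteq> j \<Longrightarrow> upward_absolute (FBall i j \<phi>)"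
  unfolding upward_absolute_def
  by (intro allI ballI impI frc_FBall_checkI) (auto simp: comp_check_upd [symmetric])

lemma upward_absolute_fm_countable: "upward_absolute (fm_countable x)"
  unfolding fm_countable_def Let_def
  by (intro upward_absolute_FEx upward_absolute_absolute) auto

text \<open>An order isomorphism of the ground model remains one. Heights thus persist, and what
  remains to be shown for the tree height is that its value is still the first uncountable
  ordinal.\<close>

lemma upward_absolute_fm_node_height: "upward_absolute (fm_node_height t r s a)"
  unfolding fm_node_height_def Let_def
  by (intro upward_absolute_FAnd upward_absolute_FEx upward_absolute_absolute absolute_FAnd
    absolute_FAll_FIff[OF _ _ bounds_FMem _ bounds_FAnd1[OF bounds_FMem]]) auto

lemma upward_absolute_fm_tree_height: "upward_absolute (fm_tree_height t r h)"
  unfolding fm_tree_height_def Let_def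
  by (intro upward_absolute_FAnd upward_absolute_FBall upward_absolute_FBex upward_absolute_fm_node_height) auto

end

section \<open>Free variables of the basic formulas\<close>

lemma fv_fm_pair [simp]: "fv (fm_pair z x y) = {z, x, y}"
  by (auto simp: fm_pair_def fm_upair_def Let_def)

lemma fv_fm_rel [simp]: "fv (fm_rel r x y) = {r, x, y}"
  by (auto simp: fm_rel_def Let_def)

lemma fv_fm_ordinal [simp]: "fv (fm_ordinal x) = {x}"
  by (auto simp: fm_ordinal_def fm_transitive_def fm_subset_def Let_def)

lemma fv_fm_empty [simp]: "fv (fm_empty x) = {x}"
  by (auto simp: fm_empty_def Let_def)

lemma fv_fm_succ [simp]: "fv (fm_succ x y) = {x, y}"
  by (auto simp: fm_succ_def Let_def)

lemma fv_fm_omega [simp]: "fv (fm_omega w) = {w}"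
  by (auto simp: fm_omega_def Let_def)

lemma fv_fm_countable [simp]: "fv (fm_countable x) = {x}"
  by (auto simp: fm_countable_def fm_function_def fm_injective_on_def Let_def)

context forcing_preorder
begin

lemma absolute_frcI: "absolute \<phi> \<Longrightarrow> p \<in> elts P \<Longrightarrow> sat UNIV \<phi> e \<Longrightarrow> frc p \<phi> (ck \<circ> e)"
  by (simp add: absolute_def)

lemma frc_FOrI1: "p \<in> elts P \<Longrightarrow> frc p \<phi> e \<Longrightarrow> frc p (FOr \<phi> \<psi>) e"
  and frc_FOrI2: "p \<in> elts P \<Longrightarrow> frc p \<psi> e \<Longrightarrow> frc p (FOr \<phi> \<psi>) e"
  unfolding frc_FOr using frc_down le_refl by metis+

lemma mem_eq_cong: "mem p \<sigma> \<xi> \<Longrightarrow> eq p \<sigma> \<tau> \<Longrightarrow> p \<in> elts P \<Longrightarrow> nm \<sigma> \<Longrightarrow> nm \<tau> \<Longrightarrow> nm \<xi> \<Longrightarrow> mem p \<tau> \<xi>"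
  using mem_cong eq_refl by blast

lemma frc_fm_rel_iff:
  assumes "\<And>i. nm (e i)" "p \<in> elts P" "eq p (e r) (ck R)" "eq p (e x) (ck a)" "eq p (e y) (ck b)" "distinct [r, x, y]"
  shows "frc p (fm_rel r x y) e \<longleftrightarrow> vpair a b \<in> elts R"
proof -
  \<comment> \<open>The default value \<open>b\<close> of the environment serves the variable
    \<open>y\<close>.\<close>
  have "frc p (fm_rel r x y) e \<longleftrightarrow> sat UNIV (fm_rel r x y) ((\<lambda>_. b)(r := R, x := a))"
    by (rule absolute_cong[OF absolute_fm_rel assms(1,2)]) (use assms(3-6) in auto)
  then show ?thesis using assms(6) by simp
qed

lemma frc_fm_pair_iff:
  assumes "\<And>i. nm (e i)" "p \<in> elts P" "eq p (e z) (ck u)" "eq p (e x) (ck a)" "eq p (e y) (ck b)" "distinct [z, x, y]"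
  shows "frc p (fm_pair z x y) e \<longleftrightarrow> u = vpair a b"
proof -
  have "frc p (fm_pair z x y) e \<longleftrightarrow> sat UNIV (fm_pair z x y) ((\<lambda>_. b)(z := u, x := a))"
    by (rule absolute_cong[OF absolute_fm_pair assms(1,2)]) (use assms(3-6) in auto)
  then show ?thesis using assms(6) by simp
qed

text \<open>Here \<open>e x\<close> and \<open>e y\<close> are arbitrary names. The pair bounds them
  by a ground model set, so an extension decides both, and absoluteness identifies the decided
  values.\<close>

lemma frc_fm_pair_checkD:
  assumes e: "\<And>i. nm (e i)" and p: "p \<in> elts P" and z: "eq p (e z) (ck (vpair a b))"
    and d: "distinct [z, x, y]" and f: "frc p (fm_pair z x y) e"
  obtains r where "r \<in> elts P" "le r p" "eq r (e x) (ck a)" "eq r (e y) (ck b)"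
proof -
  let ?e = "e(z := ck (vpair a b))"
  have e': "nm (?e i)" for i using e by simp
  have f': "frc p (fm_pair z x y) ?e"
    by (rule frc_cong[where e = e and e' = ?e, OF e e' p _ f]) (use z e eq_refl in auto)
  have ez: "?e z = ck (vpair a b)" by simp
  obtain q c where q: "q \<in> elts P" "le q p" "eq q (?e x) (ck c)"
    using boundsD[where e = ?e, OF bounds_fm_pair(1) p e' ez f'] by blast
  have f'': "frc q (fm_pair z x y) ?e" using frc_down f' p q by blast
  obtain r d where r: "r \<in> elts P" "le r q" "eq r (?e y) (ck d)"
    using boundsD[where e = ?e, OF bounds_fm_pair(2) q(1) e' ez f''] by blast
  have x: "eq r (?e x) (ck c)" using eq_down q r by blast
  have "frc r (fm_pair z x y) ?e" using frc_down f'' q r by blast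
  then have "vpair a b = vpair c d"
    using frc_fm_pair_iff[where e = ?e, OF e' r(1) _ x r(3) d, of "vpair a b"] eq_refl by simp
  then show ?thesis using that[of r] r x d le_trans[of r q p] q p by auto
qed

text \<open>The order axioms have bounded quantifiers. The well-ordering of predecessors quantifies
  over new sets and is reduced to a ground model set of possible members.\<close>

lemma frc_fm_tree:
  assumes s: "sat UNIV (fm_tree t r) e" and p: "p \<in> elts P"
  shows "frc p (fm_tree t r) (ck \<circ> e)"
proof -
  note s1 = s[unfolded fm_tree_def Let_def sat.simps]
  note wf = s[unfolded sat_fm_tree, THEN conjunct2, THEN conjunct2]
  let ?x = "t + r + 1" and ?y = "t + r + 2" and ?z = "t + r + 3" and ?X = "t + r + 4"
  have "frc p (FBall ?x t (FAll ?X
            (FImp (FAnd (FEx ?y (FMem ?y ?X)) (FBall ?y ?X (FAnd (FMem ?y t) (fm_rel r ?y ?x))))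
                  (FBex ?y ?X (FBall ?z ?X (FOr (FEq ?z ?y) (fm_rel r ?y ?z))))))) (ck \<circ> e)"
  proof (rule frc_FBall_checkI[OF p])
    show "nm ((ck \<circ> e) k)" for k by simp
    show "(ck \<circ> e) t = ck (e t)" by simp
    show "?x \<noteq> t" by simp
    fix a p assume a: "a \<in> elts (e t)" and p: "p \<in> elts P"
    show "frc p (FAll ?X
            (FImp (FAnd (FEx ?y (FMem ?y ?X)) (FBall ?y ?X (FAnd (FMem ?y t) (fm_rel r ?y ?x))))
                  (FBex ?y ?X (FBall ?z ?X (FOr (FEq ?z ?y) (fm_rel r ?y ?z)))))) ((ck \<circ> e)(?x := ck a))"
      unfolding forces.simps(5)
    proof (intro allI impI)
      fix \<xi> assume \<xi>: "nm \<xi>"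
      define E where "E = (ck \<circ> e)(?x := ck a, ?X := \<xi>)"
      have E: "nm (E k)" for k using \<xi> by (simp add: E_def)
      have Ev: "E t = ck (e t)" "E r = ck (e r)" "E ?x = ck a" "E ?X = \<xi>" by (simp_all add: E_def)
      show "frc p (FImp (FAnd (FEx ?y (FMem ?y ?X)) (FBall ?y ?X (FAnd (FMem ?y t) (fm_rel r ?y ?x))))
                  (FBex ?y ?X (FBall ?z ?X (FOr (FEq ?z ?y) (fm_rel r ?y ?z))))) ((ck \<circ> e)(?x := ck a, ?X := \<xi>))"
        unfolding E_def[symmetric] frc_FImp[OF p E]
      proof (intro ballI impI)
        fix q assume q: "q \<in> elts P" "le q p"
          and h: "frc q (FAnd (FEx ?y (FMem ?y ?X)) (FBall ?y ?X (FAnd (FMem ?y t) (fm_rel r ?y ?x)))) E"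
        show "frc q (FBex ?y ?X (FBall ?z ?X (FOr (FEq ?z ?y) (fm_rel r ?y ?z)))) E"
        proof (rule frc_dense[OF q(1) E])
          fix q' assume q': "q' \<in> elts P" "le q' q"
          have h1: "frc q' (FEx ?y (FMem ?y ?X)) E"
            and h2: "frc q' (FBall ?y ?X (FAnd (FMem ?y t) (fm_rel r ?y ?x))) E"
            using frc_down[OF h q(1) q'] by simp_all
          have yX: "?y \<noteq> ?X" and zX: "?z \<noteq> ?X" by simp_all
          have key: "\<exists>s'\<in>elts P. le s' s \<and> (\<exists>b\<in>elts (e t). eq s' \<sigma> (ck b) \<and> mem s' (ck b) \<xi> \<and> vpair b a \<in> elts (e r))"
            if s: "s \<in> elts P" "le s q'" "nm \<sigma>" "mem s \<sigma> \<xi>" for s \<sigma>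
          proof -
            have "frc s (FAnd (FMem ?y t) (fm_rel r ?y ?x)) (E(?y := \<sigma>))"
              by (rule h2[unfolded frc_FBall[OF q'(1) E yX] Ev(4), rule_format, OF s(3,1,2,4)])
            then have m: "mem s \<sigma> (ck (e t))" and f: "frc s (fm_rel r ?y ?x) (E(?y := \<sigma>))"
              using Ev by simp_all
            obtain s' b where s': "s' \<in> elts P" "le s' s" "b \<in> elts (e t)" "eq s' \<sigma> (ck b)"
              using m s(1) by (rule mem_checkE)
            have "frc s' (fm_rel r ?y ?x) (E(?y := \<sigma>)) \<longleftrightarrow> vpair b a \<in> elts (e r)"
              by (rule frc_fm_rel_iff) (use s'(1,4) E s(3) Ev eq_refl in auto)
            then have "vpair b a \<in> elts (e r)" using frc_down[OF f s(1) s'(1,2)] by blast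
            moreover have "mem s' (ck b) \<xi>"
              using mem_eq_cong[OF mem_down[OF s(4,1) s'(1,2)] s'(4,1) s(3) nm_check \<xi>] .
            ultimately show ?thesis using s' by blast
          qed
          \<comment> \<open>The predecessors of \<open>a\<close> that can still enter
            \<open>\<xi>\<close> below \<open>q'\<close>. In the ground model \<open>D\<close> has a
            least element \<open>b\<close>; a condition that forces \<open>b\<close> into
            \<open>\<xi>\<close> forces it to be least there, because every member of
            \<open>\<xi>\<close> is densely equal to one of \<open>D\<close>.\<close>
          define D where "D = {b \<in> elts (e t). vpair b a \<in> elts (e r) \<and> (\<exists>s\<in>elts P. le s q' \<and> mem s (ck b) \<xi>)}"
          have keyD: "\<exists>s'\<in>elts P. le s' s \<and> (\<exists>b\<in>D. eq s' \<sigma> (ck b) \<and> mem s' (ck b) \<xi>)"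
            if s: "s \<in> elts P" "le s q'" "nm \<sigma>" "mem s \<sigma> \<xi>" for s \<sigma>
          proof -
            obtain s' b where s': "s' \<in> elts P" "le s' s" "b \<in> elts (e t)" "eq s' \<sigma> (ck b)" "mem s' (ck b) \<xi>"
              "vpair b a \<in> elts (e r)" using key[OF s] by blast
            moreover have "le s' q'" using le_trans[OF s'(1) s(1) q'(1) s'(2) s(2)] .
            ultimately show ?thesis unfolding D_def by blast
          qed
          have "small D" by (rule small_subset[OF small_elts[of "e t"]]) (auto simp: D_def)
          then have eD: "elts (vset D) = D" by (rule elts_vset)
          obtain r0 \<tau> where r0: "r0 \<in> elts P" "le r0 q'" "nm \<tau>" "mem r0 \<tau> \<xi>"
            using h1 q'(1) by (rule frc_FExE) (use Ev in auto)
          then have "\<exists>b. b \<in> D" using keyD by blast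
          then have "(\<exists>y. y \<in> D) \<and> (\<forall>y\<in>D. y \<in> elts (e t) \<and> vpair y a \<in> elts (e r))"
            unfolding D_def by blast
          then obtain b where b: "b \<in> D" "\<And>c. c \<in> D \<Longrightarrow> c = b \<or> vpair b c \<in> elts (e r)"
            using wf[THEN bspec, OF a, THEN spec, of "vset D", unfolded eD, THEN mp] by blast
          obtain s where s: "s \<in> elts P" "le s q'" "mem s (ck b) \<xi>" using b(1) by (auto simp: D_def)
          define E' where "E' = E(?y := ck b)"
          have E': "nm (E' k)" for k using E by (simp add: E'_def)
          have Ev': "E' ?X = \<xi>" "E' r = ck (e r)" "E' ?y = ck b" using Ev by (simp_all add: E'_def)
          have "frc s (FBall ?z ?X (FOr (FEq ?z ?y) (fm_rel r ?y ?z))) E'"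
            unfolding frc_FBall[OF s(1) E' zX]
          proof (intro allI impI ballI)
            fix \<sigma> u assume u: "nm \<sigma>" "u \<in> elts P" "le u s" "mem u \<sigma> (E' ?X)"
            show "frc u (FOr (FEq ?z ?y) (fm_rel r ?y ?z)) (E'(?z := \<sigma>))"
            proof (rule frc_dense[OF u(2)])
              show nE: "nm ((E'(?z := \<sigma>)) k)" for k using E' u by simp
              fix v assume v: "v \<in> elts P" "le v u"
              have vq: "le v q'" using le_trans[of v u s] le_trans[of v s q'] u s v q' by blast
              have "mem v \<sigma> \<xi>" using mem_down[OF _ u(2) v] u(4) Ev' by simp
              then obtain v' c where v': "v' \<in> elts P" "le v' v" "c \<in> D" "eq v' \<sigma> (ck c)"
                using keyD[OF v(1) vq u(1)] by blast
              have "frc v' (FOr (FEq ?z ?y) (fm_rel r ?y ?z)) (E'(?z := \<sigma>))"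
                using b(2)[OF v'(3)]
              proof
                assume "c = b"
                then show ?thesis using v' Ev' by (intro frc_FOrI1) simp_all
              next
                assume bc: "vpair b c \<in> elts (e r)"
                have "frc v' (fm_rel r ?y ?z) (E'(?z := \<sigma>)) \<longleftrightarrow> vpair b c \<in> elts (e r)"
                  by (rule frc_fm_rel_iff[OF nE v'(1)]) (use v' Ev' eq_refl in auto)
                then show ?thesis using bc v'(1) by (intro frc_FOrI2) simp_all
              qed
              then show "\<exists>r'\<in>elts P. le r' v \<and> frc r' (FOr (FEq ?z ?y) (fm_rel r ?y ?z)) (E'(?z := \<sigma>))"
                using v' by blast
            qed
          qed
          then have "frc s (FBex ?y ?X (FBall ?z ?X (FOr (FEq ?z ?y) (fm_rel r ?y ?z)))) E"
            by (intro frc_FBexI[where \<tau> = "ck b"]) (use s Ev in \<open>auto simp: E'_def\<close>)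
          then show "\<exists>r'\<in>elts P. le r' q' \<and> frc r' (FBex ?y ?X (FBall ?z ?X (FOr (FEq ?z ?y) (fm_rel r ?y ?z)))) E"
            using s by blast
        qed
      qed
    qed
  qed
  moreover have "frc p (FBall ?x t (FNeg (fm_rel r ?x ?x))) (ck \<circ> e)"
    by (rule absolute_frcI[OF _ p conjunct1[OF s1]]) auto
  moreover have "frc p (FBall ?x t (FBall ?y t (FBall ?z t
            (FImp (FAnd (fm_rel r ?x ?y) (fm_rel r ?y ?z)) (fm_rel r ?x ?z))))) (ck \<circ> e)"
    by (rule absolute_frcI[OF _ p conjunct1[OF conjunct2[OF s1]]]) auto
  ultimately show ?thesis unfolding fm_tree_def Let_def forces.simps(4) by blast
qed

end

section \<open>Countable subsets of ground model sets\<close>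

context forcing_preorder
begin

text \<open>A forced subset \<open>\<xi>\<close> of a countable ground model set is forced to be countable by a function whose
  domain is exactly \<open>\<xi>\<close>, so a check name does not do.\<close>

definition restriction_name :: "'v \<Rightarrow> 'v \<Rightarrow> 'v" where
  "restriction_name f \<xi> = vset {u \<in> elts (ck f). \<exists>a b s. u = vpair (ck (vpair a b)) s \<and> mem s (ck a) \<xi>}"

lemma elts_restriction_name:
  "elts (restriction_name f \<xi>) = {u \<in> elts (ck f). \<exists>a b s. u = vpair (ck (vpair a b)) s \<and> mem s (ck a) \<xi>}"
  unfolding restriction_name_def by (rule elts_vset) (rule small_subset[OF small_elts[of "ck f"]], blast)

lemma nm_restriction_name: "nm (restriction_name f \<xi>)"
  by (rule is_name.intros) (auto simp: elts_restriction_name mem_check_elts)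

lemma check_inject: "p \<in> elts P \<Longrightarrow> ck x = ck y \<Longrightarrow> x = y"
  using eq_check_iff[of p x y] eq_refl[of "ck x" p] by simp

lemma vpair_mem_restriction_name:
  "vpair \<sigma> s \<in> elts (restriction_name f \<xi>) \<longleftrightarrow> s \<in> elts P \<and> (\<exists>a b. vpair a b \<in> elts f \<and> \<sigma> = ck (vpair a b) \<and> mem s (ck a) \<xi>)"
proof
  assume "vpair \<sigma> s \<in> elts (restriction_name f \<xi>)"
  then obtain a b y where *: "s \<in> elts P" "y \<in> elts f" "\<sigma> = ck y" "\<sigma> = ck (vpair a b)" "mem s (ck a) \<xi>"
    unfolding elts_restriction_name by (auto simp: vpair_mem_check)
  then have "y = vpair a b" using check_inject[OF *(1)] by metis
  then show "s \<in> elts P \<and> (\<exists>a b. vpair a b \<in> elts f \<and> \<sigma> = ck (vpair a b) \<and> mem s (ck a) \<xi>)" using * by blast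
qed (auto simp: elts_restriction_name vpair_mem_check)

lemma mem_restriction_nameE:
  assumes "mem p \<tau> (restriction_name f \<xi>)" "p \<in> elts P"
  obtains r a b where "r \<in> elts P" "le r p" "vpair a b \<in> elts f" "eq r \<tau> (ck (vpair a b))" "mem r (ck a) \<xi>"
proof -
  obtain r \<sigma> s where r: "r \<in> elts P" "le r p" "vpair \<sigma> s \<in> elts (restriction_name f \<xi>)" "le r s" "eq r \<tau> \<sigma>"
    using assms le_refl unfolding mem_iff by blast
  then show ?thesis using that[of r] mem_down[of s _ _ r] unfolding vpair_mem_restriction_name by blast
qed

lemma mem_restriction_nameI:
  assumes "vpair a b \<in> elts f" "mem p (ck a) \<xi>" "p \<in> elts P"
  shows "mem p (ck (vpair a b)) (restriction_name f \<xi>)"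
  by (rule mem_vpairI[OF nm_restriction_name, of "ck (vpair a b)" p])
    (use assms le_refl eq_refl in \<open>auto simp: vpair_mem_restriction_name\<close>)

lemma frc_fm_rel_restriction_nameE:
  assumes e: "\<And>i. nm (e i)" and p: "p \<in> elts P" and ef: "e f = restriction_name g \<xi>"
    and d: "distinct [f, x, y]" and r: "frc p (fm_rel f x y) e"
  obtains q a b where "q \<in> elts P" "le q p" "vpair a b \<in> elts g" "eq q (e x) (ck a)" "eq q (e y) (ck b)"
proof -
  let ?z = "f + x + y + 1"
  have "?z \<noteq> f" by simp
  then obtain q \<zeta> where q: "q \<in> elts P" "le q p" "nm \<zeta>" "mem q \<zeta> (restriction_name g \<xi>)" "frc q (fm_pair ?z x y) (e(?z := \<zeta>))"
    using r p ef unfolding fm_rel_def Let_def by (auto elim!: frc_FBexE)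
  obtain s a b where s: "s \<in> elts P" "le s q" "vpair a b \<in> elts g" "eq s \<zeta> (ck (vpair a b))"
    using q(4,1) by (rule mem_restriction_nameE)
  have E: "nm ((e(?z := \<zeta>)) i)" for i using e q by simp
  have f: "frc s (fm_pair ?z x y) (e(?z := \<zeta>))" using frc_down q s by blast
  obtain t where t: "t \<in> elts P" "le t s" "eq t ((e(?z := \<zeta>)) x) (ck a)" "eq t ((e(?z := \<zeta>)) y) (ck b)"
    by (rule frc_fm_pair_checkD[OF E s(1) _ _ f, of a b]) (use s d in auto)
  have "le t p" using le_trans[of t s q] le_trans[of t q p] t s q p by blast
  then show ?thesis using that[OF t(1) _ s(3)] t by simp
qed

lemma frc_fm_rel_restriction_nameI:
  assumes e: "\<And>i. nm (e i)" and p: "p \<in> elts P" and ef: "e f = restriction_name g \<xi>"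
    and d: "distinct [f, x, y]" and ab: "vpair a b \<in> elts g" "mem p (ck a) \<xi>" "eq p (e x) (ck a)" "eq p (e y) (ck b)"
  shows "frc p (fm_rel f x y) e"
proof -
  let ?z = "f + x + y + 1"
  have E: "nm ((e(?z := ck (vpair a b))) i)" for i using e by simp
  have "frc p (fm_pair ?z x y) (e(?z := ck (vpair a b)))"
    by (subst frc_fm_pair_iff[OF E p]) (use ab d eq_refl in auto)
  then show ?thesis unfolding fm_rel_def Let_def
    by (intro frc_FBexI[where \<tau> = "ck (vpair a b)"]) (use p ef mem_restriction_nameI[OF ab(1,2) p] in auto)
qed

text \<open>Only members of \<open>\<xi>\<close> below \<open>p0\<close> are known to be covered by
  \<open>z\<close>. Through \<open>bound\<close> each of them is densely equal to an argument of
  \<open>g\<close>, which makes the restriction total on \<open>\<xi>\<close>.\<close>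

context
  fixes g z w \<xi> :: 'v and p0 :: 'v
  assumes g: "function_graph g z w" and \<xi>: "nm \<xi>" and p0: "p0 \<in> elts P"
    and bound: "\<And>q \<tau>. q \<in> elts P \<Longrightarrow> le q p0 \<Longrightarrow> nm \<tau> \<Longrightarrow> mem q \<tau> \<xi> \<Longrightarrow> \<exists>r\<in>elts P. le r q \<and> (\<exists>b\<in>elts z. eq r \<tau> (ck b))"
begin

lemma graph_mem: "vpair a b \<in> elts g \<Longrightarrow> a \<in> elts z \<and> b \<in> elts w"
  using g unfolding function_graph_def by fastforce

lemma graph_unique: "vpair a b \<in> elts g \<Longrightarrow> vpair a c \<in> elts g \<Longrightarrow> b = c"
  using g graph_mem unfolding function_graph_def by metis

lemma graph_total: "a \<in> elts z \<Longrightarrow> \<exists>b. vpair a b \<in> elts g"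
  using g unfolding function_graph_def by blast

lemma frc_fm_function_restriction_name:
  assumes e: "\<And>i. nm (e i)" and ef: "e f = restriction_name g \<xi>" and ex: "e x = \<xi>" and ey: "e y = ck w"
    and d: "distinct [f, x, y]"
  shows "frc p0 (fm_function f x y) e"
proof -
  let ?z = "f + x + y + 1" and ?a = "f + x + y + 2" and ?b = "f + x + y + 3" and ?c = "f + x + y + 4"
  have n1: "?z \<noteq> f" and n2: "?a \<noteq> x" and n3: "?b \<noteq> y" and n4: "?c \<noteq> y" by simp_all
  have 1: "frc p0 (FBall ?z f (FBex ?a x (FBex ?b y (fm_pair ?z ?a ?b)))) e"
    unfolding frc_FBall[OF p0 e n1]
  proof (intro allI impI ballI)
    fix \<zeta> q assume q: "nm \<zeta>" "q \<in> elts P" "le q p0" "mem q \<zeta> (e f)"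
    show "frc q (FBex ?a x (FBex ?b y (fm_pair ?z ?a ?b))) (e(?z := \<zeta>))"
    proof (rule frc_dense[OF q(2)])
      show E: "nm ((e(?z := \<zeta>)) i)" for i using e q by simp
      fix q' assume q': "q' \<in> elts P" "le q' q"
      have "mem q' \<zeta> (restriction_name g \<xi>)" using mem_down[OF q(4,2) q'] ef by simp
      then obtain r a b where r: "r \<in> elts P" "le r q'" "vpair a b \<in> elts g" "eq r \<zeta> (ck (vpair a b))" "mem r (ck a) \<xi>"
        using q'(1) by (rule mem_restriction_nameE)
      have "frc r (fm_pair ?z ?a ?b) (e(?z := \<zeta>, ?a := ck a, ?b := ck b))"
        by (subst frc_fm_pair_iff[where u = "vpair a b" and a = a and b = b]) (use e q r eq_refl in auto)
      moreover have "mem r (ck b) (ck w)" using mem_check_check_iff graph_mem r by blast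
      ultimately have "frc r (FBex ?a x (FBex ?b y (fm_pair ?z ?a ?b))) (e(?z := \<zeta>))"
        by (intro frc_FBexI[where \<tau> = "ck a"] frc_FBexI[where \<tau> = "ck b"]) (use r ex ey in auto)
      then show "\<exists>r\<in>elts P. le r q' \<and> frc r (FBex ?a x (FBex ?b y (fm_pair ?z ?a ?b))) (e(?z := \<zeta>))"
        using r by blast
    qed
  qed
  have 2: "frc p0 (FBall ?a x (FBex ?b y (FAnd (fm_rel f ?a ?b) (FBall ?c y (FImp (fm_rel f ?a ?c) (FEq ?c ?b)))))) e"
    (is "frc p0 (FBall ?a x ?\<phi>) e")
    unfolding frc_FBall[OF p0 e n2]
  proof (intro allI impI ballI)
    fix \<alpha> q assume q: "nm \<alpha>" "q \<in> elts P" "le q p0" "mem q \<alpha> (e x)"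
    show "frc q ?\<phi> (e(?a := \<alpha>))"
    proof (rule frc_dense[OF q(2)])
      show E: "nm ((e(?a := \<alpha>)) i)" for i using e q by simp
      fix q' assume q': "q' \<in> elts P" "le q' q"
      have m: "mem q' \<alpha> \<xi>" using mem_down[OF q(4,2) q'] ex by simp
      have "le q' p0" using le_trans[of q' q p0] q q' p0 by blast
      then obtain r a where r: "r \<in> elts P" "le r q'" "a \<in> elts z" "eq r \<alpha> (ck a)"
        using bound[OF q'(1) _ q(1) m] by blast
      \<comment> \<open>\<open>restriction_name\<close> tests membership of check names only, so
        membership is moved from \<open>\<alpha>\<close> to \<open>ck a\<close>.\<close>
      have ma: "mem r (ck a) \<xi>" using mem_eq_cong[OF mem_down[OF m q'(1) r(1,2)] r(4,1) q(1) nm_check \<xi>] .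
      obtain b where b: "vpair a b \<in> elts g" using graph_total r by blast
      define E' where "E' = e(?a := \<alpha>, ?b := ck b)"
      have E': "nm (E' i)" for i using e q by (simp add: E'_def)
      have Ev: "E' f = restriction_name g \<xi>" "E' y = ck w" "E' ?a = \<alpha>" "E' ?b = ck b"
        using ef ey by (simp_all add: E'_def)
      have "frc r (fm_rel f ?a ?b) E'"
        by (rule frc_fm_rel_restriction_nameI[where e = E' and f = f, OF E' r(1) Ev(1) _ b ma]) (use Ev r eq_refl in auto)
      moreover have "frc r (FBall ?c y (FImp (fm_rel f ?a ?c) (FEq ?c ?b))) E'"
      proof (rule frc_FBall_checkI[where e = E' and j = y, OF r(1) E' Ev(2) n4])
        fix c s assume s: "c \<in> elts w" "s \<in> elts P" "le s r"
        let ?E2 = "E'(?c := ck c)"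
        have E'': "nm (?E2 i)" for i using E' by simp
        show "frc s (FImp (fm_rel f ?a ?c) (FEq ?c ?b)) (E'(?c := ck c))"
          unfolding frc_FImp[OF s(2) E'']
        proof (intro ballI impI)
          fix t assume t: "t \<in> elts P" "le t s" "frc t (fm_rel f ?a ?c) (E'(?c := ck c))"
          obtain u a' c' where u: "u \<in> elts P" "le u t" "vpair a' c' \<in> elts g"
            "eq u ((E'(?c := ck c)) ?a) (ck a')" "eq u ((E'(?c := ck c)) ?c) (ck c')"
            by (rule frc_fm_rel_restriction_nameE[where e = ?E2 and f = f, OF E'' t(1) _ _ t(3)]) (use Ev in auto)
          have "le u r" using le_trans[of u t s] le_trans[of u s r] u t s r by blast
          then have "eq u (ck a) (ck a')"
            using eq_trans[of "ck a" \<alpha> "ck a'" u] eq_sym[OF eq_down[OF r(4,1) u(1)]] u q Ev by simp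
          then have "a = a'" using eq_check_iff u by blast
          moreover have "c = c'" using eq_check_iff u by simp
          ultimately have "c = b" using graph_unique b u by blast
          then show "frc t (FEq ?c ?b) (E'(?c := ck c))" using Ev eq_refl by simp
        qed
      qed
      moreover have "mem r (ck b) (ck w)" using mem_check_check_iff graph_mem b r by blast
      ultimately have "frc r ?\<phi> (e(?a := \<alpha>))"
        by (intro frc_FBexI[where \<tau> = "ck b"]) (use r ey in \<open>auto simp: E'_def\<close>)
      then show "\<exists>r\<in>elts P. le r q' \<and> frc r ?\<phi> (e(?a := \<alpha>))" using r by blast
    qed
  qed
  show ?thesis unfolding fm_function_def Let_def forces.simps(4) using 1 2 by blast
qed

lemma frc_fm_injective_on_restriction_name:
  assumes inj: "\<And>a b c. vpair a c \<in> elts g \<Longrightarrow> vpair b c \<in> elts g \<Longrightarrow> a = b"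
    and e: "\<And>i. nm (e i)" and ef: "e f = restriction_name g \<xi>"
  shows "frc p0 (fm_injective_on f x) e"
proof -
  let ?a = "f + x + 1" and ?b = "f + x + 2" and ?c = "f + x + 3"
  have n1: "?a \<noteq> x" and n2: "?b \<noteq> x" by simp_all
  show ?thesis unfolding fm_injective_on_def Let_def frc_FBall[OF p0 e n1]
  proof (intro allI impI ballI)
    fix \<alpha> q assume q: "nm \<alpha>" "q \<in> elts P" "le q p0"
    have E: "nm ((e(?a := \<alpha>)) i)" for i using e q by simp
    show "frc q (FBall ?b x (FAll ?c (FImp (FAnd (fm_rel f ?a ?c) (fm_rel f ?b ?c)) (FEq ?a ?b)))) (e(?a := \<alpha>))"
      unfolding frc_FBall[OF q(2) E n2] forces.simps(5)
    proof (intro allI impI ballI)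
      fix \<beta> q' \<gamma> assume q': "nm \<beta>" "q' \<in> elts P" "le q' q" and \<gamma>: "nm \<gamma>"
      define E' where "E' = e(?a := \<alpha>, ?b := \<beta>, ?c := \<gamma>)"
      have E': "nm (E' i)" for i using e q q' \<gamma> by (simp add: E'_def)
      have Ev: "E' f = restriction_name g \<xi>" "E' ?a = \<alpha>" "E' ?b = \<beta>" "E' ?c = \<gamma>" using ef by (simp_all add: E'_def)
      show "frc q' (FImp (FAnd (fm_rel f ?a ?c) (fm_rel f ?b ?c)) (FEq ?a ?b)) (e(?a := \<alpha>, ?b := \<beta>, ?c := \<gamma>))"
        unfolding E'_def[symmetric] frc_FImp[OF q'(2) E']
      proof (intro ballI impI)
        fix r assume r: "r \<in> elts P" "le r q'" "frc r (FAnd (fm_rel f ?a ?c) (fm_rel f ?b ?c)) E'"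
        show "frc r (FEq ?a ?b) E'"
        proof (rule frc_dense[OF r(1) E'])
          fix s assume s: "s \<in> elts P" "le s r"
          have fs: "frc s (fm_rel f ?a ?c) E'" "frc s (fm_rel f ?b ?c) E'" using frc_down[OF r(3,1) s] by simp_all
          obtain t a c where t: "t \<in> elts P" "le t s" "vpair a c \<in> elts g" "eq t (E' ?a) (ck a)" "eq t (E' ?c) (ck c)"
            by (rule frc_fm_rel_restriction_nameE[where e = E' and f = f, OF E' s(1) Ev(1) _ fs(1)]) auto
          have ft: "frc t (fm_rel f ?b ?c) E'" using frc_down fs(2) s t by blast
          obtain u b c' where u: "u \<in> elts P" "le u t" "vpair b c' \<in> elts g" "eq u (E' ?b) (ck b)" "eq u (E' ?c) (ck c')"
            by (rule frc_fm_rel_restriction_nameE[where e = E' and f = f, OF E' t(1) Ev(1) _ ft]) auto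
          have t': "eq u (E' ?a) (ck a)" "eq u (E' ?c) (ck c)" using eq_down t u by blast+
          have "eq u (ck c) (ck c')" using eq_trans[OF nm_check E' nm_check u(1) eq_sym[OF t'(2)] u(5)] .
          then have "c = c'" using eq_check_iff u by blast
          then have "a = b" using inj t(3) u(3) by blast
          then have "eq u (E' ?a) (E' ?b)" using eq_trans[OF E' nm_check E' u(1) t'(1)] eq_sym[OF u(4)] by simp
          then show "\<exists>r\<in>elts P. le r s \<and> frc r (FEq ?a ?b) E'"
            using u le_trans[of u t s] t s by auto
        qed
      qed
    qed
  qed
qed

end

lemma frc_fm_countable_of_bound:
  assumes z: "countable (elts z)" and e: "\<And>i. nm (e i)" and p: "p \<in> elts P"
    and bound: "\<And>q \<tau>. q \<in> elts P \<Longrightarrow> le q p \<Longrightarrow> nm \<tau> \<Longrightarrow> mem q \<tau> (e x) \<Longrightarrow>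
      \<exists>r\<in>elts P. le r q \<and> (\<exists>b\<in>elts z. eq r \<tau> (ck b))"
  shows "frc p (fm_countable x) e"
proof -
  have "sat UNIV (fm_countable 0) (\<lambda>_. z)" using z by simp
  then obtain w g where w: "is_omega w" and g: "function_graph g z w"
    and inj: "\<forall>a\<in>elts z. \<forall>b\<in>elts z. \<forall>c. vpair a c \<in> elts g \<and> vpair b c \<in> elts g \<longrightarrow> a = b"
    unfolding fm_countable_def Let_def by auto
  define \<xi> where "\<xi> = e x"
  have \<xi>: "nm \<xi>" using e by (simp add: \<xi>_def)
  let ?w = "x + 1" and ?f = "x + 2"
  define E where "E = e(?w := ck w, ?f := restriction_name g \<xi>)"
  have E: "nm (E i)" for i using e nm_restriction_name by (simp add: E_def)
  have Ev: "E ?w = ck w" "E ?f = restriction_name g \<xi>" "E x = \<xi>" by (simp_all add: E_def \<xi>_def)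
  note bound' = bound[folded \<xi>_def]
  have inj': "a = b" if "vpair a c \<in> elts g" "vpair b c \<in> elts g" for a b c
    using inj that graph_mem[OF g \<xi> p bound'] by blast
  have "frc p (fm_omega ?w) E \<longleftrightarrow> sat UNIV (fm_omega ?w) (\<lambda>_. w)"
    by (rule absolute_cong[OF absolute_fm_omega E p]) (use Ev eq_refl in auto)
  then have "frc p (fm_omega ?w) E" using w by simp
  moreover have "frc p (fm_function ?f x ?w) E"
    by (rule frc_fm_function_restriction_name[where e = E and f = ?f and x = x and y = ?w, OF g \<xi> p bound' E Ev(2,3,1)]) auto
  moreover have "frc p (fm_injective_on ?f x) E"
    by (rule frc_fm_injective_on_restriction_name[where e = E and f = ?f, OF g \<xi> p bound' inj' E Ev(2)])
  ultimately show ?thesis unfolding fm_countable_def Let_def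
    by (intro frc_FExI[where \<tau> = "ck w"] frc_FExI[where \<tau> = "restriction_name g \<xi>"])
      (use p nm_restriction_name in \<open>auto simp: E_def\<close>)
qed

text \<open>The generic bound turns witnesses into a countable ground model set that covers the
  forced set below an extension; an injection of the cover into \<open>\<omega>\<close> then
  restricts.\<close>

lemma frc_fm_countable_of_witness:
  assumes asp: "almost_strongly_proper P le" and e: "\<And>i. nm (e i)" and p: "p \<in> elts P"
    and sub: "\<And>q \<tau>. q \<in> elts P \<Longrightarrow> le q p \<Longrightarrow> nm \<tau> \<Longrightarrow> mem q \<tau> (e x) \<Longrightarrow> mem q \<tau> (ck T)"
    and witness: "\<And>q. q \<in> elts P \<Longrightarrow> le q p \<Longrightarrow>
      \<exists>B Z. countable B \<and> B \<subseteq> {r \<in> elts P. le r q} \<and> countable Z \<and>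
        (\<forall>t\<in>elts T - Z. \<exists>r\<in>B. \<forall>r'\<in>elts P. le r' r \<longrightarrow> r' \<notin> {s. mem s (ck t) (e x)})"
  shows "\<exists>r\<in>elts P. le r p \<and> frc r (fm_countable x) e"
proof -
  \<comment> \<open>A single set is to be bounded, so the family is constant in
    \<open>n\<close>.\<close>
  have "\<exists>q\<in>elts P. le q p \<and> (\<exists>Z. countable Z \<and> (\<forall>n :: nat. \<forall>t\<in>elts T - Z. \<forall>q'\<in>elts P. le q' q \<longrightarrow> q' \<notin> {s. mem s (ck t) (e x)}))"
    by (rule almost_strongly_proper_countable_bound[OF forcing_notion asp p _ witness]) (auto intro: mem_down)
  then obtain q Z where q: "q \<in> elts P" "le q p" and Z: "countable Z"
    and out: "\<And>t q'. t \<in> elts T - Z \<Longrightarrow> q' \<in> elts P \<Longrightarrow> le q' q \<Longrightarrow> \<not> mem q' (ck t) (e x)"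
    by blast
  have ez: "elts (vset (Z \<inter> elts T)) = Z \<inter> elts T"
    by (rule elts_vset) (rule small_subset[OF small_elts[of T]], blast)
  have "frc q (fm_countable x) e"
  proof (rule frc_fm_countable_of_bound[where z = "vset (Z \<inter> elts T)", OF _ e q(1)])
    show "countable (elts (vset (Z \<inter> elts T)))" using Z by (simp add: ez)
    fix r \<tau> assume r: "r \<in> elts P" "le r q" and \<tau>: "nm \<tau>" "mem r \<tau> (e x)"
    have "le r p" using le_trans[of r q p] r q p by blast
    then have "mem r \<tau> (ck T)" using sub r \<tau> by blast
    then obtain s t where s: "s \<in> elts P" "le s r" "t \<in> elts T" "eq s \<tau> (ck t)"
      using r(1) by (rule mem_checkE)
    have "mem s (ck t) (e x)" using mem_eq_cong[OF mem_down[OF \<tau>(2) r(1) s(1,2)] s(4,1) \<tau>(1) nm_check e] .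
    then have "t \<in> Z" using out[of t s] s le_trans[of s r q] r q by blast
    then show "\<exists>s\<in>elts P. le s r \<and> (\<exists>b\<in>elts (vset (Z \<inter> elts T)). eq s \<tau> (ck b))" using s ez by blast
  qed
  then show ?thesis using q by blast
qed

lemma frc_antichain_countable:
  assumes asp: "almost_strongly_proper P le" and tree: "ctbl_tree (elts T) (\<lambda>x y. vpair x y \<in> elts R)"
    and e: "\<And>i. nm (e i)" and p: "p \<in> elts P" and et: "e t = ck T" and er: "e r = ck R"
  shows "frc p (FImp (fm_antichain t r A) (fm_countable A)) e"
  unfolding frc_FImp[OF p e]
proof (intro ballI impI)
  fix q assume q: "q \<in> elts P" "frc q (fm_antichain t r A) e"
  let ?x = "t + r + A + 1" and ?y = "t + r + A + 2"
  show "frc q (fm_countable A) e"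
  proof (rule frc_dense[OF q(1) e])
    fix p0 assume p0: "p0 \<in> elts P" "le p0 q"
    have h: "frc p0 (fm_subset A t) e" "frc p0 (FBall ?x A (FBall ?y A (FNeg (fm_rel r ?x ?y)))) e"
      using frc_down[OF q(2,1) p0] by (simp_all add: fm_antichain_def Let_def)
    have n: "A + t + 1 \<noteq> A" "?x \<noteq> A" "?y \<noteq> A" by simp_all
    have sub: "mem s \<tau> (ck T)" if "s \<in> elts P" "le s p0" "nm \<tau>" "mem s \<tau> (e A)" for s \<tau>
      using h(1) that et unfolding fm_subset_def Let_def frc_FBall[OF p0(1) e n(1)] by simp
    \<comment> \<open>Every condition decides the relation between two check names, so nodes forced
      into the antichain by one condition are unrelated already in the ground model.\<close>
    have anti: "vpair a b \<notin> elts R" if s: "s \<in> elts P" "le s p0" "mem s (ck a) (e A)" "mem s (ck b) (e A)" for s a b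
    proof -
      define E where "E = e(?x := ck a)"
      have E: "nm (E i)" "nm ((E(?y := ck b)) i)" for i using e by (simp_all add: E_def)
      have Ev: "E A = e A" "E r = ck R" "E ?x = ck a" using er by (simp_all add: E_def)
      have f: "frc s (FBall ?y A (FNeg (fm_rel r ?x ?y))) E"
        unfolding E_def by (rule h(2)[unfolded frc_FBall[OF p0(1) e n(2)], rule_format, OF nm_check s(1-3)])
      have f': "frc s (FNeg (fm_rel r ?x ?y)) (E(?y := ck b))"
        by (rule f[unfolded frc_FBall[OF s(1) E(1) n(3)] Ev(1), rule_format, OF nm_check s(1) le_refl[OF s(1)] s(4)])
      then have "\<not> frc s (fm_rel r ?x ?y) (E(?y := ck b))" using s le_refl by simp
      moreover have "frc s (fm_rel r ?x ?y) (E(?y := ck b)) \<longleftrightarrow> vpair a b \<in> elts R"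
        by (rule frc_fm_rel_iff[OF E(2) s(1)]) (use Ev eq_refl in auto)
      ultimately show ?thesis by blast
    qed
    show "\<exists>r\<in>elts P. le r p0 \<and> frc r (fm_countable A) e"
    proof (rule frc_fm_countable_of_witness[OF asp e p0(1) sub])
      fix q assume q: "q \<in> elts P" "le q p0"
      show "\<exists>B Z. countable B \<and> B \<subseteq> {r \<in> elts P. le r q} \<and> countable Z \<and>
        (\<forall>t\<in>elts T - Z. \<exists>r\<in>B. \<forall>r'\<in>elts P. le r' r \<longrightarrow> r' \<notin> {s. mem s (ck t) (e A)})"
      proof (rule ctbl_tree.antichain_witness[OF tree, where ?p0.0 = p0])
        show "le p p" if "p \<in> elts P" for p using le_refl that .
        show "le p r" if "p \<in> elts P" "q \<in> elts P" "r \<in> elts P" "le p q" "le q r" for p q r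
          using le_trans that .
        show "q \<in> {s. mem s (ck t) (e A)}"
          if "p \<in> {s. mem s (ck t) (e A)}" "p \<in> elts P" "q \<in> elts P" "le q p" for p q t
          using mem_down that by simp
      qed (use anti q p0 in auto)
    qed
  qed
qed

lemma frc_chain_countable:
  assumes asp: "almost_strongly_proper P le" and tree: "ctbl_tree (elts T) (\<lambda>x y. vpair x y \<in> elts R)"
    and e: "\<And>i. nm (e i)" and p: "p \<in> elts P" and et: "e t = ck T" and er: "e r = ck R"
  shows "frc p (FImp (fm_chain t r A) (fm_countable A)) e"
  unfolding frc_FImp[OF p e]
proof (intro ballI impI)
  fix q assume q: "q \<in> elts P" "frc q (fm_chain t r A) e"
  let ?x = "t + r + A + 1" and ?y = "t + r + A + 2"
  let ?\<phi> = "FOr (FEq ?x ?y) (FOr (fm_rel r ?x ?y) (fm_rel r ?y ?x))"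
  show "frc q (fm_countable A) e"
  proof (rule frc_dense[OF q(1) e])
    fix p0 assume p0: "p0 \<in> elts P" "le p0 q"
    have h: "frc p0 (fm_subset A t) e" "frc p0 (FBall ?x A (FBall ?y A ?\<phi>)) e"
      using frc_down[OF q(2,1) p0] by (simp_all add: fm_chain_def Let_def)
    have n: "A + t + 1 \<noteq> A" "?x \<noteq> A" "?y \<noteq> A" by simp_all
    have sub: "mem s \<tau> (ck T)" if "s \<in> elts P" "le s p0" "nm \<tau>" "mem s \<tau> (e A)" for s \<tau>
      using h(1) that et unfolding fm_subset_def Let_def frc_FBall[OF p0(1) e n(1)] by simp
    have chain: "a = b \<or> vpair a b \<in> elts R \<or> vpair b a \<in> elts R"
      if s: "s \<in> elts P" "le s p0" "mem s (ck a) (e A)" "mem s (ck b) (e A)" for s a b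
    proof -
      define E where "E = e(?x := ck a)"
      have E: "nm (E i)" "nm ((E(?y := ck b)) i)" for i using e by (simp_all add: E_def)
      have Ev: "E A = e A" "E r = ck R" "E ?x = ck a" using er by (simp_all add: E_def)
      have f: "frc s (FBall ?y A ?\<phi>) E"
        unfolding E_def by (rule h(2)[unfolded frc_FBall[OF p0(1) e n(2)], rule_format, OF nm_check s(1-3)])
      have f': "frc s ?\<phi> (E(?y := ck b))"
        by (rule f[unfolded frc_FBall[OF s(1) E(1) n(3)] Ev(1), rule_format, OF nm_check s(1) le_refl[OF s(1)] s(4)])
      have "frc s ?\<phi> (E(?y := ck b)) \<longleftrightarrow> sat UNIV ?\<phi> ((\<lambda>_. R)(?x := a, ?y := b))"
        by (rule absolute_cong[OF _ E(2) s(1)]) (use Ev eq_refl in \<open>auto split: if_splits\<close>)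
      then show ?thesis using f' by simp
    qed
    show "\<exists>r\<in>elts P. le r p0 \<and> frc r (fm_countable A) e"
    proof (rule frc_fm_countable_of_witness[OF asp e p0(1) sub])
      fix q assume q: "q \<in> elts P" "le q p0"
      show "\<exists>B Z. countable B \<and> B \<subseteq> {r \<in> elts P. le r q} \<and> countable Z \<and>
        (\<forall>t\<in>elts T - Z. \<exists>r\<in>B. \<forall>r'\<in>elts P. le r' r \<longrightarrow> r' \<notin> {s. mem s (ck t) (e A)})"
      proof (rule ctbl_tree.chain_witness[OF tree, where ?p0.0 = p0])
        show "le p p" if "p \<in> elts P" for p using le_refl that .
        show "le p r" if "p \<in> elts P" "q \<in> elts P" "r \<in> elts P" "le p q" "le q r" for p q r
          using le_trans that .
        show "q \<in> {s. mem s (ck t) (e A)}"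
          if "p \<in> {s. mem s (ck t) (e A)}" "p \<in> elts P" "q \<in> elts P" "le q p" for p q t
          using mem_down that by simp
      qed (use chain q p0 in auto)
    qed
  qed
qed

end

section \<open>Preservation of the first uncountable ordinal\<close>

context forcing_preorder
begin

text \<open>The forcing clauses of \<open>fm_transitive\<close> freed of variables and environments,
  a form in which induction on names can be carried out.\<close>

definition frc_transitive :: "'v \<Rightarrow> 'v \<Rightarrow> bool" where
  "frc_transitive p a \<longleftrightarrow> (\<forall>\<tau>. nm \<tau> \<longrightarrow> (\<forall>q\<in>elts P. le q p \<longrightarrow> mem q \<tau> a \<longrightarrow>
     (\<forall>\<sigma>. nm \<sigma> \<longrightarrow> (\<forall>r\<in>elts P. le r q \<longrightarrow> mem r \<sigma> \<tau> \<longrightarrow> mem r \<sigma> a))))"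

definition frc_ordinal :: "'v \<Rightarrow> 'v \<Rightarrow> bool" where
  "frc_ordinal p a \<longleftrightarrow> frc_transitive p a \<and>
     (\<forall>\<tau>. nm \<tau> \<longrightarrow> (\<forall>q\<in>elts P. le q p \<longrightarrow> mem q \<tau> a \<longrightarrow> frc_transitive q \<tau>))"

lemma frc_fm_transitive_iff:
  assumes e: "\<And>i. nm (e i)" and p: "p \<in> elts P"
  shows "frc p (fm_transitive x) e \<longleftrightarrow> frc_transitive p (e x)"
proof -
  have n: "x + 1 \<noteq> x" "x + 1 + x + 1 \<noteq> x + 1" by simp_all
  have "frc q (fm_subset (x + 1) x) (e(x + 1 := \<tau>)) \<longleftrightarrow>
      (\<forall>\<sigma>. nm \<sigma> \<longrightarrow> (\<forall>r\<in>elts P. le r q \<longrightarrow> mem r \<sigma> \<tau> \<longrightarrow> mem r \<sigma> (e x)))"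
    if q: "q \<in> elts P" "nm \<tau>" for q \<tau>
  proof -
    define E where "E = e(x + 1 := \<tau>)"
    have E: "nm (E i)" for i using e q by (simp add: E_def)
    have Ev: "E x = e x" "E (x + 1) = \<tau>" by (simp_all add: E_def)
    show ?thesis unfolding E_def[symmetric] fm_subset_def Let_def frc_FBall[OF q(1) E n(2)]
      using Ev by simp
  qed
  then show ?thesis unfolding fm_transitive_def Let_def frc_FBall[OF p e n(1)] frc_transitive_def by blast
qed

lemma frc_fm_ordinal_iff:
  assumes e: "\<And>i. nm (e i)" and p: "p \<in> elts P"
  shows "frc p (fm_ordinal x) e \<longleftrightarrow> frc_ordinal p (e x)"
proof -
  have n: "x + 1 \<noteq> x" by simp
  have "frc q (fm_transitive (x + 1)) (e(x + 1 := \<tau>)) \<longleftrightarrow> frc_transitive q \<tau>" if q: "q \<in> elts P" "nm \<tau>" for q \<tau>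
  proof -
    have "nm ((e(x + 1 := \<tau>)) i)" for i using e q by simp
    from frc_fm_transitive_iff[where e = "e(x + 1 := \<tau>)" and x = "x + 1", OF this q(1)] show ?thesis by simp
  qed
  then show ?thesis unfolding fm_ordinal_def Let_def forces.simps(4) frc_FBall[OF p e n(1)] frc_ordinal_def
    frc_fm_transitive_iff[OF e p] by blast
qed

lemma frc_transitiveD:
  "frc_transitive p a \<Longrightarrow> p \<in> elts P \<Longrightarrow> nm \<tau> \<Longrightarrow> nm \<sigma> \<Longrightarrow> mem p \<tau> a \<Longrightarrow> mem p \<sigma> \<tau> \<Longrightarrow> mem p \<sigma> a"
  unfolding frc_transitive_def using le_refl by blast

lemma frc_transitive_down: "frc_transitive p a \<Longrightarrow> p \<in> elts P \<Longrightarrow> q \<in> elts P \<Longrightarrow> le q p \<Longrightarrow> frc_transitive q a"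
  unfolding frc_transitive_def using le_trans by blast

lemma frc_ordinal_down: "frc_ordinal p a \<Longrightarrow> p \<in> elts P \<Longrightarrow> q \<in> elts P \<Longrightarrow> le q p \<Longrightarrow> frc_ordinal q a"
  unfolding frc_ordinal_def using le_trans frc_transitive_down by blast

lemma frc_ordinal_mem:
  assumes "frc_ordinal p a" "p \<in> elts P" "nm \<tau>" "mem p \<tau> a" shows "frc_ordinal p \<tau>"
  unfolding frc_ordinal_def
proof (intro conjI allI impI ballI)
  show "frc_transitive p \<tau>" using assms le_refl unfolding frc_ordinal_def by blast
  fix \<sigma> q assume q: "nm \<sigma>" "q \<in> elts P" "le q p" "mem q \<sigma> \<tau>"
  have "frc_transitive q a" using assms frc_transitive_down q unfolding frc_ordinal_def by blast
  then have "mem q \<sigma> a" using frc_transitiveD[OF _ q(2) assms(3) q(1) mem_down[OF assms(4,2) q(2,3)] q(4)] by blast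
  then show "frc_transitive q \<sigma>" using assms q unfolding frc_ordinal_def by blast
qed

text \<open>Outer induction on the ground ordinal, inner induction on the name. If no extension of
  \<open>p\<close> forces an alternative, then \<open>p\<close> itself forces both inclusions, hence
  equality.\<close>

lemma frc_ordinal_trichotomy:
  assumes "ordinal \<beta>" "nm a" "p \<in> elts P" "frc_ordinal p a"
  shows "\<exists>r\<in>elts P. le r p \<and> (mem r a (ck \<beta>) \<or> eq r a (ck \<beta>) \<or> mem r (ck \<beta>) a)"
  using assms
proof (induction \<beta> arbitrary: a p rule: mem_induct)
  case (mem \<beta>)
  note IH\<beta> = mem.IH
  have \<beta>: "ordinal \<beta>" by fact
  from mem.prems(2-4) show ?case
  proof (induction a arbitrary: p rule: name_induct)
    case (name a)
    note p = \<open>p \<in> elts P\<close>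
    show ?case
    proof (rule ccontr)
      assume "\<not> ?case"
      then have no: "\<not> mem r a (ck \<beta>)" "\<not> eq r a (ck \<beta>)" "\<not> mem r (ck \<beta>) a" if "r \<in> elts P" "le r p" for r
        using that by blast+
      \<comment> \<open>The outer hypothesis compares \<open>a\<close> with \<open>\<gamma>\<close>;
        both \<open>a \<in> \<gamma>\<close> and \<open>a = \<gamma>\<close> would put
        \<open>a\<close> into \<open>\<beta>\<close>.\<close>
      have \<beta>a: "mem p (ck \<gamma>) a" if \<gamma>: "\<gamma> \<in> elts \<beta>" for \<gamma>
      proof (rule mem_dense[OF p])
        fix q assume q: "q \<in> elts P" "le q p"
        obtain r where r: "r \<in> elts P" "le r q" "mem r a (ck \<gamma>) \<or> eq r a (ck \<gamma>) \<or> mem r (ck \<gamma>) a"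
          using IH\<beta>[OF \<gamma> ordinal_mem[OF \<beta> \<gamma>] name.prems(1) q(1) frc_ordinal_down[OF name.prems(3) p q]] by blast
        have rp: "le r p" using le_trans r q p by blast
        have "\<not> mem r a (ck \<gamma>)"
        proof
          assume "mem r a (ck \<gamma>)"
          then obtain s \<delta> where s: "s \<in> elts P" "le s r" "\<delta> \<in> elts \<gamma>" "eq s a (ck \<delta>)" using r(1) by (rule mem_checkE)
          have "mem s (ck \<delta>) (ck \<beta>)" using mem_check_check_iff s ordinal_trans \<beta> \<gamma> by blast
          then have "mem s a (ck \<beta>)" using mem_eq_cong[OF _ eq_sym[OF s(4)] s(1)] name.prems(1) by simp
          then show False using no(1)[OF s(1)] le_trans[of s r p] s r rp p by blast
        qed
        moreover have "\<not> eq r a (ck \<gamma>)"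
        proof
          assume "eq r a (ck \<gamma>)"
          moreover have "mem r (ck \<gamma>) (ck \<beta>)" using mem_check_check_iff r \<gamma> by blast
          ultimately have "mem r a (ck \<beta>)" using mem_eq_cong[OF _ eq_sym r(1)] name.prems(1) by simp
          then show False using no(1) r rp by blast
        qed
        ultimately show "\<exists>r\<in>elts P. le r q \<and> mem r (ck \<gamma>) a" using r by blast
      qed
      \<comment> \<open>The inner hypothesis compares \<open>\<sigma>\<close> with
        \<open>\<beta>\<close>; both \<open>\<sigma> = \<beta>\<close> and
        \<open>\<beta> \<in> \<sigma>\<close> would put \<open>\<beta>\<close> into
        \<open>a\<close>, the latter by transitivity of \<open>a\<close>.\<close>
      have a\<beta>: "mem q \<sigma> (ck \<beta>)" if m: "vpair \<sigma> s \<in> elts a" and q: "q \<in> elts P" "le q p" "le q s" for \<sigma> s q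
      proof -
        have n\<sigma>: "nm \<sigma>" using nm_memD name.prems(1) m by blast
        have \<sigma>a: "mem q \<sigma> a" using mem_vpairI[OF name.prems(1) m q(3,1)] eq_refl[OF n\<sigma>] by blast
        show ?thesis
        proof (rule mem_dense[OF q(1)])
          fix q' assume q': "q' \<in> elts P" "le q' q"
          have q'p: "le q' p" using le_trans q' q p by blast
          have \<sigma>a': "mem q' \<sigma> a" using mem_down[OF \<sigma>a q(1) q'] .
          have oa: "frc_ordinal q' a" using frc_ordinal_down[OF name.prems(3) p q'(1) q'p] .
          obtain r where r: "r \<in> elts P" "le r q'" "mem r \<sigma> (ck \<beta>) \<or> eq r \<sigma> (ck \<beta>) \<or> mem r (ck \<beta>) \<sigma>"
            using name.IH[OF m n\<sigma> q'(1) frc_ordinal_mem[OF oa q'(1) n\<sigma> \<sigma>a']] by blast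
          have rp: "le r p" using le_trans r q' q'p p by blast
          have \<sigma>r: "mem r \<sigma> a" using mem_down[OF \<sigma>a' q'(1) r(1,2)] .
          have "\<not> eq r \<sigma> (ck \<beta>)"
            using mem_eq_cong[OF \<sigma>r _ r(1) n\<sigma> nm_check name.prems(1)] no(3)[OF r(1) rp] by blast
          moreover have "\<not> mem r (ck \<beta>) \<sigma>"
          proof
            assume "mem r (ck \<beta>) \<sigma>"
            moreover have "frc_transitive r a"
              using frc_ordinal_down[OF oa q'(1) r(1,2)] by (simp add: frc_ordinal_def)
            ultimately show False
              using frc_transitiveD[OF _ r(1) n\<sigma> nm_check \<sigma>r] no(3)[OF r(1) rp] by blast
          qed
          ultimately show "\<exists>r\<in>elts P. le r q' \<and> mem r \<sigma> (ck \<beta>)" using r by blast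
        qed
      qed
      have "eq p a (ck \<beta>)"
      proof (rule forces_eqI; intro allI impI ballI)
        show "mem q \<pi> (ck \<beta>)" if "vpair \<pi> s \<in> elts a" "q \<in> elts P" "le q p" "le q s" for \<pi> s q
          using a\<beta> that by blast
        show "mem q \<pi> a" if "vpair \<pi> s \<in> elts (ck \<beta>)" "q \<in> elts P" "le q p" "le q s" for \<pi> s q
          using that \<beta>a mem_down[OF _ p] unfolding vpair_mem_check by blast
      qed
      then show False using no(2)[OF p] le_refl[OF p] by blast
    qed
  qed
qed

section \<open>Names for the set of natural numbers\<close>

lemma is_omega_nonempty: "is_omega w \<Longrightarrow> elts w \<noteq> {}"
  by (auto simp: is_omega_def)

lemma is_omega_mem: "is_omega w \<Longrightarrow> k \<in> elts w \<Longrightarrow> \<not> is_omega k"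
  using is_omega_elts mem_irrefl extensionality by metis

lemma is_omega_not_succ: "is_omega w \<Longrightarrow> elts w \<noteq> insert k (elts k)"
proof
  assume w: "is_omega w" and k: "elts w = insert k (elts k)"
  then obtain m where m: "m \<in> elts w" "elts m = insert k (elts k)" unfolding is_omega_def by blast
  then have "m = w" using k extensionality by metis
  then show False using m mem_irrefl by metis
qed

lemma frc_fm_succ_mem:
  assumes "frc p (fm_succ x y) e" "p \<in> elts P" "\<And>k. nm (e k)"
  shows "mem p (e x) (e y)"
proof -
  let ?z = "x + y + 1" and ?E = "e(x + y + 1 := e x)"
  have E: "nm (?E k)" for k using assms by simp
  have "frc p (FIff (FMem ?z y) (FOr (FMem ?z x) (FEq ?z x))) ?E"
    using assms(1,3) unfolding fm_succ_def Let_def forces.simps(5) by blast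
  then have "frc p (FMem ?z y) ?E \<longleftrightarrow> frc p (FOr (FMem ?z x) (FEq ?z x)) ?E"
    unfolding frc_FIff[OF assms(2) E] using assms(2) le_refl by blast
  moreover have "frc p (FEq ?z x) ?E" using eq_refl assms(3) by simp
  ultimately show ?thesis using frc_FOrI2[OF assms(2)] by auto
qed

text \<open>Trichotomy leaves two alternatives to refute. A name decided as a member of
  \<open>w\<close> would make a natural number satisfy \<open>is_omega\<close>; a name with
  \<open>w\<close> as a member would force \<open>w\<close> to be empty or a successor.\<close>

lemma frc_fm_omega_eq:
  assumes w: "is_omega w" and e: "\<And>i. nm (e i)" and p: "p \<in> elts P" and f: "frc p (fm_omega i) e"
  shows "\<exists>r\<in>elts P. le r p \<and> eq r (e i) (ck w)"
proof -
  note f' = f[unfolded fm_omega_def Let_def]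
  have "frc_ordinal p (e i)" using f' unfolding forces.simps(4) frc_fm_ordinal_iff[OF e p] by blast
  moreover have "ordinal w" using w by (simp add: is_omega_def)
  ultimately obtain r where r: "r \<in> elts P" "le r p" "mem r (e i) (ck w) \<or> eq r (e i) (ck w) \<or> mem r (ck w) (e i)"
    using frc_ordinal_trichotomy e p by blast
  have "\<not> mem r (e i) (ck w)"
  proof
    assume "mem r (e i) (ck w)"
    then obtain s k where s: "s \<in> elts P" "le s r" "k \<in> elts w" "eq s (e i) (ck k)" using r(1) by (rule mem_checkE)
    have "frc s (fm_omega i) e \<longleftrightarrow> sat UNIV (fm_omega i) (\<lambda>_. k)"
      by (rule absolute_cong[OF absolute_fm_omega e s(1)]) (use s in simp)
    moreover have "frc s (fm_omega i) e" using frc_down[OF f p] s(1) le_trans[of s r p] s r p by blast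
    ultimately show False using is_omega_mem[OF w s(3)] by simp
  qed
  moreover have "\<not> mem r (ck w) (e i)"
  proof
    assume m: "mem r (ck w) (e i)"
    let ?n = "i + 1" and ?m = "i + 2"
    have ne: "?n \<noteq> i" "?m \<noteq> i" by simp_all
    define E where "E = e(?n := ck w)"
    have E: "nm (E k)" for k using e by (simp add: E_def)
    have Ev: "E ?n = ck w" by (simp add: E_def)
    have "frc p (FBall ?n i (FOr (fm_empty ?n) (FBex ?m i (fm_succ ?m ?n)))) e"
      using f' unfolding forces.simps(4) by blast
    then have "frc r (FOr (fm_empty ?n) (FBex ?m i (fm_succ ?m ?n))) E"
      unfolding E_def frc_FBall[OF p e ne(1)] using m r(1,2) nm_check by blast
    then obtain s where s: "s \<in> elts P" "le s r" "frc s (fm_empty ?n) E \<or> frc s (FBex ?m i (fm_succ ?m ?n)) E"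
      unfolding frc_FOr using r(1) le_refl by blast
    from s(3) show False
    proof
      assume "frc s (fm_empty ?n) E"
      moreover have "frc s (fm_empty ?n) E \<longleftrightarrow> sat UNIV (fm_empty ?n) (\<lambda>_. w)"
        by (rule absolute_cong[OF absolute_fm_empty E s(1)]) (use Ev eq_refl in simp)
      ultimately show False using is_omega_nonempty[OF w] by simp
    next
      assume "frc s (FBex ?m i (fm_succ ?m ?n)) E"
      then obtain t \<mu> where t: "t \<in> elts P" "le t s" "nm \<mu>" "frc t (fm_succ ?m ?n) (E(?m := \<mu>))"
        using s(1) ne(2) by (rule frc_FBexE)
      have E': "nm ((E(?m := \<mu>)) k)" for k using E t by simp
      have "mem t \<mu> (ck w)" using frc_fm_succ_mem[OF t(4,1) E'] Ev by simp
      then obtain u k where u: "u \<in> elts P" "le u t" "k \<in> elts w" "eq u \<mu> (ck k)" using t(1) by (rule mem_checkE)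
      have "frc u (fm_succ ?m ?n) (E(?m := \<mu>)) \<longleftrightarrow> sat UNIV (fm_succ ?m ?n) ((\<lambda>_. w)(?m := k))"
        by (rule absolute_cong[OF absolute_fm_succ E' u(1)]) (use u Ev eq_refl in auto)
      moreover have "frc u (fm_succ ?m ?n) (E(?m := \<mu>))" using frc_down[OF t(4,1) u(1,2)] .
      ultimately show False using is_omega_not_succ[OF w] by simp
    qed
  qed
  ultimately show ?thesis using r by blast
qed

text \<open>Fixed variable indices make occurrences of \<open>fm_rel\<close> in different formulas comparable.\<close>

definition frc_pair_mem :: "'v \<Rightarrow> 'v \<Rightarrow> 'v \<Rightarrow> 'v \<Rightarrow> bool" where
  "frc_pair_mem p f a b \<longleftrightarrow> frc p (fm_rel 0 1 2) ((\<lambda>_. b)(0 := f, 1 := a))"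

text \<open>Bound variables are chosen above all parameters, so full unfolding leaves a condition on
  the three values alone.\<close>

lemma frc_fm_rel_eq:
  assumes "distinct [r, x, y]"
  shows "frc p (fm_rel r x y) e \<longleftrightarrow> frc_pair_mem p (e r) (e x) (e y)"
  unfolding frc_pair_mem_def
  using assms by (simp add: fm_rel_def fm_pair_def fm_upair_def FBex_def FEx_def FIff_def FImp_def FOr_def Let_def)

lemma frc_pair_mem_down: "frc_pair_mem p f a b \<Longrightarrow> p \<in> elts P \<Longrightarrow> q \<in> elts P \<Longrightarrow> le q p \<Longrightarrow> frc_pair_mem q f a b"
  unfolding frc_pair_mem_def by (rule frc_down)

lemma frc_pair_mem_cong:
  assumes "frc_pair_mem p f a b" "p \<in> elts P" "nm f" "nm a" "nm b" "nm b'" "eq p b b'"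
  shows "frc_pair_mem p f a b'"
  unfolding frc_pair_mem_def
  by (rule frc_cong[where e = "(\<lambda>_. b)(0 := f, 1 := a)"])
    (use assms eq_refl in \<open>auto simp: frc_pair_mem_def\<close>)

lemma frc_fm_functionD:
  assumes f: "frc p (fm_function f x y) e" and e: "\<And>i. nm (e i)" and p: "p \<in> elts P"
    and a: "nm \<alpha>" "mem p \<alpha> (e x)"
  obtains r \<beta> where "r \<in> elts P" "le r p" "nm \<beta>" "mem r \<beta> (e y)" "frc_pair_mem r (e f) \<alpha> \<beta>"
proof -
  let ?a = "f + x + y + 2" and ?b = "f + x + y + 3" and ?c = "f + x + y + 4"
  have n: "?a \<noteq> x" "?b \<noteq> y" by simp_all
  have "frc p (FBex ?b y (FAnd (fm_rel f ?a ?b) (FBall ?c y (FImp (fm_rel f ?a ?c) (FEq ?c ?b))))) (e(?a := \<alpha>))"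
    using f a le_refl[OF p] p unfolding fm_function_def Let_def forces.simps(4) frc_FBall[OF p e n(1)] by blast
  then obtain r \<beta> where r: "r \<in> elts P" "le r p" "nm \<beta>" "mem r \<beta> ((e(?a := \<alpha>)) y)"
      "frc r (FAnd (fm_rel f ?a ?b) (FBall ?c y (FImp (fm_rel f ?a ?c) (FEq ?c ?b)))) (e(?a := \<alpha>, ?b := \<beta>))"
    using p n(2) by (rule frc_FBexE)
  have "distinct [f, ?a, ?b]" by simp
  from frc_fm_rel_eq[OF this] r(5) have "frc_pair_mem r (e f) \<alpha> \<beta>" by simp
  then show ?thesis using that r by simp
qed

lemma frc_fm_injective_onD:
  assumes f: "frc p (fm_injective_on f x) e" and e: "\<And>i. nm (e i)" and p: "p \<in> elts P"
    and nm: "nm \<alpha>" "nm \<beta>" "nm \<gamma>" and m: "mem p \<alpha> (e x)" "mem p \<beta> (e x)"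
    and r: "frc_pair_mem p (e f) \<alpha> \<gamma>" "frc_pair_mem p (e f) \<beta> \<gamma>"
  shows "eq p \<alpha> \<beta>"
proof -
  let ?a = "f + x + 1" and ?b = "f + x + 2" and ?c = "f + x + 3"
  have n: "?a \<noteq> x" "?b \<noteq> x" by simp_all
  define E where "E = e(?a := \<alpha>)"
  have E: "nm (E i)" for i using e nm by (simp add: E_def)
  have "frc p (FBall ?b x (FAll ?c (FImp (FAnd (fm_rel f ?a ?c) (fm_rel f ?b ?c)) (FEq ?a ?b)))) E"
    using f m(1) nm(1) le_refl[OF p] p unfolding E_def fm_injective_on_def Let_def frc_FBall[OF p e n(1)] by blast
  moreover have "mem p \<beta> (E x)" using m by (simp add: E_def)
  ultimately have "frc p (FAll ?c (FImp (FAnd (fm_rel f ?a ?c) (fm_rel f ?b ?c)) (FEq ?a ?b))) (E(?b := \<beta>))"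
    using nm(2) le_refl[OF p] p unfolding frc_FBall[OF p E n(2)] by blast
  then have "frc p (FImp (FAnd (fm_rel f ?a ?c) (fm_rel f ?b ?c)) (FEq ?a ?b)) (E(?b := \<beta>, ?c := \<gamma>))"
    using nm(3) unfolding forces.simps(5) by blast
  moreover have E': "nm ((E(?b := \<beta>, ?c := \<gamma>)) i)" for i using E nm by simp
  moreover have "distinct [f, ?a, ?c]" "distinct [f, ?b, ?c]" by simp_all
  note this[THEN frc_fm_rel_eq]
  then have "frc p (FAnd (fm_rel f ?a ?c) (fm_rel f ?b ?c)) (E(?b := \<beta>, ?c := \<gamma>))"
    using r by (simp add: E_def)
  ultimately have "frc p (FEq ?a ?b) (E(?b := \<beta>, ?c := \<gamma>))"
    using le_refl[OF p] p unfolding frc_FImp[OF p E'] by blast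
  then show ?thesis by (simp add: E_def)
qed

text \<open>For a forced injection \<open>F\<close> into \<open>\<omega>\<close>, let
  \<open>\<Phi> n a\<close> be the conditions forcing \<open>F\<close> to map \<open>a\<close> to
  \<open>n\<close>. The generic bound yields some \<open>a\<close> in \<open>h\<close> that cannot
  be mapped to any \<open>n\<close>, against totality of \<open>F\<close>.\<close>

lemma not_frc_fm_countable_of_uncountable:
  assumes asp: "almost_strongly_proper P le" and h: "uncountable (elts h)"
    and e: "\<And>i. nm (e i)" and p: "p \<in> elts P" and sub: "\<And>a. a \<in> elts h \<Longrightarrow> mem p (ck a) (e x)"
  shows "\<not> frc p (fm_countable x) e"
proof
  let ?w = "x + 1" and ?f = "x + 2"
  assume "frc p (fm_countable x) e"
  then obtain q W where q: "q \<in> elts P" "le q p" "nm W"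
    "frc q (FEx ?f (FAnd (fm_omega ?w) (FAnd (fm_function ?f x ?w) (fm_injective_on ?f x)))) (e(?w := W))"
    unfolding fm_countable_def Let_def using p by (rule frc_FExE)
  obtain r F where r: "r \<in> elts P" "le r q" "nm F"
    "frc r (FAnd (fm_omega ?w) (FAnd (fm_function ?f x ?w) (fm_injective_on ?f x))) (e(?w := W, ?f := F))"
    using q(4,1) by (rule frc_FExE)
  define E where "E = e(?w := W, ?f := F)"
  have E: "nm (E i)" for i using e q r by (simp add: E_def)
  have Ev: "E ?w = W" "E ?f = F" "E x = e x" by (simp_all add: E_def)
  have om: "frc r (fm_omega ?w) E" and fu: "frc r (fm_function ?f x ?w) E" and inj: "frc r (fm_injective_on ?f x) E"
    using r(4) by (simp_all add: E_def)
  obtain w :: 'v where w: "is_omega w" using ex_is_omega by blast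
  \<comment> \<open>The formula brings its own name for \<open>\<omega>\<close>; below
    \<open>s\<close> it equals \<open>ck w\<close>, so values of \<open>F\<close> can be decided as
    numerals.\<close>
  obtain s where s: "s \<in> elts P" "le s r" "eq s W (ck w)"
    using frc_fm_omega_eq[OF w E r(1) om] Ev by auto
  have sp: "le s p" using le_trans[of s r q] le_trans[of s q p] s r q p by blast
  have fu': "frc s (fm_function ?f x ?w) E" and inj': "frc s (fm_injective_on ?f x) E"
    using frc_down[OF fu r(1) s(1,2)] frc_down[OF inj r(1) s(1,2)] .
  have "\<exists>q\<in>elts P. le q s \<and> (\<exists>Z. countable Z \<and>
      (\<forall>n. \<forall>a\<in>elts h - Z. \<forall>q'\<in>elts P. le q' q \<longrightarrow> q' \<notin> {u. frc_pair_mem u F (ck a) (ck (num n))}))"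
  proof (rule almost_strongly_proper_countable_bound[OF forcing_notion asp s(1)])
    show "q \<in> {u. frc_pair_mem u F (ck t) (ck (num n))}"
      if "p \<in> {u. frc_pair_mem u F (ck t) (ck (num n))}" "p \<in> elts P" "q \<in> elts P" "le q p" for n t p q
      using frc_pair_mem_down that by simp
    fix n q assume q: "q \<in> elts P" "le q s"
    show "\<exists>B Z. countable B \<and> B \<subseteq> {r \<in> elts P. le r q} \<and> countable Z \<and>
        (\<forall>t\<in>elts h - Z. \<exists>r\<in>B. \<forall>r'\<in>elts P. le r' r \<longrightarrow> r' \<notin> {u. frc_pair_mem u F (ck t) (ck (num n))})"
    \<comment> \<open>If the value \<open>n\<close> can be attained below \<open>q\<close>, a
      condition attaining it at \<open>t\<close> excludes all other arguments by injectivity; if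
      not, \<open>q\<close> itself excludes every argument.\<close>
    proof (cases "\<exists>u\<in>elts P. le u q \<and> (\<exists>t\<in>elts h. frc_pair_mem u F (ck t) (ck (num n)))")
      case True
      then obtain u t where u: "u \<in> elts P" "le u q" "t \<in> elts h" "frc_pair_mem u F (ck t) (ck (num n))" by blast
      have "\<not> frc_pair_mem v F (ck t') (ck (num n))" if t': "t' \<in> elts h" "t' \<noteq> t" "v \<in> elts P" "le v u" for t' v
      proof
        assume v: "frc_pair_mem v F (ck t') (ck (num n))"
        have vs: "le v s" using le_trans[of v u q] le_trans[of v q s] t' u q s by blast
        then have vp: "le v p" using le_trans[of v s p] t' s sp p by blast
        have "frc v (fm_injective_on ?f x) E" using frc_down[OF inj' s(1) t'(3) vs] .
        moreover have "mem v (ck t) (E x)" "mem v (ck t') (E x)"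
          using mem_down[OF sub p t'(3) vp] u t' Ev by simp_all
        moreover have "frc_pair_mem v (E ?f) (ck t) (ck (num n))" "frc_pair_mem v (E ?f) (ck t') (ck (num n))"
          using frc_pair_mem_down[OF u(4,1) t'(3,4)] v Ev by simp_all
        ultimately have "eq v (ck t) (ck t')" using frc_fm_injective_onD[where e = E and f = ?f and x = x, OF _ E t'(3) nm_check nm_check nm_check] by blast
        then show False using t'(2) by (simp add: eq_check_iff[OF t'(3)])
      qed
      then show ?thesis using u by (intro exI[of _ "{u}"] exI[of _ "{t}"]) auto
    next
      case False
      then show ?thesis using q le_refl by (intro exI[of _ "{q}"] exI[of _ "{}"]) auto
    qed
  qed
  then obtain q1 Z where q1: "q1 \<in> elts P" "le q1 s" and Z: "countable Z"
    and out: "\<And>n a u. a \<in> elts h - Z \<Longrightarrow> u \<in> elts P \<Longrightarrow> le u q1 \<Longrightarrow> \<not> frc_pair_mem u F (ck a) (ck (num n))"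
    by blast
  obtain a where a: "a \<in> elts h - Z" using h Z countable_subset[of "elts h" Z] by blast
  have q1p: "le q1 p" using le_trans[of q1 s p] q1 s sp p by blast
  have "mem q1 (ck a) (E x)" using mem_down[OF sub p q1(1) q1p] a Ev by simp
  then obtain u \<beta> where u: "u \<in> elts P" "le u q1" "nm \<beta>" "mem u \<beta> (E ?w)" "frc_pair_mem u (E ?f) (ck a) \<beta>"
    by (rule frc_fm_functionD[OF frc_down[OF fu' s(1) q1] E q1(1) nm_check])
  have "le u s" using le_trans[of u q1 s] u q1 s by blast
  then have "mem u \<beta> (ck w)"
    using mem_cong[of \<beta> \<beta> W "ck w" u] u q(3) eq_refl[OF u(3)] eq_down[OF s(3,1) u(1)] Ev by simp
  then obtain v b where v: "v \<in> elts P" "le v u" "b \<in> elts w" "eq v \<beta> (ck b)" using u(1) by (rule mem_checkE)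
  then obtain n where "b = num n" using is_omega_elts[OF w] by blast
  moreover have "frc_pair_mem v F (ck a) \<beta>" using frc_pair_mem_down[OF u(5,1) v(1,2)] Ev by simp
  ultimately have "frc_pair_mem v F (ck a) (ck (num n))"
    using frc_pair_mem_cong[OF _ v(1) r(3) nm_check u(3) nm_check v(4)] by blast
  then show False using out[OF a v(1)] le_trans[of v u q1] v u q1 by blast
qed

text \<open>Countable ordinals of the ground model stay so by upward absoluteness. Conversely, a
  forced ordinal that is not below \<open>ck H\<close> contains every member of \<open>ck H\<close>,
  and is then not countable.\<close>

lemma frc_fm_omega1:
  assumes asp: "almost_strongly_proper P le" and H: "elts H = {a. ordinal a \<and> countable (elts a)}"
    and e: "\<And>i. nm (e i)" and p: "p \<in> elts P" and eh: "e h = ck H"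
  shows "frc p (fm_omega1 h) e"
  unfolding fm_omega1_def Let_def forces.simps(5)
proof (intro allI impI)
  fix \<alpha> assume \<alpha>: "nm \<alpha>"
  let ?a = "h + 1"
  define E where "E = e(?a := \<alpha>)"
  have E: "nm (E i)" for i using e \<alpha> by (simp add: E_def)
  have Ev: "E ?a = \<alpha>" "E h = ck H" using eh by (simp_all add: E_def)
  show "frc p (FIff (FMem ?a h) (FAnd (fm_ordinal ?a) (fm_countable ?a))) (e(?a := \<alpha>))"
    unfolding E_def[symmetric] frc_FIff[OF p E]
  proof (intro ballI impI iffI)
    fix q assume q: "q \<in> elts P" "frc q (FMem ?a h) E"
    show "frc q (FAnd (fm_ordinal ?a) (fm_countable ?a)) E"
    proof (rule frc_dense[OF q(1) E])
      fix q' assume q': "q' \<in> elts P" "le q' q"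
      have "mem q' \<alpha> (ck H)" using mem_down[OF _ q(1) q'] q(2) Ev by simp
      then obtain r a where r: "r \<in> elts P" "le r q'" "a \<in> elts H" "eq r \<alpha> (ck a)" using q'(1) by (rule mem_checkE)
      have "frc r (fm_ordinal ?a) E \<longleftrightarrow> sat UNIV (fm_ordinal ?a) (\<lambda>_. a)"
        by (rule absolute_cong[OF absolute_fm_ordinal E r(1)]) (use r Ev in simp)
      moreover have "frc r (fm_countable ?a) E"
        by (rule upward_absolute_cong[where v = "\<lambda>_. a", OF upward_absolute_fm_countable E r(1)])
          (use r Ev H in simp_all)
      ultimately show "\<exists>r\<in>elts P. le r q' \<and> frc r (FAnd (fm_ordinal ?a) (fm_countable ?a)) E"
        using r H by auto
    qed
  next
    fix q assume q: "q \<in> elts P" "frc q (FAnd (fm_ordinal ?a) (fm_countable ?a)) E"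
    have "mem q \<alpha> (ck H)"
    proof (rule mem_dense[OF q(1)])
      fix q' assume q': "q' \<in> elts P" "le q' q"
      have oc: "frc q' (fm_ordinal ?a) E" "frc q' (fm_countable ?a) E" using frc_down[OF q(2,1) q'] by simp_all
      have "frc_ordinal q' \<alpha>" using oc(1) unfolding frc_fm_ordinal_iff[OF E q'(1)] Ev(1) .
      then obtain r where r: "r \<in> elts P" "le r q'" "mem r \<alpha> (ck H) \<or> eq r \<alpha> (ck H) \<or> mem r (ck H) \<alpha>"
        using frc_ordinal_trichotomy[OF uncountable_omega1(2)[OF H] \<alpha> q'(1)] by blast
      have tr: "frc_transitive r \<alpha>"
        using frc_ordinal_down[OF \<open>frc_ordinal q' \<alpha>\<close> q'(1) r(1,2)] by (simp add: frc_ordinal_def)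
      have "mem r \<alpha> (ck H)"
      proof (rule ccontr)
        assume "\<not> mem r \<alpha> (ck H)"
        then have c: "eq r \<alpha> (ck H) \<or> mem r (ck H) \<alpha>" using r by blast
        have "mem r (ck a) (E ?a)" if a: "a \<in> elts H" for a
        proof -
          have m: "mem r (ck a) (ck H)" using mem_check_check_iff r a by blast
          from c show ?thesis unfolding Ev(1)
          proof
            assume "eq r \<alpha> (ck H)"
            then show "mem r (ck a) \<alpha>"
              using mem_cong[OF _ _ _ \<alpha> r(1) eq_refl eq_sym m] by simp
          next
            assume "mem r (ck H) \<alpha>"
            then show "mem r (ck a) \<alpha>" using frc_transitiveD[OF tr r(1) nm_check nm_check _ m] by blast
          qed
        qed
        then have "\<not> frc r (fm_countable ?a) E"
          by (rule not_frc_fm_countable_of_uncountable[OF asp uncountable_omega1(1)[OF H] E r(1)])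
        then show False using frc_down[OF oc(2) q'(1) r(1,2)] by simp
      qed
      then show "\<exists>r\<in>elts P. le r q' \<and> mem r \<alpha> (ck H)" using r by blast
    qed
    then show "frc q (FMem ?a h) E" using Ev by simp
  qed
qed

end

theorem corollary1p7:
  fixes P :: "'v::zfc_universe" and le :: "'v \<Rightarrow> 'v \<Rightarrow> bool"
  assumes "forcing_notion P le"
    and "almost_strongly_proper P le"
  shows "preserves_suslinity P le"
proof -
  interpret forcing_preorder P le by standard fact
  have "frc p (fm_suslin_tree 0 1) (env2 (ck T) (ck R))" if S: "suslin_tree T R" and p: "p \<in> elts P" for T R p
  proof -
    define e where "e = env2 (ck T) (ck R)"
    have ec: "e = ck \<circ> env2 T R" by (auto simp: e_def env2_def)
    have e: "nm (e i)" for i by (simp add: ec)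
    have ev: "e 0 = ck T" "e 1 = ck R" by (simp_all add: e_def env2_def)
    note tree = ctbl_tree_of_suslin_tree[OF S]
    note S' = S[unfolded suslin_tree_iff]
    have "frc p (fm_tree 0 1) e" unfolding ec by (rule frc_fm_tree[OF conjunct1[OF S'] p])
    \<comment> \<open>The Suslin property supplies the set \<open>H\<close> of countable ordinals;
      its check name is the witness for the first uncountable ordinal of the extension.\<close>
    moreover obtain H where H: "elts H = {a. ordinal a \<and> countable (elts a)}"
      and ht: "sat UNIV (fm_tree_height 0 1 2) ((env2 T R)(2 := H))"
      using S' by blast
    have "frc p (FEx 2 (FAnd (fm_omega1 2) (fm_tree_height 0 1 2))) e"
    proof (rule frc_FExI[OF p nm_check[of H]])
      have "nm ((e(2 := ck H)) i)" for i using e by simp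
      then have "frc p (fm_omega1 2) (e(2 := ck H))"
        by (rule frc_fm_omega1[OF assms(2) H _ p]) simp
      moreover have "frc p (fm_tree_height 0 1 2) (e(2 := ck H))"
        using upward_absolute_fm_tree_height ht p unfolding upward_absolute_def ec comp_check_upd[symmetric] by blast
      ultimately show "frc p (FAnd (fm_omega1 2) (fm_tree_height 0 1 2)) (e(2 := ck H))" by simp
    qed
    moreover have "frc p (FImp (fm_chain 0 1 3) (fm_countable 3)) (e(3 := \<tau>))"
      and "frc p (FImp (fm_antichain 0 1 3) (fm_countable 3)) (e(3 := \<tau>))" if "nm \<tau>" for \<tau>
    proof -
      have E: "nm ((e(3 := \<tau>)) i)" for i using e that by simp
      show "frc p (FImp (fm_chain 0 1 3) (fm_countable 3)) (e(3 := \<tau>))"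
        by (rule frc_chain_countable[OF assms(2) tree E p]) (use ev in auto)
      show "frc p (FImp (fm_antichain 0 1 3) (fm_countable 3)) (e(3 := \<tau>))"
        by (rule frc_antichain_countable[OF assms(2) tree E p]) (use ev in auto)
    qed
    \<comment> \<open>\<open>fm_suslin_tree\<close> computes its bound variables from its
      parameters; for 0 and 1 they are 2 and 3.\<close>
    moreover have n: "(0 + 1 + 1 :: nat) = 2" "(0 + 1 + 2 :: nat) = 3" by simp_all
    ultimately have "frc p (fm_suslin_tree 0 1) e"
      unfolding fm_suslin_tree_def Let_def n forces.simps(4,5) by blast
    then show ?thesis by (simp add: e_def)
  qed
  then show ?thesis unfolding preserves_suslinity_def holds_in_all_generic_extensions_def by blast
qed

end
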